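(* Let $n\in\mathbb{N}$, $m\in\mathbb{N}$ and $-1<a<m$. (i) If $a=k\in\mathbb{N}_0$, suppose that $f_j\in B^{m-k-j,1}(\mathbb{R}^n)$ for $j=0,\dots,m-k-1$, and $f_{m-k}\in L^1(\mathbb{R}^n)$. Then there exists $F\in W^{m+1,1}_k(\mathbb{R}^{n+1}_+)$ such that $\operatorname{Tr}(F)=f_0$, $\operatorname{Tr}\big(\frac{\partial^jF}{\partial t^j}\big)=f_j$ for $j=1,\dots,m-k$, and $$\|F\|_{W^{m+1,1}_k(\mathbb{R}^{n+1}_+)}\le C\Big(\sum_{j=0}^{m-k-1}\|f_j\|_{B^{m-k-j,1}(\mathbb{R}^n)}+\|f_{m-k}\|_{L^1(\mathbb{R}^n)}\Big).$$ (ii) If $a\notin\mathbb{N}_0$, let $l:=\lfloor m-a\rfloor$ and suppose that $f_j\in B^{m-a-j,1}(\mathbb{R}^n)$ for $j=0,\dots,l$. Then there exists $F\in W^{m+1,1}_a(\mathbb{R}^{n+1}_+)$ such that $\operatorname{Tr}(F)=f_0$, $\operatorname{Tr}\big(\frac{\partial^jF}{\partial t^j}\big)=f_j$ for $j=1,\dots,l$, and $$\|F\|_{W^{m+1,1}_a(\mathbb{R}^{n+1}_+)}\le C\sum_{j=0}^{l}\|f_j\|_{B^{m-a-j,1}(\mathbb{R}^n)}.$$ Here $C>0$ is a constant depending only on $n,m,a$ (not on the $f_j$).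
   Context: $\mathbb{N}_0=\{0,1,2,\dots\}$, $\mathbb{N}=\{1,2,\dots\}$, $\mathbb{R}^{n+1}_+=\mathbb{R}^n\times(0,\infty)$ with points $(x,t)$. $\nabla^{k}u$ is the tensor of all (weak) partial derivatives of order $k$ of $u$ jointly in $(x,t)$. Weighted Sobolev space: $W^{m+1,1}_a(\mathbb{R}^{n+1}_+)$ is the space of all $u\in W^{m+1,1}_{\mathrm{loc}}(\mathbb{R}^{n+1}_+)$ with $$\|u\|_{W^{m+1,1}_a(\mathbb{R}^{n+1}_+)}:=\int_{\mathbb{R}^{n+1}_+}t^a|u(x,t)|\,dx\,dt+\sum_{j=1}^{m+1}\int_{\mathbb{R}^{n+1}_+}t^a|\nabla^ju(x,t)|\,dx\,dt<\infty.$$ Trace: $\operatorname{Tr}$ is the usual trace on $\{t=0\}\cong\mathbb{R}^n$, i.e. $\operatorname{Tr}(v)=g$ means that $v(\cdot,t)\to g$ in $L^1_{\mathrm{loc}}(\mathbb{R}^n)$ as $t\to0^+$ (for functions continuous up to $t=0$ it is the restriction to $t=0$). Differences: $\Delta_hf(x)=f(x+h)-f(x)$, $\Delta_h^{k+1}f=\Delta_h^k(\Delta_hf)$. Besov spaces. For $0<s\le1$ put $|f|_{B^{s,1}(\mathbb{R}^n)}:=\int_{\mathbb{R}^n}\|\Delta_h^{\lfloor s\rfloor+1}f\|_{L^1(\mathbb{R}^n)}\frac{dh}{|h|^{n+s}}$ (first differences if $s<1$, second differences if $s=1$); $B^{s,1}(\mathbb{R}^n)$ is the set of $f\in L^1(\mathbb{R}^n)$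 with $|f|_{B^{s,1}}<\infty$, with norm $\|f\|_{B^{s,1}}:=\|f\|_{L^1}+|f|_{B^{s,1}}$. For $s>1$ let $\ell=\max\{j\in\mathbb{N}:j<s\}$; $B^{s,1}(\mathbb{R}^n)$ is the set of $f\in W^{\ell,1}(\mathbb{R}^n)$ with $|f|_{B^{s,1}}:=\sum_{|\alpha|=\ell}\big|\frac{\partial^\alpha f}{\partial x^\alpha}\big|_{B^{s-\ell,1}}<\infty$, with norm $\|f\|_{B^{s,1}}:=\|f\|_{W^{\ell,1}}+|f|_{B^{s,1}}$. *)

theory Defs
  imports "HOL-Analysis.Analysis" "HOL-Library.Multiset"
begin

section \<open>Test functions and weak derivatives\<close>

definition partial_deriv :: "'a::euclidean_space \<Rightarrow> ('a \<Rightarrow> real) \<Rightarrow> 'a \<Rightarrow> real" where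
  "partial_deriv b \<phi> x = deriv (\<lambda>s. \<phi> (x + s *\<^sub>R b)) 0"

definition partial_derivs :: "'a::euclidean_space list \<Rightarrow> ('a \<Rightarrow> real) \<Rightarrow> 'a \<Rightarrow> real" where
  "partial_derivs bs \<phi> = foldr partial_deriv bs \<phi>"

text \<open>Every iterated partial derivative is (Frechet) differentiable, hence continuous, so this is
  the usual class of infinitely differentiable functions.\<close>

definition smooth_fun :: "('a::euclidean_space \<Rightarrow> real) \<Rightarrow> bool" where
  "smooth_fun \<phi> \<longleftrightarrow> (\<forall>bs\<in>lists Basis. partial_derivs bs \<phi> differentiable_on UNIV)"

definition test_fun :: "'a::euclidean_space set \<Rightarrow> ('a \<Rightarrow> real) set" where
  "test_fun \<Omega> = {\<phi>. smooth_fun \<phi> \<and> compact (closure {x. \<phi> x \<noteq> 0}) \<and> closure {x. \<phi> x \<noteq> 0} \<subseteq> \<Omega>}"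

definition locally_integrable :: "'a::euclidean_space set \<Rightarrow> ('a \<Rightarrow> real) \<Rightarrow> bool" where
  "locally_integrable \<Omega> u \<longleftrightarrow> (\<forall>K. compact K \<and> K \<subseteq> \<Omega> \<longrightarrow> u absolutely_integrable_on K)"

text \<open>A multi-index is a multiset of coordinate directions: the multiplicity of \<open>b\<close> is the number
  of derivatives taken in direction \<open>b\<close>, and \<open>size\<close> is the order.\<close>

definition multi_indices :: "nat \<Rightarrow> 'a::euclidean_space multiset set" where
  "multi_indices k = {\<alpha>. set_mset \<alpha> \<subseteq> Basis \<and> size \<alpha> = k}"

lemma finite_multi_indices: "finite (multi_indices k :: 'a::euclidean_space multiset set)"
proof -
  have "multi_indices k \<subseteq> mset ` {xs. set xs \<subseteq> (Basis :: 'a set) \<and> length xs = k}"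
  proof
    fix \<alpha> :: "'a multiset"
    assume \<alpha>: "\<alpha> \<in> multi_indices k"
    obtain xs where "mset xs = \<alpha>" using ex_mset by blast
    with \<alpha> show "\<alpha> \<in> mset ` {xs. set xs \<subseteq> Basis \<and> length xs = k}"
      unfolding multi_indices_def by fastforce
  qed
  moreover have "finite {xs. set xs \<subseteq> (Basis :: 'a set) \<and> length xs = k}"
    by (rule finite_lists_length_eq) simp
  ultimately show ?thesis
    by (meson finite_surj)
qed

text \<open>The order in which a smooth function is differentiated does not matter; quantifying over all
  enumerations \<open>bs\<close> of \<open>\<alpha>\<close> avoids choosing one.\<close>

definition has_weak_deriv ::
    "'a::euclidean_space set \<Rightarrow> 'a multiset \<Rightarrow> ('a \<Rightarrow> real) \<Rightarrow> ('a \<Rightarrow> real) \<Rightarrow> bool" where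
  "has_weak_deriv \<Omega> \<alpha> u g \<longleftrightarrow> locally_integrable \<Omega> u \<and> locally_integrable \<Omega> g \<and>
     (\<forall>\<phi>\<in>test_fun \<Omega>. \<forall>bs. mset bs = \<alpha> \<longrightarrow>
        (LINT x:\<Omega>|lebesgue. u x * partial_derivs bs \<phi> x)
          = (-1) ^ size \<alpha> * (LINT x:\<Omega>|lebesgue. g x * \<phi> x))"

text \<open>A weak derivative is determined only almost everywhere on \<open>\<Omega>\<close>; this is one representative.\<close>

definition weak_deriv ::
    "'a::euclidean_space set \<Rightarrow> 'a multiset \<Rightarrow> ('a \<Rightarrow> real) \<Rightarrow> 'a \<Rightarrow> real" where
  "weak_deriv \<Omega> \<alpha> u = (SOME g. has_weak_deriv \<Omega> \<alpha> u g)"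

text \<open>Euclidean norm of the tensor of all partial derivatives of order \<open>j\<close>; its entries are indexed
  by \<open>j\<close>-tuples of coordinate directions.\<close>

definition norm_nabla ::
    "'a::euclidean_space set \<Rightarrow> nat \<Rightarrow> ('a \<Rightarrow> real) \<Rightarrow> 'a \<Rightarrow> real" where
  "norm_nabla \<Omega> j u x =
     sqrt (\<Sum>bs | set bs \<subseteq> Basis \<and> length bs = j. (weak_deriv \<Omega> (mset bs) u x)\<^sup>2)"


section \<open>Sobolev spaces\<close>

definition sobolev_loc :: "'a::euclidean_space set \<Rightarrow> nat \<Rightarrow> ('a \<Rightarrow> real) set" where
  "sobolev_loc \<Omega> k = {u. locally_integrable \<Omega> u \<and>
     (\<forall>j\<le>k. \<forall>\<alpha>\<in>multi_indices j. \<exists>g. has_weak_deriv \<Omega> \<alpha> u g)}"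

definition sobolev_norm ::
    "'a::euclidean_space set \<Rightarrow> ('a \<Rightarrow> real) \<Rightarrow> nat \<Rightarrow> ('a \<Rightarrow> real) \<Rightarrow> ennreal" where
  "sobolev_norm \<Omega> w k u =
     (\<integral>\<^sup>+x\<in>\<Omega>. ennreal (w x * \<bar>u x\<bar>) \<partial>lebesgue)
     + (\<Sum>j=1..k. \<integral>\<^sup>+x\<in>\<Omega>. ennreal (w x * norm_nabla \<Omega> j u x) \<partial>lebesgue)"

definition sobolev ::
    "'a::euclidean_space set \<Rightarrow> ('a \<Rightarrow> real) \<Rightarrow> nat \<Rightarrow> ('a \<Rightarrow> real) set" where
  "sobolev \<Omega> w k = {u \<in> sobolev_loc \<Omega> k. sobolev_norm \<Omega> w k u < \<infinity>}"

definition halfspace :: "('a::euclidean_space \<times> real) set" where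
  "halfspace = {(x, t). 0 < t}"

abbreviation weighted_sobolev_norm ::
    "real \<Rightarrow> nat \<Rightarrow> ('a::euclidean_space \<times> real \<Rightarrow> real) \<Rightarrow> ennreal" where
  "weighted_sobolev_norm a k \<equiv> sobolev_norm halfspace (\<lambda>(x, t). t powr a) k"

abbreviation weighted_sobolev ::
    "real \<Rightarrow> nat \<Rightarrow> ('a::euclidean_space \<times> real \<Rightarrow> real) set" where
  "weighted_sobolev a k \<equiv> sobolev halfspace (\<lambda>(x, t). t powr a) k"


section \<open>Traces\<close>

definition tendsto_L1_loc ::
    "('i \<Rightarrow> 'a::euclidean_space \<Rightarrow> real) \<Rightarrow> ('a \<Rightarrow> real) \<Rightarrow> 'i filter \<Rightarrow> bool" where
  "tendsto_L1_loc v g \<F> \<longleftrightarrow> locally_integrable UNIV g \<and>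
     (\<forall>\<^sub>F i in \<F>. locally_integrable UNIV (v i)) \<and>
     (\<forall>K. compact K \<longrightarrow> ((\<lambda>i. LINT x:K|lebesgue. \<bar>v i x - g x\<bar>) \<longlongrightarrow> 0) \<F>)"

text \<open>Elements of Sobolev spaces, and weak derivatives in particular, are given only almost
  everywhere on the half-space, so the slices at individual heights \<open>t\<close> are taken from a suitable
  representative \<open>w\<close>.\<close>

definition has_trace :: "('a::euclidean_space \<times> real \<Rightarrow> real) \<Rightarrow> ('a \<Rightarrow> real) \<Rightarrow> bool" where
  "has_trace v g \<longleftrightarrow> (\<exists>w. (AE p in lebesgue. p \<in> halfspace \<longrightarrow> w p = v p) \<and>
     tendsto_L1_loc (\<lambda>t x. w (x, t)) g (at_right 0))"

definition t_deriv ::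
    "nat \<Rightarrow> ('a::euclidean_space \<times> real \<Rightarrow> real) \<Rightarrow> 'a \<times> real \<Rightarrow> real" where
  "t_deriv j = weak_deriv halfspace (replicate_mset j (0, 1))"


section \<open>Besov spaces\<close>

definition L1_norm :: "('a::euclidean_space \<Rightarrow> real) \<Rightarrow> ennreal" where
  "L1_norm f = (\<integral>\<^sup>+x. ennreal \<bar>f x\<bar> \<partial>lebesgue)"

definition diff_op :: "'a::euclidean_space \<Rightarrow> ('a \<Rightarrow> real) \<Rightarrow> 'a \<Rightarrow> real" where
  "diff_op h f x = f (x + h) - f x"

definition besov_seminorm_base :: "real \<Rightarrow> ('a::euclidean_space \<Rightarrow> real) \<Rightarrow> ennreal" where
  "besov_seminorm_base s f =
     (\<integral>\<^sup>+h. L1_norm ((diff_op h ^^ (nat \<lfloor>s\<rfloor> + 1)) f)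
             / ennreal (norm h powr (real DIM('a) + s)) \<partial>lebesgue)"

definition besov_order :: "real \<Rightarrow> nat" where
  "besov_order s = Max {j. 1 \<le> j \<and> real j < s}"

definition besov_seminorm :: "real \<Rightarrow> ('a::euclidean_space \<Rightarrow> real) \<Rightarrow> ennreal" where
  "besov_seminorm s f =
     (if s \<le> 1 then besov_seminorm_base s f
      else \<Sum>\<alpha>\<in>multi_indices (besov_order s).
             besov_seminorm_base (s - real (besov_order s)) (weak_deriv UNIV \<alpha> f))"

definition besov_norm :: "real \<Rightarrow> ('a::euclidean_space \<Rightarrow> real) \<Rightarrow> ennreal" where
  "besov_norm s f =
     (if s \<le> 1 then L1_norm f else sobolev_norm UNIV (\<lambda>_. 1) (besov_order s) f)
     + besov_seminorm s f"

definition besov :: "real \<Rightarrow> ('a::euclidean_space \<Rightarrow> real) set" where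
  "besov s = {f. (if s \<le> 1 then integrable lebesgue f
                  else f \<in> sobolev UNIV (\<lambda>_. 1) (besov_order s))
                 \<and> besov_seminorm s f < \<infinity>}"

end

theory Submission
  imports Defs
begin

text \<open>Write \<open>s = m - a - j\<close>, which is nonnegative for every prescribed trace \<open>f j\<close>. If
  \<open>f j = (\<Sum>i. g i)\<close> in \<open>L1\<close> with smooth pieces \<open>g i\<close> and scales \<open>r i \<le> 1\<close> tending to \<open>0\<close> such that
  \<open>(\<Sum>i. r i powr (\<bar>\<beta>\<bar> - s) * \<parallel>\<partial>\<^sup>\<beta> (g i)\<parallel>)\<close> is finite for \<open>\<bar>\<beta>\<bar> \<le> m + 1\<close>, then
  \<open>(\<Sum>i. g i x * r i ^ j * \<theta> (t / r i))\<close>, with a cutoff \<open>\<theta>\<close> that behaves like \<open>t ^ j / j!\<close> at \<open>0\<close>, is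
  locally finite for \<open>t > 0\<close>, lies in the weighted Sobolev space, and its \<open>q\<close>-th \<open>t\<close>-derivative has trace
  \<open>f j\<close> for \<open>q = j\<close> and \<open>0\<close> for the other \<open>q \<le> m - a\<close>. For \<open>s > 0\<close> the pieces are differences of
  averages at dyadic scales, controlled by second differences and hence by the Besov seminorm. For
  \<open>s = 0\<close> one takes a rapidly convergent smooth approximation and chooses the scales afterwards.\<close>

section \<open>Test functions\<close>

text \<open>The condition on \<beta> is dictated by one integral. A piece at scale r lives on 0 < t
  < r; q derivatives in t leave the size r ^ (j - q), and t powr a integrates over [0, r] to r powr
  (a + 1) / (a + 1). For r <= 1 the product is at most a constant times r powr (|\<beta>| - s) as
  soon as |\<beta>| + q <= m + 1, which is where s = m - a - j comes from. The same sum with \<beta>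
  empty dominates the extension uniformly in t, so the traces follow by exchanging a limit with a
  series. The obstacle for s > 0 is integer s, where the derivatives of order s - 1 are known only
  through second differences. The averaging kernel is therefore built from differences of order l +
  2, with l the order of the available derivatives: l of them are spent on derivatives, two remain.
  For s = 0 there is no smoothness to spend: only the L1 norms of the pieces are under control, so
  the scales must depend on the derivatives of the pieces, and the extension is no longer linear in
  f.\<close>

lemma partial_derivs_Nil [simp]: "partial_derivs [] \<phi> = \<phi>"
  and partial_derivs_Cons [simp]: "partial_derivs (b # bs) \<phi> = partial_deriv b (partial_derivs bs \<phi>)"
  and partial_derivs_append: "partial_derivs (as @ bs) \<phi> = partial_derivs as (partial_derivs bs \<phi>)"
  by (simp_all add: partial_derivs_def)

lemma partial_deriv_eqI:
  "((\<lambda>s. \<phi> (x + s *\<^sub>R b)) has_real_derivative d) (at 0) \<Longrightarrow> partial_deriv b \<phi> x = d"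
  unfolding partial_deriv_def by (rule DERIV_imp_deriv)

lemma smooth_fun_partial_derivs:
  "smooth_fun \<phi> \<Longrightarrow> bs \<in> lists Basis \<Longrightarrow> smooth_fun (partial_derivs bs \<phi>)"
  unfolding smooth_fun_def by (metis append_in_lists_conv partial_derivs_append)

lemma smooth_fun_partial_deriv:
  "smooth_fun \<phi> \<Longrightarrow> b \<in> Basis \<Longrightarrow> smooth_fun (partial_deriv b \<phi>)"
  using smooth_fun_partial_derivs[of \<phi> "[b]"] by simp

lemma smooth_fun_differentiable: "smooth_fun \<phi> \<Longrightarrow> \<phi> differentiable (at x)"
  unfolding smooth_fun_def differentiable_on_def
  by (metis UNIV_I lists.Nil partial_derivs_Nil)

lemma smooth_fun_continuous: "smooth_fun \<phi> \<Longrightarrow> continuous_on UNIV \<phi>"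
  by (meson continuous_at_imp_continuous_on differentiable_imp_continuous_within smooth_fun_differentiable)

lemma frechet_derivative_partial:
  fixes \<phi> :: "'a::euclidean_space \<Rightarrow> real"
  assumes "\<phi> differentiable (at x)"
  shows "(\<phi> has_derivative (\<lambda>h. \<Sum>b\<in>Basis. (h \<bullet> b) * partial_deriv b \<phi> x)) (at x)"
proof -
  obtain D where D: "(\<phi> has_derivative D) (at x)" using assms by (auto simp: differentiable_def)
  interpret D: bounded_linear D using D by (rule has_derivative_bounded_linear)
  have p: "partial_deriv b \<phi> x = D b" for b
  proof (rule partial_deriv_eqI)
    have "((\<lambda>s. \<phi> (x + s *\<^sub>R b)) has_derivative (\<lambda>s. D (s *\<^sub>R b))) (at 0)"
      by (rule has_derivative_compose[of "\<lambda>s. x + s *\<^sub>R b" _ 0 UNIV \<phi> D, simplified])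
        (auto intro!: derivative_eq_intros D)
    moreover have "(\<lambda>s. D (s *\<^sub>R b)) = (*) (D b)" by (simp add: fun_eq_iff D.scaleR)
    ultimately show "((\<lambda>s. \<phi> (x + s *\<^sub>R b)) has_real_derivative D b) (at 0)"
      by (simp add: has_field_derivative_def)
  qed
  have "D h = (\<Sum>b\<in>Basis. (h \<bullet> b) * partial_deriv b \<phi> x)" for h
  proof -
    have "D h = D (\<Sum>b\<in>Basis. (h \<bullet> b) *\<^sub>R b)" by (simp add: euclidean_representation)
    also have "\<dots> = (\<Sum>b\<in>Basis. (h \<bullet> b) * D b)" by (simp add: D.sum D.scaleR)
    finally show ?thesis by (simp add: p)
  qed
  then have "D = (\<lambda>h. \<Sum>b\<in>Basis. (h \<bullet> b) * partial_deriv b \<phi> x)" by blast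
  with D show ?thesis by simp
qed

lemma DERIV_line:
  fixes \<phi> :: "'a::euclidean_space \<Rightarrow> real"
  assumes "\<And>x. \<phi> differentiable (at x)"
  shows "((\<lambda>s. \<phi> (x + s *\<^sub>R h)) has_real_derivative
           (\<Sum>b\<in>Basis. (h \<bullet> b) * partial_deriv b \<phi> (x + s *\<^sub>R h))) (at s within A)"
proof -
  have "((\<lambda>s. \<phi> (x + s *\<^sub>R h)) has_derivative
      (\<lambda>\<tau>. \<Sum>b\<in>Basis. ((\<tau> *\<^sub>R h) \<bullet> b) * partial_deriv b \<phi> (x + s *\<^sub>R h))) (at s within A)"
    by (rule has_derivative_compose[of "\<lambda>s. x + s *\<^sub>R h" "\<lambda>\<tau>. \<tau> *\<^sub>R h" s A \<phi>])
      (auto intro!: derivative_eq_intros frechet_derivative_partial assms)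
  then show ?thesis
    unfolding has_field_derivative_def
    by (rule back_subst[of "\<lambda>D. (_ has_derivative D) _"]) (auto simp: fun_eq_iff sum_distrib_left algebra_simps intro!: sum.cong)
qed

lemma DERIV_line_Basis:
  fixes \<phi> :: "'a::euclidean_space \<Rightarrow> real"
  assumes "\<And>x. \<phi> differentiable (at x)" "b \<in> Basis"
  shows "((\<lambda>s. \<phi> (x + s *\<^sub>R b)) has_real_derivative partial_deriv b \<phi> (x + s *\<^sub>R b)) (at s within A)"
proof -
  have "(\<Sum>c\<in>Basis. (b \<bullet> c) * partial_deriv c \<phi> (x + s *\<^sub>R b)) = partial_deriv b \<phi> (x + s *\<^sub>R b)"
    using assms(2) by (simp add: inner_Basis if_distrib[of "\<lambda>z. z * _"] cong: if_cong)
  with DERIV_line[OF assms(1), of x b s A] show ?thesis by simp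
qed

lemma test_fun_smooth: "\<phi> \<in> test_fun \<Omega> \<Longrightarrow> smooth_fun \<phi>"
  by (simp add: test_fun_def)

lemma test_fun_vanish: "\<phi> \<in> test_fun \<Omega> \<Longrightarrow> x \<notin> \<Omega> \<Longrightarrow> \<phi> x = 0"
  using closure_subset[of "{x. \<phi> x \<noteq> 0}"] unfolding test_fun_def by blast

lemma test_fun_continuous: "\<phi> \<in> test_fun \<Omega> \<Longrightarrow> continuous_on UNIV \<phi>"
  by (simp add: test_fun_smooth smooth_fun_continuous)

lemma test_fun_borel [measurable_dest]: "\<phi> \<in> test_fun \<Omega> \<Longrightarrow> \<phi> \<in> borel_measurable borel"
  by (simp add: test_fun_continuous borel_measurable_continuous_onI)

lemma test_fun_mono: "\<phi> \<in> test_fun \<Omega> \<Longrightarrow> \<Omega> \<subseteq> \<Omega>' \<Longrightarrow> \<phi> \<in> test_fun \<Omega>'"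
  unfolding test_fun_def by blast

text \<open>Away from the closed support, \<phi> vanishes in a whole neighbourhood, so
  differentiation cannot enlarge the support.\<close>

lemma test_fun_partial_deriv:
  assumes "\<phi> \<in> test_fun \<Omega>" "b \<in> Basis"
  shows "partial_deriv b \<phi> \<in> test_fun \<Omega>"
proof -
  let ?S = "closure {x. \<phi> x \<noteq> 0}"
  have "partial_deriv b \<phi> x = 0" if "x \<notin> ?S" for x
  proof (rule partial_deriv_eqI)
    have "open ((\<lambda>s. x + s *\<^sub>R b) -` (- ?S))"
      by (intro open_vimage) (auto intro!: continuous_intros)
    then have "open {s. x + s *\<^sub>R b \<in> - ?S}" by (simp add: vimage_def)
    moreover have "0 \<in> {s. x + s *\<^sub>R b \<in> - ?S}" using that by simp
    ultimately have ev: "eventually (\<lambda>s. x + s *\<^sub>R b \<in> - ?S) (nhds 0)"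
      unfolding eventually_nhds by blast
    have "eventually (\<lambda>s. \<phi> (x + s *\<^sub>R b) = 0) (nhds 0)"
      using ev by eventually_elim (use closure_subset[of "{x. \<phi> x \<noteq> 0}"] in blast)
    then show "((\<lambda>s. \<phi> (x + s *\<^sub>R b)) has_real_derivative 0) (at 0)"
      by (subst DERIV_cong_ev[OF refl _ refl, of _ "\<lambda>_. 0"]) auto
  qed
  then have "{x. partial_deriv b \<phi> x \<noteq> 0} \<subseteq> ?S" by blast
  then have "closure {x. partial_deriv b \<phi> x \<noteq> 0} \<subseteq> ?S" by (rule closure_minimal) simp
  moreover have "bounded {x. partial_deriv b \<phi> x \<noteq> 0}"
  proof (rule bounded_subset)
    show "bounded ?S" using assms(1) by (simp add: test_fun_def compact_imp_bounded)
  qed fact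
  moreover have "smooth_fun (partial_deriv b \<phi>)" "?S \<subseteq> \<Omega>"
    using assms by (simp_all add: test_fun_def smooth_fun_partial_deriv)
  ultimately show ?thesis
    unfolding test_fun_def mem_Collect_eq compact_closure by (meson order_trans)
qed

lemma test_fun_partial_derivs:
  "\<phi> \<in> test_fun \<Omega> \<Longrightarrow> bs \<in> lists Basis \<Longrightarrow> partial_derivs bs \<phi> \<in> test_fun \<Omega>"
  by (induction bs) (auto intro: test_fun_partial_deriv)

lemma test_fun_bounded:
  assumes "\<phi> \<in> test_fun \<Omega>"
  obtains B where "0 < B" "\<And>x. \<bar>\<phi> x\<bar> \<le> B"
proof -
  let ?S = "closure {x. \<phi> x \<noteq> 0}"
  have "compact (\<phi> ` ?S)"
    using assms test_fun_continuous[OF assms]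
    by (intro compact_continuous_image) (auto simp: test_fun_def intro: continuous_on_subset)
  then obtain B where B: "0 < B" "\<And>x. x \<in> ?S \<Longrightarrow> \<bar>\<phi> x\<bar> \<le> B"
    using bounded_pos[of "\<phi> ` ?S"] compact_imp_bounded by auto
  moreover have "\<bar>\<phi> x\<bar> \<le> B" if "x \<notin> ?S" for x
    proof -
    have "\<phi> x = 0" using that closure_subset[of "{x. \<phi> x \<noteq> 0}"] by blast
    then show ?thesis using B(1) by simp
  qed
  ultimately show ?thesis using that by blast
qed

text \<open>Negative \<open>r\<close> is allowed for the sake of
  \<open>average_weak_partial\<close>, which tests a kernel against \<phi> (x - r y);
  \<open>r = 1\<close> gives translations.\<close>

lemma test_fun_affine:
  fixes \<phi> :: "'a::euclidean_space \<Rightarrow> real"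
  assumes "\<phi> \<in> test_fun UNIV" "r \<noteq> 0"
  shows "(\<lambda>y. \<phi> (z + r *\<^sub>R y)) \<in> test_fun UNIV"
    and "b \<in> Basis \<Longrightarrow> partial_deriv b (\<lambda>y. \<phi> (z + r *\<^sub>R y)) y = r * partial_deriv b \<phi> (z + r *\<^sub>R y)"
proof -
  \<comment> \<open>The factor \<open>c\<close> is there for the induction on \<open>bs\<close>
    below, where a power of \<open>r\<close> has already accumulated.\<close>
  have step: "partial_deriv b (\<lambda>y. c * \<psi> (z + r *\<^sub>R y)) y = (r * c) * partial_deriv b \<psi> (z + r *\<^sub>R y)"
    if "b \<in> Basis" "\<And>x. \<psi> differentiable (at x)" for b c y and \<psi> :: "'a \<Rightarrow> real"
  proof (rule partial_deriv_eqI)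
    have "((\<lambda>s. \<psi> ((z + r *\<^sub>R y) + (r * s) *\<^sub>R b)) has_real_derivative
            partial_deriv b \<psi> ((z + r *\<^sub>R y) + (r * 0) *\<^sub>R b) * r) (at 0)"
      using DERIV_chain2[OF DERIV_line_Basis[OF that(2,1), of "z + r *\<^sub>R y"], of "\<lambda>s. r * s" r 0 UNIV]
      by (auto intro!: derivative_eq_intros)
    then show "((\<lambda>s. c * \<psi> (z + r *\<^sub>R (y + s *\<^sub>R b))) has_real_derivative
            (r * c) * partial_deriv b \<psi> (z + r *\<^sub>R y)) (at 0)"
      by (auto intro!: derivative_eq_intros simp: scaleR_add_right add.assoc)
  qed
  have sm: "smooth_fun \<phi>" using assms(1) by (rule test_fun_smooth)
  show "partial_deriv b (\<lambda>y. \<phi> (z + r *\<^sub>R y)) y = r * partial_deriv b \<phi> (z + r *\<^sub>R y)" if "b \<in> Basis"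
    using step[OF that smooth_fun_differentiable[OF sm], of 1] by simp
  have eq: "partial_derivs bs (\<lambda>y. \<phi> (z + r *\<^sub>R y)) = (\<lambda>y. r ^ length bs * partial_derivs bs \<phi> (z + r *\<^sub>R y))"
    if "bs \<in> lists Basis" for bs
    using that
    by (induction bs) (auto simp: step sm smooth_fun_partial_derivs smooth_fun_differentiable lists.Cons)
  have "smooth_fun (\<lambda>y. \<phi> (z + r *\<^sub>R y))"
    unfolding smooth_fun_def
  proof
    fix bs :: "'a list" assume bs: "bs \<in> lists Basis"
    have "(\<lambda>y. partial_derivs bs \<phi> (z + r *\<^sub>R y)) differentiable at x within UNIV" for x
      by (rule differentiable_chain_at[of "\<lambda>y. z + r *\<^sub>R y" x "partial_derivs bs \<phi>", unfolded o_def])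
        (auto intro!: derivative_intros smooth_fun_differentiable smooth_fun_partial_derivs sm bs)
    then show "partial_derivs bs (\<lambda>y. \<phi> (z + r *\<^sub>R y)) differentiable_on UNIV"
      unfolding eq[OF bs] differentiable_on_def by (auto intro!: differentiable_mult)
  qed
  moreover have "bounded {y. \<phi> (z + r *\<^sub>R y) \<noteq> 0}"
  proof -
    have "bounded {x. \<phi> x \<noteq> 0}"
      using assms(1) bounded_subset[OF compact_imp_bounded closure_subset] by (auto simp: test_fun_def)
    then have "bounded ((\<lambda>x. (1/r) *\<^sub>R x + (-(1/r) *\<^sub>R z)) ` {x. \<phi> x \<noteq> 0})"
      using bounded_scaling[of "{x. \<phi> x \<noteq> 0}" "1/r"] bounded_translation[of "(\<lambda>x. (1/r) *\<^sub>R x) ` {x. \<phi> x \<noteq> 0}" "-(1/r) *\<^sub>R z"]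
      by (simp add: image_image add.commute)
    moreover have "{y. \<phi> (z + r *\<^sub>R y) \<noteq> 0} \<subseteq> (\<lambda>x. (1/r) *\<^sub>R x + (-(1/r) *\<^sub>R z)) ` {x. \<phi> x \<noteq> 0}"
    proof
      fix y assume "y \<in> {y. \<phi> (z + r *\<^sub>R y) \<noteq> 0}"
      then show "y \<in> (\<lambda>x. (1/r) *\<^sub>R x + (-(1/r) *\<^sub>R z)) ` {x. \<phi> x \<noteq> 0}"
        using assms(2) by (intro image_eqI[of _ _ "z + r *\<^sub>R y"]) (auto simp: algebra_simps)
    qed
    ultimately show ?thesis by (rule bounded_subset)
  qed
  ultimately show "(\<lambda>y. \<phi> (z + r *\<^sub>R y)) \<in> test_fun UNIV"
    by (simp add: test_fun_def compact_closure)
qed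

text \<open>Weak derivatives in x on the half-space are checked at each fixed height t, and for this
  a slice must again be a test function.\<close>

lemma test_fun_slice:
  fixes \<phi> :: "'a::euclidean_space \<times> real \<Rightarrow> real"
  assumes "\<phi> \<in> test_fun \<Omega>"
  shows "(\<lambda>x. \<phi> (x, t)) \<in> test_fun UNIV"
    and "partial_deriv b (\<lambda>x. \<phi> (x, t)) x = partial_deriv (b, 0) \<phi> (x, t)"
proof -
  have step: "partial_deriv b (\<lambda>x. \<psi> (x, t)) = (\<lambda>x. partial_deriv (b, 0) \<psi> (x, t))"
    for b and \<psi> :: "'a \<times> real \<Rightarrow> real"
    by (simp add: partial_deriv_def fun_eq_iff)
  then show "partial_deriv b (\<lambda>x. \<phi> (x, t)) x = partial_deriv (b, 0) \<phi> (x, t)" by meson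
  have eq: "partial_derivs bs (\<lambda>x. \<phi> (x, t)) = (\<lambda>x. partial_derivs (map (\<lambda>b. (b, 0)) bs) \<phi> (x, t))" for bs
    by (induction bs) (auto simp: step)
  have sm: "smooth_fun \<phi>" using assms(1) by (rule test_fun_smooth)
  have "smooth_fun (\<lambda>x. \<phi> (x, t))"
    unfolding smooth_fun_def
  proof
    fix bs :: "'a list" assume bs: "bs \<in> lists Basis"
    let ?bs = "map (\<lambda>b. (b, 0)) bs :: ('a \<times> real) list"
    have "?bs \<in> lists Basis" using bs by (auto simp: Basis_prod_def lists_eq_set)
    then have "partial_derivs ?bs \<phi> differentiable at (x, t)" for x
      by (rule smooth_fun_differentiable[OF smooth_fun_partial_derivs[OF sm]])
    moreover have "(\<lambda>x. (x, t)) differentiable at x" for x :: 'a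
      unfolding differentiable_def by (intro exI[of _ "\<lambda>x. (x, 0)"]) (auto intro!: derivative_eq_intros)
    ultimately have "(\<lambda>x. partial_derivs ?bs \<phi> (x, t)) differentiable at x within UNIV" for x
      using differentiable_chain_at[of "\<lambda>x. (x, t)" x "partial_derivs ?bs \<phi>", unfolded o_def] by blast
    then show "partial_derivs bs (\<lambda>x. \<phi> (x, t)) differentiable_on UNIV"
      unfolding eq differentiable_on_def by auto
  qed
  moreover have "bounded {x. \<phi> (x, t) \<noteq> 0}"
  proof (rule bounded_subset)
    show "bounded (fst ` {p. \<phi> p \<noteq> 0})"
      using assms(1) bounded_subset[OF compact_imp_bounded closure_subset]
      by (intro bounded_fst) (auto simp: test_fun_def)
    show "{x. \<phi> (x, t) \<noteq> 0} \<subseteq> fst ` {p. \<phi> p \<noteq> 0}"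
      by force
  qed
  ultimately show "(\<lambda>x. \<phi> (x, t)) \<in> test_fun UNIV"
    by (simp add: test_fun_def compact_closure)
qed

section \<open>Bump functions\<close>

text \<open>The negative powers are included because differentiation produces them: the derivative
  of a member is a combination of the members for \<open>k + 1\<close> and
  \<open>k + 2\<close>.\<close>

definition flat_exp :: "nat \<Rightarrow> real \<Rightarrow> real" where
  "flat_exp k x = (if 0 < x then exp (- (1 / x)) / x ^ k else 0)"

text \<open>This is the difference quotient of \<open>flat_exp k\<close> at 0. From the right, y = 1
  / x turns it into y ^ (k + 1) / exp y.\<close>

lemma flat_exp_div_tendsto_0: "((\<lambda>x. flat_exp k x / x) \<longlongrightarrow> 0) (at 0)"
proof -
  have "((\<lambda>x::real. flat_exp k x / x) \<longlongrightarrow> 0) (at_left 0)"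
    by (rule tendsto_eventually) (auto simp: eventually_at_filter flat_exp_def)
  moreover have "((\<lambda>x::real. flat_exp k x / x) \<longlongrightarrow> 0) (at_right 0)"
  proof -
    have "((\<lambda>x::real. inverse x ^ (k + 1) / exp (inverse x)) \<longlongrightarrow> 0) (at_right 0)"
      by (rule filterlim_compose[OF tendsto_power_div_exp_0 filterlim_inverse_at_top_right])
    then show ?thesis
      by (rule Lim_transform_eventually)
        (auto simp: eventually_at_filter flat_exp_def field_simps exp_minus)
  qed
  ultimately show ?thesis by (simp add: filterlim_split_at)
qed

lemma DERIV_flat_exp:
  "(flat_exp k has_real_derivative flat_exp (k + 2) x - real k * flat_exp (k + 1) x) (at x)"
proof -
  consider "x < 0" | "x = 0" | "x > 0" by linarith
  then show ?thesis
  proof cases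
    case 1
    have "eventually (\<lambda>y. flat_exp k y = 0) (nhds x)"
      using eventually_nhds_in_open[of "{..<0}" x] 1 by (auto elim!: eventually_mono simp: flat_exp_def)
    then show ?thesis
      using 1 by (subst DERIV_cong_ev[OF refl _ refl, of _ "\<lambda>_. 0"]) (auto simp: flat_exp_def)
  next
    case 2
    then show ?thesis using flat_exp_div_tendsto_0[of k]
      by (simp add: DERIV_def flat_exp_def)
  next
    case 3
    have ev: "eventually (\<lambda>y. flat_exp k y = exp (- (1 / y)) / y ^ k) (nhds x)"
      using eventually_nhds_in_open[of "{0<..}" x] 3 by (auto elim!: eventually_mono simp: flat_exp_def)
    have "((\<lambda>y. exp (- (1 / y)) / y ^ k) has_real_derivative
        (exp (- (1 / x)) * (1 / x^2) * x ^ k - exp (- (1 / x)) * (real k * x ^ (k - 1))) / (x ^ k * x ^ k)) (at x)"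
      using 3 by (auto intro!: derivative_eq_intros simp: power2_eq_square)
    also have "(exp (- (1 / x)) * (1 / x^2) * x ^ k - exp (- (1 / x)) * (real k * x ^ (k - 1))) / (x ^ k * x ^ k)
        = flat_exp (k + 2) x - real k * flat_exp (k + 1) x"
      using 3 by (cases k) (auto simp: flat_exp_def field_simps power2_eq_square)
    finally show ?thesis
      using ev by (subst DERIV_cong_ev[OF refl _ refl]) auto
  qed
qed

text \<open>An algebra closed under differentiation, so that derivatives of all orders exist without
  any being computed. The affine argument covers both edges of an interval.\<close>

inductive_set smooth_alg :: "(real \<Rightarrow> real) set" where
  gen: "(\<lambda>s. flat_exp k (c * s + d)) \<in> smooth_alg"
| const: "(\<lambda>s. c) \<in> smooth_alg"
| add: "f \<in> smooth_alg \<Longrightarrow> g \<in> smooth_alg \<Longrightarrow> (\<lambda>s. f s + g s) \<in> smooth_alg"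
| mult: "f \<in> smooth_alg \<Longrightarrow> g \<in> smooth_alg \<Longrightarrow> (\<lambda>s. f s * g s) \<in> smooth_alg"

lemma smooth_alg_deriv:
  "f \<in> smooth_alg \<Longrightarrow> \<exists>f'\<in>smooth_alg. \<forall>x. (f has_real_derivative f' x) (at x)"
proof (induction rule: smooth_alg.induct)
  case (gen k c d)
  have "((\<lambda>s. flat_exp k (c * s + d)) has_real_derivative
      c * flat_exp (k + 2) (c * x + d) + (c * - real k) * flat_exp (k + 1) (c * x + d)) (at x)" for x
  proof -
    have "((\<lambda>s. c * s + d) has_real_derivative c) (at x)" by (auto intro!: derivative_eq_intros)
    from DERIV_chain2[OF DERIV_flat_exp this, of k] show ?thesis by (simp add: algebra_simps)
  qed
  moreover have "(\<lambda>x. c * flat_exp (k + 2) (c * x + d) + (c * - real k) * flat_exp (k + 1) (c * x + d)) \<in> smooth_alg"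
    by (intro smooth_alg.intros)
  ultimately show ?case by (intro bexI allI)
next
  case (const c)
  show ?case by (intro bexI[of _ "\<lambda>_. 0"]) (auto intro: smooth_alg.intros)
next
  case (add f g)
  then obtain f' g' where "f' \<in> smooth_alg" "g' \<in> smooth_alg"
    "\<And>x. (f has_real_derivative f' x) (at x)" "\<And>x. (g has_real_derivative g' x) (at x)" by blast
  then show ?case
    by (intro bexI[of _ "\<lambda>x. f' x + g' x"]) (auto intro!: smooth_alg.intros derivative_eq_intros)
next
  case (mult f g)
  then obtain f' g' where "f' \<in> smooth_alg" "g' \<in> smooth_alg"
    "\<And>x. (f has_real_derivative f' x) (at x)" "\<And>x. (g has_real_derivative g' x) (at x)" by blast
  then show ?case using mult.hyps
    by (intro bexI[of _ "\<lambda>x. f' x * g x + g' x * f x"])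
      (auto intro!: smooth_alg.intros derivative_eq_intros)
qed

lemma smooth_alg_family:
  assumes "f \<in> smooth_alg"
  obtains D where "D 0 = f" "\<And>k x. (D k has_real_derivative D (Suc k) x) (at x)"
proof -
  have "\<exists>D. \<forall>k. (D k \<in> smooth_alg \<and> (k = 0 \<longrightarrow> D k = f)) \<and>
      (\<forall>x. (D k has_real_derivative D (Suc k) x) (at x))"
    by (rule dependent_nat_choice) (use assms smooth_alg_deriv in auto)
  then show ?thesis using that by metis
qed

lemma bump_1d:
  fixes p q c :: real
  obtains D where "D 0 = (\<lambda>s. flat_exp 0 (c * (s - p)) * flat_exp 0 (c * (q - s)))"
    "\<And>k x. (D k has_real_derivative D (Suc k) x) (at x)"
proof -
  have "(\<lambda>s. flat_exp 0 (c * s + (- c * p)) * flat_exp 0 ((-c) * s + c * q)) \<in> smooth_alg"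
    by (intro smooth_alg.intros)
  then have "(\<lambda>s. flat_exp 0 (c * (s - p)) * flat_exp 0 (c * (q - s))) \<in> smooth_alg"
    by (simp add: algebra_simps)
  then show ?thesis using smooth_alg_family that by blast
qed

lemma deriv_family_vanish:
  fixes D :: "nat \<Rightarrow> real \<Rightarrow> real"
  assumes D: "\<And>k x. (D k has_real_derivative D (Suc k) x) (at x)"
    and "open U" "\<And>x. x \<in> U \<Longrightarrow> D 0 x = 0" "x \<in> U"
  shows "D k x = 0"
  using \<open>x \<in> U\<close>
proof (induction k arbitrary: x)
  case 0 then show ?case using assms by simp
next
  case (Suc k)
  have "eventually (\<lambda>y. D k y = 0) (nhds x)"
    using eventually_nhds_in_open[OF \<open>open U\<close> Suc.prems] by eventually_elim (rule Suc.IH)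
  then have "(D k has_real_derivative 0) (at x)"
    by (subst DERIV_cong_ev[OF refl _ refl, of _ "\<lambda>_. 0"]) auto
  with D show ?case using DERIV_unique by blast
qed

text \<open>The multiplicity of a direction in \<beta> is the order of the derivative of the factor
  in that direction. Indexed in this way, the mixed derivatives of a product of one-variable
  functions do not depend on an order of differentiation.\<close>

definition tensor_family ::
    "('a::euclidean_space \<Rightarrow> nat \<Rightarrow> real \<Rightarrow> real) \<Rightarrow> 'a multiset \<Rightarrow> 'a \<Rightarrow> real" where
  "tensor_family D \<beta> x = (\<Prod>b\<in>Basis. D b (count \<beta> b) (x \<bullet> b))"

lemma tensor_family_differentiable:
  assumes D: "\<And>b k x. b \<in> Basis \<Longrightarrow> (D b k has_real_derivative D b (Suc k) x) (at x)"
  shows "tensor_family D \<beta> differentiable (at x)"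
proof -
  have "((\<lambda>x. D b (count \<beta> b) (x \<bullet> b)) has_derivative (\<lambda>h. (h \<bullet> b) * D b (Suc (count \<beta> b)) (x \<bullet> b))) (at x)"
    if "b \<in> Basis" for b
  proof -
    have "((\<lambda>x. x \<bullet> b) has_derivative (\<lambda>h. h \<bullet> b)) (at x)"
      by (auto intro!: derivative_eq_intros)
    from has_derivative_compose[OF this D[OF that, unfolded has_field_derivative_def]]
    show ?thesis by (simp add: mult.commute)
  qed
  note prod = has_derivative_prod[of Basis "\<lambda>b x. D b (count \<beta> b) (x \<bullet> b)", OF this]
  show ?thesis
    unfolding tensor_family_def[abs_def] differentiable_def by (rule exI, rule prod)
qed

lemma tensor_family_partial:
  assumes D: "\<And>b k x. b \<in> Basis \<Longrightarrow> (D b k has_real_derivative D b (Suc k) x) (at x)"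
    and b: "b \<in> Basis"
  shows "partial_deriv b (tensor_family D \<beta>) = tensor_family D (add_mset b \<beta>)"
proof
  fix x
  show "partial_deriv b (tensor_family D \<beta>) x = tensor_family D (add_mset b \<beta>) x"
  proof (rule partial_deriv_eqI)
    let ?P = "\<Prod>c\<in>Basis - {b}. D c (count \<beta> c) (x \<bullet> c)"
    have eq: "tensor_family D \<beta> (x + s *\<^sub>R b) = D b (count \<beta> b) (x \<bullet> b + s) * ?P" for s
    proof -
      have "tensor_family D \<beta> (x + s *\<^sub>R b) = D b (count \<beta> b) ((x + s *\<^sub>R b) \<bullet> b)
          * (\<Prod>c\<in>Basis - {b}. D c (count \<beta> c) ((x + s *\<^sub>R b) \<bullet> c))"
        unfolding tensor_family_def using b by (simp add: prod.remove)
      also have "(\<Prod>c\<in>Basis - {b}. D c (count \<beta> c) ((x + s *\<^sub>R b) \<bullet> c)) = ?P"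
        using b by (intro prod.cong) (auto simp: inner_add_left inner_Basis)
      finally show ?thesis using b by (simp add: inner_add_left)
    qed
    have "tensor_family D (add_mset b \<beta>) x = D b (Suc (count \<beta> b)) (x \<bullet> b)
          * (\<Prod>c\<in>Basis - {b}. D c (count (add_mset b \<beta>) c) (x \<bullet> c))"
      unfolding tensor_family_def using b by (simp add: prod.remove)
    also have "(\<Prod>c\<in>Basis - {b}. D c (count (add_mset b \<beta>) c) (x \<bullet> c)) = ?P"
      by (intro prod.cong) auto
    finally have eq': "tensor_family D (add_mset b \<beta>) x = D b (Suc (count \<beta> b)) (x \<bullet> b) * ?P" .
    have "((\<lambda>s. D b (count \<beta> b) (x \<bullet> b + s)) has_real_derivative D b (Suc (count \<beta> b)) (x \<bullet> b)) (at 0)"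
      using D[OF b, of "count \<beta> b" "x \<bullet> b"] DERIV_at_within_shift[of "D b (count \<beta> b)" _ "x \<bullet> b" 0 UNIV] 
      by (simp add: DERIV_shift add.commute)
    then show "((\<lambda>s. tensor_family D \<beta> (x + s *\<^sub>R b)) has_real_derivative tensor_family D (add_mset b \<beta>) x) (at 0)"
      unfolding eq eq' by (rule DERIV_cmult_right)
  qed
qed

lemma tensor_family_continuous:
  assumes D: "\<And>b k x. b \<in> Basis \<Longrightarrow> (D b k has_real_derivative D b (Suc k) x) (at x)"
  shows "continuous_on UNIV (tensor_family D \<beta>)"
  by (simp add: continuous_at_imp_continuous_on differentiable_imp_continuous_within
      tensor_family_differentiable[where D = D, OF D])

lemma tensor_family_smooth:
  fixes D :: "'a::euclidean_space \<Rightarrow> nat \<Rightarrow> real \<Rightarrow> real"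
  assumes D: "\<And>b k x. b \<in> Basis \<Longrightarrow> (D b k has_real_derivative D b (Suc k) x) (at x)"
  shows "smooth_fun (tensor_family D {#})"
proof -
  have "partial_derivs bs (tensor_family D {#}) = tensor_family D (mset bs)" if "bs \<in> lists Basis" for bs
    using that by (induction bs) (auto simp: tensor_family_partial[where D = D, OF D])
  then show ?thesis
    unfolding smooth_fun_def differentiable_on_def
    by (auto intro!: differentiable_at_withinI tensor_family_differentiable D)
qed

text \<open>The bumps are \<open>H (c (s - p)) H (c (q - s))\<close> in each coordinate with \<open>H s = exp (-1/s)\<close> for
  \<open>s > 0\<close>; as \<open>c\<close> tends to infinity they increase to the indicator function of the box.\<close>

lemma box_bump:
  fixes p q :: "'a::euclidean_space"
  assumes c: "0 < c"
  shows "\<exists>\<Phi>. (\<forall>\<beta>. continuous_on UNIV (\<Phi> \<beta>)) \<and> (\<forall>\<beta> x. \<Phi> \<beta> differentiable (at x)) \<and>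
    (\<forall>\<beta>. \<forall>b\<in>Basis. partial_deriv b (\<Phi> \<beta>) = \<Phi> (add_mset b \<beta>)) \<and>
    (\<forall>\<beta> x. x \<notin> cbox p q \<longrightarrow> \<Phi> \<beta> x = 0) \<and>
    \<Phi> {#} = (\<lambda>x. \<Prod>b\<in>Basis. flat_exp 0 (c * (x \<bullet> b - p \<bullet> b)) * flat_exp 0 (c * (q \<bullet> b - x \<bullet> b))) \<and>
    \<Phi> {#} \<in> test_fun (cbox p q)"
proof -
  have "\<exists>D. D 0 = (\<lambda>s. flat_exp 0 (c * (s - p \<bullet> b)) * flat_exp 0 (c * (q \<bullet> b - s))) \<and>
    (\<forall>k x. (D k has_real_derivative D (Suc k) x) (at x))" for b
    using bump_1d[of c "p \<bullet> b" "q \<bullet> b"] by metis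
  then obtain D where D0: "\<And>b. D b 0 = (\<lambda>s. flat_exp 0 (c * (s - p \<bullet> b)) * flat_exp 0 (c * (q \<bullet> b - s)))"
    and D: "\<And>b k x. (D b k has_real_derivative D b (Suc k) x) (at x)" by metis
  have van: "tensor_family D \<beta> x = 0" if x: "x \<notin> cbox p q" for \<beta> x
  proof -
    obtain b where b: "b \<in> Basis" "x \<bullet> b \<in> - {p \<bullet> b..q \<bullet> b}"
      using x by (auto simp: mem_box)
    \<comment> \<open>One coordinate of x lies in the open set where the one-variable bump vanishes
      identically, and there all its derivatives vanish too.\<close>
    have "D b (count \<beta> b) (x \<bullet> b) = 0"
      by (rule deriv_family_vanish[of "D b" "- {p \<bullet> b..q \<bullet> b}"])
        (use c b D in \<open>auto simp: D0 flat_exp_def zero_less_mult_iff\<close>)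
    with b(1) show ?thesis unfolding tensor_family_def by (auto intro!: prod_zero)
  qed
  have sub: "closure {x. tensor_family D {#} x \<noteq> 0} \<subseteq> cbox p q"
    by (rule closure_minimal) (use van in auto)
  then have "compact (closure {x. tensor_family D {#} x \<noteq> 0})"
    by (simp add: compact_eq_bounded_closed bounded_subset[OF bounded_cbox])
  then have "tensor_family D {#} \<in> test_fun (cbox p q)"
    unfolding test_fun_def using sub tensor_family_smooth[where D = D, OF D] by simp
  moreover have "tensor_family D {#} = (\<lambda>x. \<Prod>b\<in>Basis. flat_exp 0 (c * (x \<bullet> b - p \<bullet> b)) * flat_exp 0 (c * (q \<bullet> b - x \<bullet> b)))"
    by (simp add: tensor_family_def[abs_def] D0)
  ultimately show ?thesis
    by (intro exI[of _ "tensor_family D"] conjI allI ballI impI)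
      (simp_all add: van tensor_family_continuous[where D = D, OF D] tensor_family_differentiable[where D = D, OF D] tensor_family_partial[where D = D, OF D])
qed

text \<open>Used three times: to test against indicator functions of boxes in the fundamental lemma,
  to supply one mollifier for the averaging kernel, and to approximate indicator functions in
  L1.\<close>

lemma box_bump_sequence:
  fixes p q :: "'a::euclidean_space"
  obtains \<Phi> :: "nat \<Rightarrow> 'a multiset \<Rightarrow> 'a \<Rightarrow> real"
    where "\<And>k \<beta>. continuous_on UNIV (\<Phi> k \<beta>)"
    "\<And>k \<beta> x. \<Phi> k \<beta> differentiable (at x)"
    "\<And>k \<beta> b. b \<in> Basis \<Longrightarrow> partial_deriv b (\<Phi> k \<beta>) = \<Phi> k (add_mset b \<beta>)"
    "\<And>k \<beta> x. x \<notin> cbox p q \<Longrightarrow> \<Phi> k \<beta> x = 0"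
    "\<And>k. \<Phi> k {#} \<in> test_fun (cbox p q)"
    "\<And>k x. 0 \<le> \<Phi> k {#} x" "\<And>k x. \<Phi> k {#} x \<le> 1"
    "\<And>k x. 0 < \<Phi> k {#} x \<longleftrightarrow> x \<in> box p q"
    "\<And>x. (\<lambda>k. \<Phi> k {#} x) \<longlonglongrightarrow> indicator (box p q) x"
proof -
  \<comment> \<open>\<open>Suc k\<close> and not \<open>k\<close>, since \<open>box_bump\<close>
    asks for a positive steepness.\<close>
  let ?g = "\<lambda>(k::nat) (x::'a) b. flat_exp 0 (real (Suc k) * (x \<bullet> b - p \<bullet> b)) * flat_exp 0 (real (Suc k) * (q \<bullet> b - x \<bullet> b))"
  have "\<exists>\<Phi> :: 'a multiset \<Rightarrow> 'a \<Rightarrow> real. (\<forall>\<beta>. continuous_on UNIV (\<Phi> \<beta>)) \<and> (\<forall>\<beta> x. \<Phi> \<beta> differentiable (at x)) \<and>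
    (\<forall>\<beta>. \<forall>b\<in>Basis. partial_deriv b (\<Phi> \<beta>) = \<Phi> (add_mset b \<beta>)) \<and>
    (\<forall>\<beta> x. x \<notin> cbox p q \<longrightarrow> \<Phi> \<beta> x = 0) \<and> \<Phi> {#} = (\<lambda>x. \<Prod>b\<in>Basis. ?g k x b) \<and>
    \<Phi> {#} \<in> test_fun (cbox p q)" for k
    by (rule box_bump) simp
  then obtain \<Phi> :: "nat \<Rightarrow> 'a multiset \<Rightarrow> 'a \<Rightarrow> real" where
    \<Phi>: "\<And>k. (\<forall>\<beta>. continuous_on UNIV (\<Phi> k \<beta>)) \<and> (\<forall>\<beta> x. \<Phi> k \<beta> differentiable (at x)) \<and>
    (\<forall>\<beta>. \<forall>b\<in>Basis. partial_deriv b (\<Phi> k \<beta>) = \<Phi> k (add_mset b \<beta>)) \<and>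
    (\<forall>\<beta> x. x \<notin> cbox p q \<longrightarrow> \<Phi> k \<beta> x = 0) \<and> \<Phi> k {#} = (\<lambda>x. \<Prod>b\<in>Basis. ?g k x b) \<and>
    \<Phi> k {#} \<in> test_fun (cbox p q)"
    using choice[of "\<lambda>k \<Phi>. (\<forall>\<beta>. continuous_on UNIV (\<Phi> \<beta>)) \<and> (\<forall>\<beta> x. \<Phi> \<beta> differentiable (at x)) \<and>
    (\<forall>\<beta>. \<forall>b\<in>Basis. partial_deriv b (\<Phi> \<beta>) = \<Phi> (add_mset b \<beta>)) \<and>
    (\<forall>\<beta> x. x \<notin> cbox p q \<longrightarrow> \<Phi> \<beta> x = 0) \<and> \<Phi> {#} = (\<lambda>x. \<Prod>b\<in>Basis. ?g k x b) \<and>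
    \<Phi> {#} \<in> test_fun (cbox p q)"] by blast
  have e: "\<Phi> k {#} x = (\<Prod>b\<in>Basis. ?g k x b)" for k x using \<Phi>[of k] by simp
  have f01: "0 \<le> flat_exp 0 s" "flat_exp 0 s \<le> 1" for s by (auto simp: flat_exp_def)
  have fpos: "0 < flat_exp 0 s \<longleftrightarrow> 0 < s" for s by (auto simp: flat_exp_def)
  have lim1: "(\<lambda>k. flat_exp 0 (real (Suc k) * s)) \<longlonglongrightarrow> 1" if "0 < s" for s
  proof -
    have "(\<lambda>k. exp (- (1 / s) * inverse (real (Suc k)))) \<longlonglongrightarrow> exp (- (1 / s) * 0)"
      by (intro tendsto_intros LIMSEQ_inverse_real_of_nat)
    then show ?thesis using that by (simp add: flat_exp_def field_simps del: of_nat_Suc)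
  qed
  have pos: "0 < \<Phi> k {#} x \<longleftrightarrow> x \<in> box p q" for k x
  proof
    assume "x \<in> box p q" then show "0 < \<Phi> k {#} x"
      unfolding e by (intro prod_pos mult_pos_pos) (auto simp: fpos mem_box simp del: of_nat_Suc)
  next
    assume "0 < \<Phi> k {#} x"
    then have "(\<Prod>b\<in>Basis. ?g k x b) \<noteq> 0" unfolding e by (rule less_imp_neq[symmetric])
    then have "\<And>b. b \<in> Basis \<Longrightarrow> ?g k x b \<noteq> 0"
      unfolding prod_zero_iff[OF finite_Basis] by blast
    then have "\<And>b. b \<in> Basis \<Longrightarrow> flat_exp 0 (real (Suc k) * (x \<bullet> b - p \<bullet> b)) > 0 \<and> flat_exp 0 (real (Suc k) * (q \<bullet> b - x \<bullet> b)) > 0"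
      by (metis f01(1) mult_eq_0_iff order_less_le)
    then show "x \<in> box p q" by (auto simp: mem_box fpos zero_less_mult_iff simp del: of_nat_Suc)
  qed
  have nn: "0 \<le> \<Phi> k {#} x" for k x unfolding e by (intro prod_nonneg mult_nonneg_nonneg f01)
  have "(\<lambda>k. \<Phi> k {#} x) \<longlonglongrightarrow> indicator (box p q) x" for x
  proof (cases "x \<in> box p q")
    case True
    have "(\<lambda>k. \<Prod>b\<in>Basis. ?g k x b) \<longlonglongrightarrow> (\<Prod>b\<in>(Basis :: 'a set). 1 * 1)"
    proof (rule tendsto_prod[where f = "\<lambda>b k. ?g k x b" and L = "\<lambda>_. 1 * 1"])
      fix b :: 'a assume "b \<in> Basis"
      with True show "(\<lambda>k. ?g k x b) \<longlonglongrightarrow> 1 * 1"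
        by (intro tendsto_mult lim1) (auto simp: mem_box)
    qed
    then show ?thesis using True by (simp add: e)
  next
    case False
    then have "\<Phi> k {#} x = 0" for k using pos[of k x] nn[of k x] by simp
    with False show ?thesis by simp
  qed
  moreover have "\<Phi> k {#} x \<le> 1" for k x
    unfolding e by (intro prod_le_1 conjI mult_le_one mult_nonneg_nonneg f01)
  ultimately show ?thesis using that[of \<Phi>] \<Phi> pos nn by blast
qed

section \<open>Translations, dilations and Fubini\<close>

lemma lborel_translate:
  fixes f :: "'a::euclidean_space \<Rightarrow> real"
  assumes [measurable]: "f \<in> borel_measurable borel"
  shows integrable_translate_iff: "integrable lborel (\<lambda>x. f (x + h)) \<longleftrightarrow> integrable lborel f"
    and integral_translate: "(\<integral>x. f (x + h) \<partial>lborel) = (\<integral>x. f x \<partial>lborel)"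
proof -
  have d: "distr lborel borel (\<lambda>x. x + h) = lborel" for h :: 'a
  proof -
    have "(\<lambda>x. x + h) = (+) h" by (simp add: fun_eq_iff add.commute)
    then show ?thesis by (simp add: lborel_distr_plus)
  qed
  have "integrable lborel f = integrable (distr lborel borel (\<lambda>x. x + h)) f" by (simp only: d)
  also have "\<dots> = integrable lborel (\<lambda>x. f (x + h))" by (subst integrable_distr_eq) auto
  finally show "integrable lborel (\<lambda>x. f (x + h)) \<longleftrightarrow> integrable lborel f" by simp
  have "integral\<^sup>L lborel f = integral\<^sup>L (distr lborel borel (\<lambda>x. x + h)) f" by (simp only: d)
  also have "\<dots> = (\<integral>x. f (x + h) \<partial>lborel)" by (subst integral_distr) auto
  finally show "(\<integral>x. f (x + h) \<partial>lborel) = (\<integral>x. f x \<partial>lborel)" by simp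
qed

lemma nn_integral_translate:
  fixes f :: "'a::euclidean_space \<Rightarrow> ennreal"
  assumes [measurable]: "f \<in> borel_measurable borel"
  shows "(\<integral>\<^sup>+x. f (x + h) \<partial>lborel) = (\<integral>\<^sup>+x. f x \<partial>lborel)"
proof -
  have d: "distr lborel borel (\<lambda>x. x + h) = lborel"
  proof -
    have "(\<lambda>x. x + h) = (+) h" by (simp add: fun_eq_iff add.commute)
    then show ?thesis by (simp add: lborel_distr_plus)
  qed
  have "(\<integral>\<^sup>+x. f x \<partial>lborel) = (\<integral>\<^sup>+x. f x \<partial>distr lborel borel (\<lambda>x. x + h))" by (simp only: d)
  also have "\<dots> = (\<integral>\<^sup>+x. f (x + h) \<partial>lborel)" by (subst nn_integral_distr) auto
  finally show ?thesis by simp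
qed

lemma nn_integral_dilate:
  fixes f :: "'a::euclidean_space \<Rightarrow> ennreal"
  assumes [measurable]: "f \<in> borel_measurable borel" and c: "0 < c"
  shows "(\<integral>\<^sup>+x. f x \<partial>lborel) = ennreal (c ^ DIM('a)) * (\<integral>\<^sup>+x. f (c *\<^sub>R x) \<partial>lborel)"
proof -
  have "(\<integral>\<^sup>+x. f x \<partial>lborel) = (\<integral>\<^sup>+x. f x \<partial>density (distr lborel borel (\<lambda>x. 0 + c *\<^sub>R x)) (\<lambda>_. \<bar>c\<bar> ^ DIM('a)))"
    using c lborel_affine[of c "0::'a"] by simp
  also have "\<dots> = ennreal (c ^ DIM('a)) * (\<integral>\<^sup>+x. f (c *\<^sub>R x) \<partial>lborel)"
    using c by (subst nn_integral_density) (auto simp: nn_integral_distr nn_integral_cmult)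
  finally show ?thesis .
qed

lemma lborel_dilate:
  fixes f :: "'a::euclidean_space \<Rightarrow> real"
  assumes f [measurable]: "f \<in> borel_measurable borel" and c: "0 < c"
  shows integrable_dilate_iff: "integrable lborel (\<lambda>x. f (c *\<^sub>R x)) \<longleftrightarrow> integrable lborel f"
    and integral_dilate: "(\<integral>x. f x \<partial>lborel) = c ^ DIM('a) * (\<integral>x. f (c *\<^sub>R x) \<partial>lborel)"
proof -
  have e: "lborel = density (distr lborel borel (\<lambda>x::'a. c *\<^sub>R x)) (\<lambda>_. c ^ DIM('a))"
    using c lborel_affine[of c "0::'a"] by simp
  have "integrable lborel f \<longleftrightarrow> integrable (density (distr lborel borel (\<lambda>x::'a. c *\<^sub>R x)) (\<lambda>_. c ^ DIM('a))) f"
    by (simp only: e[symmetric])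
  also have "\<dots> \<longleftrightarrow> integrable (distr lborel borel (\<lambda>x::'a. c *\<^sub>R x)) (\<lambda>x. c ^ DIM('a) * f x)"
    using c by (subst integrable_real_density) auto
  also have "\<dots> \<longleftrightarrow> integrable lborel (\<lambda>x. c ^ DIM('a) * f (c *\<^sub>R x))"
    by (subst integrable_distr_eq) auto
  also have "\<dots> \<longleftrightarrow> integrable lborel (\<lambda>x. f (c *\<^sub>R x))"
    using c by simp
  finally show "integrable lborel (\<lambda>x. f (c *\<^sub>R x)) \<longleftrightarrow> integrable lborel f" by simp
  have "integral\<^sup>L lborel f = integral\<^sup>L (density (distr lborel borel (\<lambda>x::'a. c *\<^sub>R x)) (\<lambda>_. c ^ DIM('a))) f"
    by (simp only: e[symmetric])
  also have "\<dots> = integral\<^sup>L (distr lborel borel (\<lambda>x::'a. c *\<^sub>R x)) (\<lambda>x. c ^ DIM('a) * f x)"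
    using c by (subst integral_real_density) auto
  also have "\<dots> = (\<integral>x. c ^ DIM('a) * f (c *\<^sub>R x) \<partial>lborel)"
    by (subst integral_distr) auto
  finally show "(\<integral>x. f x \<partial>lborel) = c ^ DIM('a) * (\<integral>x. f (c *\<^sub>R x) \<partial>lborel)" by simp
qed

lemma integrable_bounded_mult:
  fixes u w :: "'a \<Rightarrow> real"
  assumes "integrable M u" "w \<in> borel_measurable M" "\<And>x. \<bar>w x\<bar> \<le> B"
  shows "integrable M (\<lambda>x. u x * w x)"
proof (rule Bochner_Integration.integrable_bound[of _ "\<lambda>x. B * u x"])
  have "0 \<le> B" using assms(3)[of undefined] by linarith
  then show "AE x in M. norm (u x * w x) \<le> norm (B * u x)"
  proof (intro always_eventually allI)
    fix x
    have "\<bar>u x\<bar> * \<bar>w x\<bar> \<le> \<bar>u x\<bar> * B" using assms(3) by (rule mult_left_mono) simp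
    then show "norm (u x * w x) \<le> norm (B * u x)"
      using \<open>0 \<le> B\<close> by (simp add: abs_mult mult.commute)
  qed
qed (use assms in auto)

text \<open>The hypothesis of Fubini's theorem for all later exchanges: translation preserves the L1
  norm, so the inner integral is \<bar>k y\<bar> times the norm of u. The bounded factor w carries
  test functions, and y may range over another space, such as the parameter of a segment.\<close>

lemma integrable_translate_kernel:
  fixes u :: "'a::euclidean_space \<Rightarrow> real" and k :: "'b::euclidean_space \<Rightarrow> real"
  assumes u: "integrable lborel u" and k: "integrable lborel k"
    and \<tau> [measurable]: "\<tau> \<in> borel_measurable borel"
    and w [measurable]: "(\<lambda>(y, x). w y x) \<in> borel_measurable (borel \<Otimes>\<^sub>M borel)"
    and B: "\<And>y x. \<bar>w y x\<bar> \<le> B"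
  shows "integrable (lborel \<Otimes>\<^sub>M lborel) (\<lambda>(y, x). u (x + \<tau> y) * k y * w y x)"
proof -
  have [measurable]: "u \<in> borel_measurable borel" "k \<in> borel_measurable borel"
    using u k by auto
  have "integrable (lborel \<Otimes>\<^sub>M lborel) (\<lambda>(y, x). u (x + \<tau> y) * k y)"
  proof (rule lborel_pair.Fubini_integrable)
    show "(\<lambda>(y, x). u (x + \<tau> y) * k y) \<in> borel_measurable (lborel \<Otimes>\<^sub>M lborel)"
      by measurable
    have "(\<integral>x. norm (u (x + \<tau> y) * k y) \<partial>lborel) = (\<integral>x. \<bar>u x\<bar> \<partial>lborel) * \<bar>k y\<bar>" for y
      using integral_translate[of "\<lambda>x. \<bar>u x\<bar>" "\<tau> y"] by (simp add: abs_mult)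
    then show "integrable lborel (\<lambda>y. \<integral>x. norm (case (y, x) of (y, x) \<Rightarrow> u (x + \<tau> y) * k y) \<partial>lborel)"
      using k by simp
    show "AE y in lborel. integrable lborel (\<lambda>x. case (y, x) of (y, x) \<Rightarrow> u (x + \<tau> y) * k y)"
      using u by (simp add: integrable_translate_iff)
  qed
  from integrable_bounded_mult[OF this, of "\<lambda>(y, x). w y x" B]
  show ?thesis using B by (simp add: case_prod_beta' )
qed

lemma integral_swap_translate_kernel:
  fixes u :: "'a::euclidean_space \<Rightarrow> real" and k :: "'b::euclidean_space \<Rightarrow> real"
  assumes "integrable lborel u" "integrable lborel k" "\<tau> \<in> borel_measurable borel"
    "(\<lambda>(y, x). w y x) \<in> borel_measurable (borel \<Otimes>\<^sub>M borel)" "\<And>y x. \<bar>w y x\<bar> \<le> B"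
  shows "(\<integral>x. (\<integral>y. u (x + \<tau> y) * k y * w y x \<partial>lborel) \<partial>lborel)
       = (\<integral>y. (\<integral>x. u (x + \<tau> y) * k y * w y x \<partial>lborel) \<partial>lborel)"
  using lborel_pair.Fubini_integral[OF integrable_translate_kernel[OF assms]] by simp

text \<open>Integrate g (x + b) - g x, written as an integral of g' over the segment, with respect
  to x. Translation invariance makes the result 0, and Fubini's theorem identifies it with the
  integral of g'. Applied to products, this is integration by parts without boundary terms.\<close>

lemma integral_directional_derivative_eq_0:
  fixes g g' :: "'a::euclidean_space \<Rightarrow> real"
  assumes g: "integrable lborel g" and g': "integrable lborel g'"
    and D: "\<And>x s. ((\<lambda>s. g (x + s *\<^sub>R b)) has_real_derivative g' (x + s *\<^sub>R b)) (at s)"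
    and C: "\<And>x. continuous_on UNIV (\<lambda>s. g' (x + s *\<^sub>R b))"
  shows "(\<integral>x. g' x \<partial>lborel) = 0"
proof -
  have [measurable]: "g \<in> borel_measurable borel" "g' \<in> borel_measurable borel" using g g' by auto
  let ?i = "indicator {0..1::real} :: real \<Rightarrow> real"
  have i: "integrable lborel ?i" by simp
  have "(\<integral>s. g' (x + s *\<^sub>R b) * ?i s \<partial>lborel) = g (x + b) - g x" for x
    using integral_FTC_Icc_real[of 0 1 "\<lambda>s. g (x + s *\<^sub>R b)" "\<lambda>s. g' (x + s *\<^sub>R b)"] D C[of x]
    by (auto simp: continuous_on_eq_continuous_at)
  then have "(\<integral>x. (\<integral>s. g' (x + s *\<^sub>R b) * ?i s * 1 \<partial>lborel) \<partial>lborel) = (\<integral>x. g (x + b) - g x \<partial>lborel)"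
    by simp
  also have "\<dots> = 0"
    using g by (simp add: integrable_translate_iff integral_translate)
  finally have "(\<integral>s. (\<integral>x. g' (x + s *\<^sub>R b) * ?i s * 1 \<partial>lborel) \<partial>lborel) = 0"
    by (subst (asm) integral_swap_translate_kernel[OF g' i, of "\<lambda>s. s *\<^sub>R b" "\<lambda>_ _. 1" 1]) auto
  then show ?thesis by (simp add: integral_translate)
qed

section \<open>The fundamental lemma of the calculus of variations\<close>

text \<open>Boxes are stable under intersection and generate the Borel sets, so by Dynkin's argument
  all integrals over Borel sets vanish. The complement step needs the integral over the whole space,
  which is a limit over growing boxes.\<close>

lemma AE_zero_if_box_integrals_zero:
  fixes d :: "'a::euclidean_space \<Rightarrow> real"
  assumes d: "integrable lborel d" and box: "\<And>p q. (LINT x:box p q|lborel. d x) = 0"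
  shows "AE x in lborel. d x = 0"
proof (rule sigma_finite_measure.density_zero[OF sigma_finite_lborel d])
  have [measurable]: "d \<in> borel_measurable borel" using d by auto
  have si: "set_integrable lborel A d" if "A \<in> sets borel" for A
    using that d integrable_mult_indicator[of A lborel d] by (simp add: set_integrable_def)
  have all: "(\<integral>x. d x \<partial>lborel) = 0"
  proof -
    let ?B = "\<lambda>n::nat. box (- real n *\<^sub>R One) (real n *\<^sub>R One) :: 'a set"
    have lim: "(\<lambda>n. LINT x:?B n|lborel. d x) \<longlonglongrightarrow> (LINT x:(\<Union>n. ?B n)|lborel. d x)"
    proof (rule set_integral_cont_up)
      show "incseq ?B"
        by (auto simp: incseq_def mem_box) (meson le_less_trans less_le_trans neg_le_iff_le of_nat_le_iff)+
    qed (auto intro: si)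
    have "(\<Union>n. ?B n) = UNIV"
      using UN_box_eq_UNIV by simp
    with lim have "(\<lambda>n. LINT x:?B n|lborel. d x) \<longlonglongrightarrow> (\<integral>x. d x \<partial>lborel)"
      by (simp add: set_lebesgue_integral_def)
    then show ?thesis unfolding box by (simp add: LIMSEQ_const_iff)
  qed
  let ?G = "range (\<lambda>(a, b). box a b :: 'a set)"
  have G: "Int_stable ?G" "?G \<subseteq> Pow UNIV"
    by (auto simp: Int_stable_def box_Int_box)
  fix A :: "'a set" assume "A \<in> sets lborel"
  then have "A \<in> sigma_sets UNIV ?G" by (simp add: borel_eq_box)
  with G show "set_lebesgue_integral lborel A d = 0"
  proof (induction rule: sigma_sets_induct_disjoint)
    case (basic A) then show ?case using box by auto
  next
    case empty then show ?case by (simp add: set_lebesgue_integral_def)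
  next
    case (compl A)
    then have [measurable]: "A \<in> sets borel" by (simp add: borel_eq_box)
    have "(LINT x:UNIV|lborel. d x) = (LINT x:A|lborel. d x) + (LINT x:UNIV - A|lborel. d x)"
      using set_integral_Un[of A "UNIV - A" lborel d] si[of A] si[of "UNIV - A"] by (simp add: Un_commute)
    then show ?case using compl.IH all by (simp add: set_lebesgue_integral_def)
  next
    case (union A)
    then have A: "A i \<in> sets borel" for i by (auto simp: borel_eq_box)
    then have "(LINT x:(\<Union>i. A i)|lborel. d x) = (\<Sum>i. LINT x:A i|lborel. d x)"
      using union.hyps(1) by (intro lebesgue_integral_countable_add si) (auto simp: disjoint_family_on_def)
    then show ?case using union.IH by simp
  qed
qed

lemma locally_integrable_test_fun:
  fixes u :: "'a::euclidean_space \<Rightarrow> real"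
  assumes u: "locally_integrable \<Omega> u" and \<phi>: "\<phi> \<in> test_fun \<Omega>"
  shows "integrable lebesgue (\<lambda>x. u x * \<phi> x)"
proof -
  let ?K = "closure {x. \<phi> x \<noteq> 0}"
  have "set_integrable lebesgue ?K u"
    using u \<phi> by (auto simp: locally_integrable_def test_fun_def)
  then have K: "integrable lebesgue (\<lambda>x. indicator ?K x * u x)" by (simp add: set_integrable_def)
  obtain B where B: "\<And>x. \<bar>\<phi> x\<bar> \<le> B" using test_fun_bounded[OF \<phi>] by auto
  have "\<phi> \<in> borel_measurable lebesgue"
    using test_fun_borel[OF \<phi>] by (simp add: measurable_completion)
  with K have "integrable lebesgue (\<lambda>x. (indicator ?K x * u x) * \<phi> x)"
    using B by (rule integrable_bounded_mult)
  moreover have "(indicator ?K x * u x) * \<phi> x = u x * \<phi> x" for x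
    using closure_subset[of "{x. \<phi> x \<noteq> 0}"] by (auto simp: indicator_def)
  ultimately show ?thesis by simp
qed

lemma set_integral_test_fun:
  assumes "\<phi> \<in> test_fun \<Omega>"
  shows "(LINT x:\<Omega>|lebesgue. u x * \<phi> x) = (\<integral>x. u x * \<phi> x \<partial>lebesgue)"
  unfolding set_lebesgue_integral_def
  by (intro Bochner_Integration.integral_cong) (auto simp: indicator_def test_fun_vanish[OF assms])

lemma set_integral_test_fun_borel:
  assumes \<phi>: "\<phi> \<in> test_fun \<Omega>" and [measurable]: "u \<in> borel_measurable borel"
  shows "(LINT x:\<Omega>|lebesgue. u x * \<phi> x) = (\<integral>x. u x * \<phi> x \<partial>lborel)"
proof -
  have [measurable]: "\<phi> \<in> borel_measurable borel" using \<phi> by (rule test_fun_borel)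
  show ?thesis unfolding set_integral_test_fun[OF \<phi>] by (rule integral_completion) simp
qed

text \<open>Bumps converge boundedly to the indicator function of a box, so the integral of d
  vanishes over every box whose closure lies in \<Omega>. Since d is integrable only on compact
  subsets, the conclusion is drawn on one closed box at a time, and countably many of them cover
  \<Omega>.\<close>

lemma fundamental_lemma_variations:
  fixes d :: "'a::euclidean_space \<Rightarrow> real"
  assumes "open \<Omega>" and d: "locally_integrable \<Omega> d"
    and zero: "\<And>\<phi>. \<phi> \<in> test_fun \<Omega> \<Longrightarrow> (\<integral>x. d x * \<phi> x \<partial>lebesgue) = 0"
  shows "AE x in lebesgue. x \<in> \<Omega> \<longrightarrow> d x = 0"
proof -
  have box0: "(\<integral>x. indicator (box p q) x * d x \<partial>lebesgue) = 0" if "cbox p q \<subseteq> \<Omega>" for p q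
  proof (rule box_bump_sequence[of p q])
    fix \<Phi> :: "nat \<Rightarrow> 'a multiset \<Rightarrow> 'a \<Rightarrow> real"
    assume \<Phi>: "\<And>k \<beta>. continuous_on UNIV (\<Phi> k \<beta>)"
      "\<And>k \<beta> x. \<Phi> k \<beta> differentiable (at x)"
      "\<And>k \<beta> b. b \<in> Basis \<Longrightarrow> partial_deriv b (\<Phi> k \<beta>) = \<Phi> k (add_mset b \<beta>)"
      "\<And>k \<beta> x. x \<notin> cbox p q \<Longrightarrow> \<Phi> k \<beta> x = 0"
      "\<And>k. \<Phi> k {#} \<in> test_fun (cbox p q)"
      "\<And>k x. 0 \<le> \<Phi> k {#} x" "\<And>k x. \<Phi> k {#} x \<le> 1"
      "\<And>k x. 0 < \<Phi> k {#} x \<longleftrightarrow> x \<in> box p q"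
      "\<And>x. (\<lambda>k. \<Phi> k {#} x) \<longlonglongrightarrow> indicator (box p q) x"
    have t: "\<Phi> k {#} \<in> test_fun \<Omega>" for k using \<Phi>(5) that by (rule test_fun_mono)
    have K: "integrable lebesgue (\<lambda>x. indicator (cbox p q) x * d x)"
      using d that unfolding locally_integrable_def set_integrable_def by auto
    have m: "(\<lambda>x. indicator (cbox p q) x * d x) \<in> borel_measurable lebesgue" using K by auto
    have e: "indicator (box p q) x * d x = indicator (box p q) x * (indicator (cbox p q) x * d x)" for x
      using box_subset_cbox[of p q] by (auto simp: indicator_def)
    have "(\<lambda>k. \<integral>x. d x * \<Phi> k {#} x \<partial>lebesgue) \<longlonglongrightarrow> (\<integral>x. indicator (box p q) x * d x \<partial>lebesgue)"
    proof (rule integral_dominated_convergence[where w = "\<lambda>x. \<bar>indicator (cbox p q) x * d x\<bar>"])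
      show "(\<lambda>x. indicator (box p q) x * d x) \<in> borel_measurable lebesgue"
        unfolding e by (rule borel_measurable_times[OF borel_measurable_indicator m])
          (simp add: fmeasurableD lmeasurable_box)
      show "(\<lambda>x. d x * \<Phi> k {#} x) \<in> borel_measurable lebesgue" for k
        using locally_integrable_test_fun[OF d t] by auto
      show "integrable lebesgue (\<lambda>x. \<bar>indicator (cbox p q) x * d x\<bar>)" using K by auto
      show "AE x in lebesgue. (\<lambda>k. d x * \<Phi> k {#} x) \<longlonglongrightarrow> indicator (box p q) x * d x"
        using tendsto_mult[OF tendsto_const \<Phi>(9)] by (simp add: mult.commute)
      show "AE x in lebesgue. norm (d x * \<Phi> k {#} x) \<le> \<bar>indicator (cbox p q) x * d x\<bar>" for k
      proof (intro always_eventually allI)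
        fix x show "norm (d x * \<Phi> k {#} x) \<le> \<bar>indicator (cbox p q) x * d x\<bar>"
          using \<Phi>(4)[of x k "{#}"] \<Phi>(6)[of k x] \<Phi>(7)[of k x]
          by (cases "x \<in> cbox p q") (auto simp: abs_mult intro!: mult_left_le)
      qed
    qed
    then show ?thesis using zero[OF t] by (simp add: LIMSEQ_const_iff)
  qed
  have cb: "AE x in lebesgue. x \<in> cbox a b \<longrightarrow> d x = 0" if ab: "cbox a b \<subseteq> \<Omega>" for a b
  proof -
    have "set_integrable lebesgue (cbox a b) d"
      using d that unfolding locally_integrable_def by auto
    then have I: "integrable lebesgue (\<lambda>x. indicator (box a b) x * d x)"
      using set_integrable_subset[of lebesgue "cbox a b" d "box a b"] box_subset_cbox[of a b]
      by (simp add: set_integrable_def)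
    then have "(\<lambda>x. indicator (box a b) x * d x) \<in> borel_measurable lebesgue" by auto
    \<comment> \<open>The generation argument concerns Borel sets, whereas d is only Lebesgue
      measurable; hence a Borel representative of d, cut off to the box.\<close>
    from completion_ex_borel_measurable_real[OF this] obtain d' where
      d'[measurable]: "d' \<in> borel_measurable borel" and ae: "AE x in lborel. indicator (box a b) x * d x = d' x"
      by auto
    have ae': "AE x in lebesgue. indicator (box a b) x * d x = d' x"
      using ae by (rule AE_completion)
    have "integrable lebesgue d'"
      using I by (rule integrable_cong_AE_imp) (use ae' in \<open>auto simp: measurable_completion\<close>)
    then have I': "integrable lborel d'" by (simp add: integrable_completion)
    have "AE x in lborel. d' x = 0"
    proof (rule AE_zero_if_box_integrals_zero[OF I'])
      fix p q
      have "(LINT x:box p q|lborel. d' x) = (\<integral>x. indicator (box p q) x * d' x \<partial>lebesgue)"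
        unfolding set_lebesgue_integral_def real_scaleR_def by (rule integral_completion[symmetric]) simp
      also have "\<dots> = (\<integral>x. indicator (box p q \<inter> box a b) x * d x \<partial>lebesgue)"
      proof (rule integral_cong_AE)
        show "(\<lambda>x. indicator (box p q \<inter> box a b) x * d x) \<in> borel_measurable lebesgue"
          unfolding indicator_inter_arith mult.assoc
          by (rule borel_measurable_times[OF borel_measurable_indicator borel_measurable_integrable[OF I]])
            (simp add: fmeasurableD lmeasurable_box)
        show "AE x in lebesgue. indicator (box p q) x * d' x = indicator (box p q \<inter> box a b) x * d x"
          using ae' by eventually_elim (auto simp: indicator_inter_arith)
      qed (auto simp: measurable_completion)
      also have "\<dots> = 0"
      proof (cases "box p q \<inter> box a b = {}")
        case True then show ?thesis by simp
      next
        case False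
        have "\<exists>p' q'. box p q \<inter> box a b = box p' q'" unfolding box_Int_box by blast
        then obtain p' q' where pq: "box p q \<inter> box a b = box p' q'" by blast
        \<comment> \<open>\<open>box0\<close> needs the closed box inside \<Omega>. A nonempty open
          box has the closed one as its closure, which stays inside \<open>cbox a b\<close>.\<close>
        have "cbox p' q' = closure (box p' q')" using False pq by (simp add: closure_box)
        also have "\<dots> \<subseteq> cbox a b"
          using pq box_subset_cbox[of a b] by (intro closure_minimal) auto
        finally have "cbox p' q' \<subseteq> \<Omega>" using ab by blast
        then show ?thesis unfolding pq by (rule box0)
      qed
      finally show "(LINT x:box p q|lborel. d' x) = 0" .
    qed
    then have "AE x in lebesgue. d' x = 0" by (rule AE_completion)
    moreover have "AE x in lebesgue. x \<notin> cbox a b - box a b"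
      using negligible_frontier_interval[of a b] unfolding negligible_iff_null_sets by (rule AE_not_in)
    ultimately show ?thesis using ae' by eventually_elim auto
  qed
  obtain \<D> where \<D>: "countable \<D>" "\<D> \<subseteq> Pow \<Omega>" "\<And>X. X \<in> \<D> \<Longrightarrow> \<exists>a b. X = cbox a b" "\<Union>\<D> = \<Omega>"
    using open_countable_Union_open_cbox[OF \<open>open \<Omega>\<close>] by metis
  have "AE x in lebesgue. \<forall>X\<in>\<D>. x \<in> X \<longrightarrow> d x = 0"
  proof (subst AE_ball_countable[OF \<D>(1)], intro ballI)
    fix X assume X: "X \<in> \<D>"
    then obtain a b where "X = cbox a b" using \<D>(3) by blast
    then show "AE x in lebesgue. x \<in> X \<longrightarrow> d x = 0" using cb[of a b] X \<D>(2) by blast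
  qed
  then show ?thesis by eventually_elim (use \<D>(4) in blast)
qed

section \<open>Families of weak derivatives\<close>

lemma has_weak_deriv_unique:
  assumes "open \<Omega>" and g: "has_weak_deriv \<Omega> \<alpha> u g" and g': "has_weak_deriv \<Omega> \<alpha> u g'"
  shows "AE x in lebesgue. x \<in> \<Omega> \<longrightarrow> g x = g' x"
proof -
  have l: "locally_integrable \<Omega> g" "locally_integrable \<Omega> g'"
    using g g' by (auto simp: has_weak_deriv_def)
  have "AE x in lebesgue. x \<in> \<Omega> \<longrightarrow> g x - g' x = 0"
  proof (rule fundamental_lemma_variations[OF \<open>open \<Omega>\<close>])
    show "locally_integrable \<Omega> (\<lambda>x. g x - g' x)"
      using l by (auto simp: locally_integrable_def intro: set_integral_diff)
    fix \<phi> assume \<phi>: "\<phi> \<in> test_fun \<Omega>"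
    obtain bs where bs: "mset bs = \<alpha>" using ex_mset by blast
    have "(-1) ^ size \<alpha> * (LINT x:\<Omega>|lebesgue. g x * \<phi> x) = (-1) ^ size \<alpha> * (LINT x:\<Omega>|lebesgue. g' x * \<phi> x)"
    proof -
      have "(LINT x:\<Omega>|lebesgue. u x * partial_derivs bs \<phi> x) = (-1) ^ size \<alpha> * (LINT x:\<Omega>|lebesgue. g x * \<phi> x)"
        using g \<phi> bs unfolding has_weak_deriv_def by blast
      moreover have "(LINT x:\<Omega>|lebesgue. u x * partial_derivs bs \<phi> x) = (-1) ^ size \<alpha> * (LINT x:\<Omega>|lebesgue. g' x * \<phi> x)"
        using g' \<phi> bs unfolding has_weak_deriv_def by blast
      ultimately show ?thesis by (rule trans[OF sym])
    qed
    then have "(\<integral>x. g x * \<phi> x \<partial>lebesgue) = (\<integral>x. g' x * \<phi> x \<partial>lebesgue)"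
      by (simp add: set_integral_test_fun[OF \<phi>])
    then show "(\<integral>x. (g x - g' x) * \<phi> x \<partial>lebesgue) = 0"
      using locally_integrable_test_fun[OF l(1) \<phi>] locally_integrable_test_fun[OF l(2) \<phi>]
      by (simp add: left_diff_distrib)
  qed
  then show ?thesis by simp
qed

lemma weak_deriv_AE:
  assumes "open \<Omega>" and g: "has_weak_deriv \<Omega> \<alpha> u g"
  shows "AE x in lebesgue. x \<in> \<Omega> \<longrightarrow> weak_deriv \<Omega> \<alpha> u x = g x"
  by (rule has_weak_deriv_unique[OF assms(1) _ g])
    (unfold weak_deriv_def, rule someI[of "has_weak_deriv \<Omega> \<alpha> u", OF g])

text \<open>Test functions vanish off \<Omega>, so the integrals over the whole space are integrals
  over \<Omega>. The Borel form suits Fubini's theorem and translations;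
  \<open>has_weak_deriv_family\<close> leads back to weak derivatives of any order.\<close>

definition weak_partial ::
    "'a::euclidean_space set \<Rightarrow> 'a \<Rightarrow> ('a \<Rightarrow> real) \<Rightarrow> ('a \<Rightarrow> real) \<Rightarrow> bool" where
  "weak_partial \<Omega> b u g \<longleftrightarrow> (\<forall>\<phi>\<in>test_fun \<Omega>.
     (\<integral>x. u x * partial_deriv b \<phi> x \<partial>lborel) = - (\<integral>x. g x * \<phi> x \<partial>lborel))"

text \<open>Indexing the derivatives by multisets makes the order of differentiation irrelevant, so that
  no symmetry of second derivatives of the test functions is needed.\<close>

lemma has_weak_deriv_family:
  fixes G :: "'a::euclidean_space multiset \<Rightarrow> 'a \<Rightarrow> real"
  assumes [measurable]: "\<And>\<alpha>. G \<alpha> \<in> borel_measurable borel"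
    and loc: "\<And>\<alpha>. size \<alpha> \<le> k \<Longrightarrow> locally_integrable \<Omega> (G \<alpha>)"
    and step: "\<And>\<alpha> b. b \<in> Basis \<Longrightarrow> size \<alpha> < k \<Longrightarrow> weak_partial \<Omega> b (G \<alpha>) (G (add_mset b \<alpha>))"
    and \<alpha>: "set_mset \<alpha> \<subseteq> Basis" "size \<alpha> \<le> k"
  shows "has_weak_deriv \<Omega> \<alpha> (G {#}) (G \<alpha>)"
proof -
  \<comment> \<open>The start \<gamma> varies because each step moves the outermost derivative onto
    \<open>G\<close> and leaves the others to be tested against
    \<open>G (add_mset b \<gamma>)\<close>.\<close>
  have *: "(\<integral>x. G \<gamma> x * partial_derivs bs \<phi> x \<partial>lborel)
      = (-1) ^ length bs * (\<integral>x. G (mset bs + \<gamma>) x * \<phi> x \<partial>lborel)"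
    if "\<phi> \<in> test_fun \<Omega>" "bs \<in> lists Basis" "size \<gamma> + length bs \<le> k" for \<phi> bs \<gamma>
    using that
  proof (induction bs arbitrary: \<gamma>)
    case (Cons b bs)
    have "(\<integral>x. G \<gamma> x * partial_derivs (b # bs) \<phi> x \<partial>lborel)
      = - (\<integral>x. G (add_mset b \<gamma>) x * partial_derivs bs \<phi> x \<partial>lborel)"
      using step[of b \<gamma>] Cons.prems test_fun_partial_derivs[of \<phi> \<Omega> bs] by (auto simp: weak_partial_def)
    then show ?case using Cons.IH[of "add_mset b \<gamma>"] Cons.prems by simp
  qed simp
  show ?thesis
    unfolding has_weak_deriv_def
  proof (intro conjI ballI allI impI loc \<alpha>)
    fix \<phi> bs assume \<phi>: "\<phi> \<in> test_fun \<Omega>" and bs: "mset bs = \<alpha>"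
    then have l: "bs \<in> lists Basis" "length bs = size \<alpha>" using \<alpha>(1) by auto
    show "(LINT x:\<Omega>|lebesgue. G {#} x * partial_derivs bs \<phi> x)
        = (-1) ^ size \<alpha> * (LINT x:\<Omega>|lebesgue. G \<alpha> x * \<phi> x)"
      using *[OF \<phi> l(1), of "{#}"] l \<alpha>(2) bs
      by (simp add: set_integral_test_fun_borel \<phi> test_fun_partial_derivs)
  qed simp
qed

text \<open>Test the derivative of order \<alpha> against the derivative of \<phi> in direction b,
  and the one of order \<alpha> + b against \<phi>. Both sides are the same integral of f, and the
  signs differ by one factor -1.\<close>

lemma has_weak_deriv_weak_partial:
  fixes f :: "'a::euclidean_space \<Rightarrow> real"
  assumes g: "has_weak_deriv UNIV \<alpha> f g" and g': "has_weak_deriv UNIV (add_mset b \<alpha>) f g'"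
    and \<alpha>: "set_mset \<alpha> \<subseteq> Basis" and b: "b \<in> Basis"
    and v: "v \<in> borel_measurable borel" "AE x in lebesgue. v x = g x"
    and v': "v' \<in> borel_measurable borel" "AE x in lebesgue. v' x = g' x"
  shows "weak_partial UNIV b v v'"
  unfolding weak_partial_def
proof
  fix \<phi> :: "'a \<Rightarrow> real" assume \<phi>: "\<phi> \<in> test_fun UNIV"
  obtain as where as: "mset as = \<alpha>" using ex_mset by blast
  have \<phi>b: "partial_deriv b \<phi> \<in> test_fun UNIV" using \<phi> b by (rule test_fun_partial_deriv)
  have c: "(\<integral>x. v x * \<psi> x \<partial>lborel) = (\<integral>x. g x * \<psi> x \<partial>lebesgue)"
    if t: "\<psi> \<in> test_fun UNIV" and l: "locally_integrable UNIV g"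
      and v: "v \<in> borel_measurable borel" "AE x in lebesgue. v x = g x" for v g \<psi>
  proof -
    have "(\<integral>x. v x * \<psi> x \<partial>lborel) = (\<integral>x. v x * \<psi> x \<partial>lebesgue)"
      using v test_fun_borel[OF t] by (intro integral_completion[symmetric]) simp
    also have "\<dots> = (\<integral>x. g x * \<psi> x \<partial>lebesgue)"
      using v test_fun_borel[OF t] locally_integrable_test_fun[OF l t]
      by (intro integral_cong_AE) (auto simp: measurable_completion)
    finally show ?thesis .
  qed
  have l: "locally_integrable UNIV g" "locally_integrable UNIV g'"
    using g g' by (auto simp: has_weak_deriv_def)
  have "(-1) ^ size \<alpha> * (\<integral>x. g x * partial_deriv b \<phi> x \<partial>lebesgue)
      = (LINT x:UNIV|lebesgue. f x * partial_derivs as (partial_deriv b \<phi>) x)"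
    using g \<phi>b as unfolding has_weak_deriv_def by (simp add: set_integral_test_fun)
  also have "\<dots> = (-1) ^ Suc (size \<alpha>) * (\<integral>x. g' x * \<phi> x \<partial>lebesgue)"
  proof -
    \<comment> \<open>With b last in the list it is the innermost derivative, so the remaining ones
      act on \<open>partial_deriv b \<phi>\<close>.\<close>
    have "mset (as @ [b]) = add_mset b \<alpha>" using as by simp
    then have "(LINT x:UNIV|lebesgue. f x * partial_derivs (as @ [b]) \<phi> x)
        = (-1) ^ size (add_mset b \<alpha>) * (LINT x:UNIV|lebesgue. g' x * \<phi> x)"
      using g' \<phi> unfolding has_weak_deriv_def by blast
    then show ?thesis using set_integral_test_fun[OF \<phi>, of g'] by (simp add: partial_derivs_append)
  qed
  finally have "(-1) ^ size \<alpha> * (\<integral>x. g x * partial_deriv b \<phi> x \<partial>lebesgue)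
      = (-1) ^ size \<alpha> * (- (\<integral>x. g' x * \<phi> x \<partial>lebesgue))" by simp
  then have "(\<integral>x. g x * partial_deriv b \<phi> x \<partial>lebesgue) = - (\<integral>x. g' x * \<phi> x \<partial>lebesgue)"
    unfolding mult_cancel_left by simp
  then show "(\<integral>x. v x * partial_deriv b \<phi> x \<partial>lborel) = - (\<integral>x. v' x * \<phi> x \<partial>lborel)"
    using c[OF \<phi>b l(1) v] c[OF \<phi> l(2) v'] by simp
qed

section \<open>The \<open>L1\<close> norm\<close>

lemma L1_norm_lborel: "L1_norm f = (\<integral>\<^sup>+x. ennreal \<bar>f x\<bar> \<partial>lborel)"
  unfolding L1_norm_def by (rule nn_integral_completion)

lemma L1_norm_cong_AE: "AE x in lebesgue. f x = g x \<Longrightarrow> L1_norm f = L1_norm g"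
  unfolding L1_norm_def by (rule nn_integral_cong_AE) auto

lemma L1_norm_0 [simp]: "L1_norm (\<lambda>x. 0) = 0"
  by (simp add: L1_norm_def)

lemma L1_norm_add:
  assumes [measurable]: "f \<in> borel_measurable borel" "g \<in> borel_measurable borel"
  shows "L1_norm (\<lambda>x. f x + g x) \<le> L1_norm f + L1_norm g"
proof -
  have "L1_norm (\<lambda>x. f x + g x) \<le> (\<integral>\<^sup>+x. ennreal \<bar>f x\<bar> + ennreal \<bar>g x\<bar> \<partial>lborel)"
    unfolding L1_norm_lborel by (intro nn_integral_mono) (simp add: ennreal_plus[symmetric] ennreal_leI del: ennreal_plus)
  then show ?thesis unfolding L1_norm_lborel by (simp add: nn_integral_add)
qed

lemma L1_norm_cmult:
  assumes [measurable]: "f \<in> borel_measurable borel"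
  shows "L1_norm (\<lambda>x. c * f x) = ennreal \<bar>c\<bar> * L1_norm f"
  unfolding L1_norm_lborel by (simp add: abs_mult ennreal_mult nn_integral_cmult)

lemma L1_norm_diff:
  assumes [measurable]: "f \<in> borel_measurable borel" "g \<in> borel_measurable borel"
  shows "L1_norm (\<lambda>x. f x - g x) \<le> L1_norm f + L1_norm g"
  using L1_norm_add[of f "\<lambda>x. (-1) * g x"] L1_norm_cmult[of g "-1"] by simp

lemma L1_norm_sum:
  assumes "\<And>i. i \<in> I \<Longrightarrow> f i \<in> borel_measurable borel"
  shows "L1_norm (\<lambda>x. \<Sum>i\<in>I. f i x) \<le> (\<Sum>i\<in>I. L1_norm (f i))"
  using assms
proof (induction I rule: infinite_finite_induct)
  case (insert i I)
  have "L1_norm (\<lambda>x. f i x + (\<Sum>i\<in>I. f i x)) \<le> L1_norm (f i) + L1_norm (\<lambda>x. \<Sum>i\<in>I. f i x)"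
    using insert.prems by (intro L1_norm_add borel_measurable_sum) auto
  also have "\<dots> \<le> L1_norm (f i) + (\<Sum>i\<in>I. L1_norm (f i))"
    using insert by (intro add_left_mono) auto
  finally show ?case using insert.hyps by simp
qed simp_all

lemma L1_norm_translate:
  assumes [measurable]: "f \<in> borel_measurable borel"
  shows "L1_norm (\<lambda>x. f (x + h)) = L1_norm f"
  unfolding L1_norm_lborel using nn_integral_translate[of "\<lambda>x. ennreal \<bar>f x\<bar>" h] by simp

lemma L1_norm_eq_integral: "integrable lborel f \<Longrightarrow> L1_norm f = ennreal (\<integral>x. \<bar>f x\<bar> \<partial>lborel)"
  unfolding L1_norm_lborel by (intro nn_integral_eq_integral) auto

lemma L1_norm_Minkowski:
  fixes F :: "'b::euclidean_space \<Rightarrow> 'a::euclidean_space \<Rightarrow> real"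
  assumes [measurable]: "(\<lambda>(y, x). F y x) \<in> borel_measurable (borel \<Otimes>\<^sub>M borel)"
  shows "L1_norm (\<lambda>x. \<integral>y. F y x \<partial>lborel) \<le> (\<integral>\<^sup>+y. L1_norm (F y) \<partial>lborel)"
proof -
  \<comment> \<open>Where the integrand is not integrable in y, its Bochner integral is 0 and the
    bound is trivial.\<close>
  have "ennreal \<bar>\<integral>y. F y x \<partial>lborel\<bar> \<le> (\<integral>\<^sup>+y. ennreal \<bar>F y x\<bar> \<partial>lborel)" for x
    using integral_norm_bound_ennreal[of lborel "\<lambda>y. F y x"]
    by (cases "integrable lborel (\<lambda>y. F y x)") (auto simp: not_integrable_integral_eq)
  then have "L1_norm (\<lambda>x. \<integral>y. F y x \<partial>lborel) \<le> (\<integral>\<^sup>+x. (\<integral>\<^sup>+y. ennreal \<bar>F y x\<bar> \<partial>lborel) \<partial>lborel)"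
    unfolding L1_norm_lborel by (intro nn_integral_mono)
  also have "\<dots> = (\<integral>\<^sup>+y. L1_norm (F y) \<partial>lborel)"
    unfolding L1_norm_lborel by (rule lborel_pair.Fubini') measurable
  finally show ?thesis .
qed

lemma integrable_locally_integrable:
  assumes "integrable lborel u"
  shows "locally_integrable \<Omega> u"
  unfolding locally_integrable_def
proof (intro allI impI)
  fix K :: "'a set" assume "compact K \<and> K \<subseteq> \<Omega>"
  then have "K \<in> sets lebesgue" by (simp add: fmeasurableD lmeasurable_compact)
  moreover have "integrable lebesgue u"
    using assms by (subst integrable_completion) auto
  ultimately show "u absolutely_integrable_on K"
    unfolding set_integrable_def by (rule integrable_mult_indicator)
qed

lemma integrable_mult_test_fun:
  assumes "integrable lborel u" "\<phi> \<in> test_fun \<Omega>"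
  shows "integrable lborel (\<lambda>x. u x * \<phi> x)"
proof -
  obtain B where "\<And>x. \<bar>\<phi> x\<bar> \<le> B" using test_fun_bounded[OF assms(2)] by auto
  then show ?thesis using assms test_fun_borel[OF assms(2)] by (intro integrable_bounded_mult[where B = B]) auto
qed

section \<open>Linearity and translation invariance of weak first-order derivatives\<close>

lemma weak_partial_cmult:
  "weak_partial \<Omega> b u g \<Longrightarrow> weak_partial \<Omega> b (\<lambda>x. c * u x) (\<lambda>x. c * g x)"
  by (auto simp: weak_partial_def mult.assoc)

lemma weak_partial_add:
  assumes "integrable lborel u" "integrable lborel g" "integrable lborel u'" "integrable lborel g'"
    "weak_partial \<Omega> b u g" "weak_partial \<Omega> b u' g'" "b \<in> Basis"
  shows "weak_partial \<Omega> b (\<lambda>x. u x + u' x) (\<lambda>x. g x + g' x)"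
  unfolding weak_partial_def
proof
  fix \<phi> assume \<phi>: "\<phi> \<in> test_fun \<Omega>"
  note t = \<phi> test_fun_partial_deriv[OF \<phi> \<open>b \<in> Basis\<close>]
  show "(\<integral>x. (u x + u' x) * partial_deriv b \<phi> x \<partial>lborel) = - (\<integral>x. (g x + g' x) * \<phi> x \<partial>lborel)"
    using assms t integrable_mult_test_fun[OF _ t(1)] integrable_mult_test_fun[OF _ t(2)]
    by (simp add: distrib_right weak_partial_def)
qed

lemma weak_partial_translate:
  assumes [measurable]: "u \<in> borel_measurable borel" "g \<in> borel_measurable borel"
    and w: "weak_partial UNIV b u g" and b: "b \<in> Basis"
  shows "weak_partial UNIV b (\<lambda>x. u (x + h)) (\<lambda>x. g (x + h))"
  unfolding weak_partial_def
proof
  fix \<phi> :: "'a \<Rightarrow> real" assume \<phi>: "\<phi> \<in> test_fun UNIV"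
  have m[measurable]: "\<phi> \<in> borel_measurable borel" "partial_deriv b \<phi> \<in> borel_measurable borel"
    using \<phi> b by (auto intro: test_fun_borel test_fun_partial_deriv)
  let ?\<phi> = "\<lambda>x. \<phi> (- h + 1 *\<^sub>R x)"
  have t: "?\<phi> \<in> test_fun UNIV" "partial_deriv b ?\<phi> x = partial_deriv b \<phi> (x - h)" for x
    using test_fun_affine(1)[OF \<phi>, where r = 1 and z = "- h"]
      test_fun_affine(2)[OF \<phi> _ b, where r = 1 and z = "- h"] by auto
  have "(\<integral>x. u (x + h) * partial_deriv b \<phi> x \<partial>lborel) = (\<integral>x. u x * partial_deriv b ?\<phi> x \<partial>lborel)"
    using integral_translate[of "\<lambda>x. u x * partial_deriv b \<phi> (x - h)" h] unfolding t by simp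
  also have "\<dots> = - (\<integral>x. g x * ?\<phi> x \<partial>lborel)"
    using w t(1) unfolding weak_partial_def by blast
  also have "\<dots> = - (\<integral>x. g (x + h) * \<phi> x \<partial>lborel)"
    using integral_translate[of "\<lambda>x. g x * \<phi> (x - h)" h] by simp
  finally show "(\<integral>x. u (x + h) * partial_deriv b \<phi> x \<partial>lborel) = - (\<integral>x. g (x + h) * \<phi> x \<partial>lborel)" .
qed

section \<open>Finite differences\<close>

lemma diff_op_power:
  "(diff_op h ^^ n) f x = (\<Sum>k\<le>n. (-1) ^ (n - k) * real (n choose k) * f (x + real k *\<^sub>R h))"
proof (induction n arbitrary: x)
  case (Suc n)
  let ?c = "\<lambda>k. (-1) ^ (n - k) * real (n choose k) :: real"
  let ?F = "\<lambda>k. f (x + real k *\<^sub>R h)"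
  have "(diff_op h ^^ Suc n) f x = (\<Sum>k\<le>n. ?c k * ?F (Suc k)) - (\<Sum>k\<le>n. ?c k * ?F k)"
    by (simp add: diff_op_def[of h "(diff_op h ^^ n) f"] Suc.IH algebra_simps)
  also have "\<dots> = (\<Sum>k\<le>Suc n. (-1) ^ (Suc n - k) * real (Suc n choose k) * ?F k)"
  proof -
    have "(\<Sum>k\<le>Suc n. (-1) ^ (Suc n - k) * real (Suc n choose k) * ?F k)
        = (-1) ^ Suc n * ?F 0 + (\<Sum>k\<le>n. (-1) ^ (n - k) * real (Suc n choose Suc k) * ?F (Suc k))"
      by (subst sum.atMost_Suc_shift) simp
    also have "\<dots> = (\<Sum>k\<le>n. ?c k * ?F (Suc k))
        + ((-1) ^ Suc n * ?F 0 + (\<Sum>k\<le>n. (-1) ^ (n - k) * real (n choose Suc k) * ?F (Suc k)))"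
      by (simp add: sum.distrib[symmetric] algebra_simps)
    \<comment> \<open>At k = n + 1 the truncated n - k would give the wrong sign. The extra factor
      lets the index shift go through uniformly, and the binomial coefficient is 0 there.\<close>
    also have "(-1) ^ Suc n * ?F 0 + (\<Sum>k\<le>n. (-1) ^ (n - k) * real (n choose Suc k) * ?F (Suc k))
        = (\<Sum>k\<le>Suc n. - ((-1) ^ (n - k) * (if k \<le> n then 1 else -1) * real (n choose k) * ?F k))"
    proof -
      have "(\<Sum>k\<le>n. (-1) ^ (n - k) * real (n choose Suc k) * ?F (Suc k))
          = (\<Sum>k\<le>n. - ((-1) ^ (n - Suc k) * (if Suc k \<le> n then 1 else -1) * real (n choose Suc k) * ?F (Suc k)))"
      proof (intro sum.cong refl)
        fix k assume "k \<in> {..n}"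
        show "(-1) ^ (n - k) * real (n choose Suc k) * ?F (Suc k)
          = - ((-1) ^ (n - Suc k) * (if Suc k \<le> n then 1 else -1) * real (n choose Suc k) * ?F (Suc k))"
        proof (cases "Suc k \<le> n")
          case True
          then have "n - k = Suc (n - Suc k)" by simp
          with True show ?thesis by simp
        qed (simp add: binomial_eq_0)
      qed
      then show ?thesis by (subst sum.atMost_Suc_shift) simp
    qed
    also have "\<dots> = - (\<Sum>k\<le>n. ?c k * ?F k)"
      by (simp add: binomial_eq_0 sum_negf)
    finally show ?thesis by simp
  qed
  finally show ?case .
qed simp

lemma diff_op_power_joint_measurable [measurable]:
  fixes f :: "'a::euclidean_space \<Rightarrow> real"
  assumes [measurable]: "f \<in> borel_measurable borel" "h \<in> borel_measurable M" "g \<in> borel_measurable M"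
  shows "(\<lambda>y. (diff_op (h y) ^^ n) f (g y)) \<in> borel_measurable M"
  unfolding diff_op_power by measurable

lemma diff_op_power_measurable [measurable]:
  fixes f :: "'a::euclidean_space \<Rightarrow> real"
  assumes [measurable]: "f \<in> borel_measurable borel"
  shows "(diff_op h ^^ n) f \<in> borel_measurable borel"
  unfolding diff_op_power[abs_def] by measurable

lemma diff_op_power_integrable:
  fixes f :: "'a::euclidean_space \<Rightarrow> real"
  assumes "integrable lborel f"
  shows "integrable lborel ((diff_op h ^^ n) f)"
  unfolding diff_op_power[abs_def]
  using assms by (intro Bochner_Integration.integrable_sum integrable_mult_right) (simp add: integrable_translate_iff)

lemma diff_op_power_weak_partial:
  assumes u: "integrable lborel u" and g: "integrable lborel g"
    and w: "weak_partial UNIV b u g" and b: "b \<in> Basis"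
  shows "weak_partial UNIV b ((diff_op h ^^ n) u) ((diff_op h ^^ n) g)"
proof (induction n)
  case (Suc n)
  let ?u = "(diff_op h ^^ n) u" and ?g = "(diff_op h ^^ n) g"
  have i: "integrable lborel ?u" "integrable lborel ?g"
    using u g by (auto intro: diff_op_power_integrable)
  then have m: "?u \<in> borel_measurable borel" "?g \<in> borel_measurable borel" by auto
  have "weak_partial UNIV b (\<lambda>x. ?u (x + h) + (-1) * ?u x) (\<lambda>x. ?g (x + h) + (-1) * ?g x)"
    using i m by (intro weak_partial_add weak_partial_translate weak_partial_cmult Suc.IH b)
      (auto simp: integrable_translate_iff)
  then show ?case by (simp add: diff_op_def[abs_def])
qed (use w in simp)

text \<open>The fundamental theorem of calculus along the segment from x to x + h, by duality: it
  holds classically for a test function, Fubini's theorem and translations transfer it to w, and the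
  fundamental lemma removes the test function.\<close>

lemma diff_op_eq_integral_weak_gradient:
  fixes w :: "'a::euclidean_space \<Rightarrow> real" and v :: "'a \<Rightarrow> 'a \<Rightarrow> real" and h :: 'a
  assumes w: "integrable lborel w" and v: "\<And>b. b \<in> Basis \<Longrightarrow> integrable lborel (v b)"
    and wp: "\<And>b. b \<in> Basis \<Longrightarrow> weak_partial UNIV b w (v b)"
  defines "V \<equiv> \<lambda>x. \<Sum>b\<in>Basis. (h \<bullet> b) * v b x"
  shows "AE x in lebesgue. diff_op h w x = (\<integral>s. V (x + s *\<^sub>R h) * indicator {0..1} s \<partial>lborel)"
proof -
  let ?i = "indicator {0..1::real} :: real \<Rightarrow> real"
  let ?W = "\<lambda>x. \<integral>s. V (x + s *\<^sub>R h) * ?i s \<partial>lborel"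
  have i: "integrable lborel ?i" by simp
  have V: "integrable lborel V"
    unfolding V_def using v by (intro Bochner_Integration.integrable_sum integrable_mult_right)
  have [measurable]: "V \<in> borel_measurable borel" "w \<in> borel_measurable borel" using V w by auto
  have W: "integrable lborel ?W"
  proof -
    have "integrable (lborel \<Otimes>\<^sub>M lborel) (\<lambda>(s, x). V (x + s *\<^sub>R h) * ?i s * 1)"
      by (rule integrable_translate_kernel[OF V i, of _ _ 1]) auto
    from lborel_pair.integrable_snd[OF this] show ?thesis by simp
  qed
  have dw: "integrable lborel (diff_op h w)" using diff_op_power_integrable[OF w, where h = h and n = 1] by simp
  have "AE x in lebesgue. x \<in> UNIV \<longrightarrow> diff_op h w x - ?W x = 0"
  proof (rule fundamental_lemma_variations)
    show "locally_integrable UNIV (\<lambda>x. diff_op h w x - ?W x)"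
      using dw W by (intro integrable_locally_integrable) auto
    fix \<phi> :: "'a \<Rightarrow> real" assume \<phi>: "\<phi> \<in> test_fun UNIV"
    have [measurable]: "\<phi> \<in> borel_measurable borel" using \<phi> by (rule test_fun_borel)
    let ?\<Psi> = "\<lambda>x. \<Sum>b\<in>Basis. (h \<bullet> b) * partial_deriv b \<phi> x"
    have tb: "partial_deriv b \<phi> \<in> test_fun UNIV" if "b \<in> Basis" for b
      using \<phi> that by (rule test_fun_partial_deriv)
    have [measurable]: "?\<Psi> \<in> borel_measurable borel"
      by (intro borel_measurable_sum borel_measurable_times borel_measurable_const) (auto dest: tb intro: test_fun_borel)
    have \<Psi>c: "continuous_on UNIV ?\<Psi>"
      by (intro continuous_intros test_fun_continuous[OF tb])
    obtain B where B: "\<And>x. \<bar>\<phi> x\<bar> \<le> B" using test_fun_bounded[OF \<phi>] by auto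
    obtain B' where B': "\<And>x. \<bar>?\<Psi> x\<bar> \<le> B'"
    proof -
      have "\<exists>C. \<forall>x. \<bar>partial_deriv b \<phi> x\<bar> \<le> C" if "b \<in> Basis" for b
        using test_fun_bounded[OF tb[OF that]] by metis
      then obtain C where C: "\<And>b x. b \<in> Basis \<Longrightarrow> \<bar>partial_deriv b \<phi> x\<bar> \<le> C b" by metis
      have "\<bar>?\<Psi> x\<bar> \<le> (\<Sum>b\<in>Basis. \<bar>h \<bullet> b\<bar> * C b)" for x
        by (rule order_trans[OF sum_abs]) (auto intro!: sum_mono mult_left_mono C simp: abs_mult)
      then show ?thesis by (rule that)
    qed
    \<comment> \<open>The segment runs towards -h, since shifting w by h is dual to shifting \<phi>
      by -h.\<close>
    have line: "\<phi> (x - h) - \<phi> x = - (\<integral>s. ?\<Psi> (x - s *\<^sub>R h) * ?i s \<partial>lborel)" for x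
    proof -
      have D: "((\<lambda>s. - \<phi> (x + s *\<^sub>R (- h))) has_real_derivative ?\<Psi> (x - s *\<^sub>R h)) (at s)" for s
        using DERIV_minus[OF DERIV_line[OF smooth_fun_differentiable[OF test_fun_smooth[OF \<phi>]], of x "- h" s UNIV]]
        by (simp add: sum_negf)
      have "continuous_on UNIV (\<lambda>s. ?\<Psi> (x - s *\<^sub>R h))"
        by (rule continuous_on_compose2[OF \<Psi>c]) (auto intro!: continuous_intros)
      then have "(\<integral>s. ?\<Psi> (x - s *\<^sub>R h) * ?i s \<partial>lborel) = - \<phi> (x + 1 *\<^sub>R (- h)) - (- \<phi> (x + 0 *\<^sub>R (- h)))"
        using integral_FTC_Icc_real[of 0 1 "\<lambda>s. - \<phi> (x + s *\<^sub>R (- h))" "\<lambda>s. ?\<Psi> (x - s *\<^sub>R h)"] D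
        by (auto simp: continuous_on_eq_continuous_at)
      then show ?thesis by simp
    qed
    have weak: "(\<integral>x. w x * ?\<Psi> (x - s *\<^sub>R h) \<partial>lborel) = - (\<integral>x. V (x + s *\<^sub>R h) * \<phi> x \<partial>lborel)" for s
    proof -
      let ?\<phi> = "\<lambda>x. \<phi> (- (s *\<^sub>R h) + 1 *\<^sub>R x)"
      have t: "?\<phi> \<in> test_fun UNIV" "\<And>b x. b \<in> Basis \<Longrightarrow> partial_deriv b ?\<phi> x = partial_deriv b \<phi> (x - s *\<^sub>R h)"
        using test_fun_affine(1)[OF \<phi>, where r = 1 and z = "- (s *\<^sub>R h)"]
          test_fun_affine(2)[OF \<phi>, where r = 1 and z = "- (s *\<^sub>R h)"] by auto
      have t': "(\<lambda>x. partial_deriv b \<phi> (x - s *\<^sub>R h)) \<in> test_fun UNIV" if "b \<in> Basis" for b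
        using test_fun_affine(1)[OF tb[OF that], where r = 1 and z = "- (s *\<^sub>R h)"] by simp
      have "(\<integral>x. w x * ?\<Psi> (x - s *\<^sub>R h) \<partial>lborel)
          = (\<integral>x. (\<Sum>b\<in>Basis. (h \<bullet> b) * (w x * partial_deriv b \<phi> (x - s *\<^sub>R h))) \<partial>lborel)"
        by (simp add: sum_distrib_left algebra_simps)
      also have "\<dots> = (\<Sum>b\<in>Basis. (h \<bullet> b) * (\<integral>x. w x * partial_deriv b ?\<phi> x \<partial>lborel))"
        using integrable_mult_test_fun[OF w t'] by (subst Bochner_Integration.integral_sum) (auto simp: t(2)[simplified])
      also have "\<dots> = (\<Sum>b\<in>Basis. (h \<bullet> b) * (- (\<integral>x. v b x * ?\<phi> x \<partial>lborel)))"
        using wp t(1) by (intro sum.cong refl) (simp add: weak_partial_def)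
      also have "\<dots> = - (\<Sum>b\<in>Basis. (h \<bullet> b) * (\<integral>x. v b x * ?\<phi> x \<partial>lborel))"
        by (simp add: sum_negf)
      also have "(\<Sum>b\<in>Basis. (h \<bullet> b) * (\<integral>x. v b x * ?\<phi> x \<partial>lborel)) = (\<integral>x. (\<Sum>b\<in>Basis. (h \<bullet> b) * (v b x * ?\<phi> x)) \<partial>lborel)"
        using integrable_mult_test_fun[OF v t(1)] by (subst Bochner_Integration.integral_sum) auto
      also have "\<dots> = (\<integral>x. V x * \<phi> (x - s *\<^sub>R h) \<partial>lborel)"
        by (simp add: V_def sum_distrib_right mult.assoc)
      also have "\<dots> = (\<integral>x. V (x + s *\<^sub>R h) * \<phi> x \<partial>lborel)"
        using integral_translate[of "\<lambda>x. V x * \<phi> (x - s *\<^sub>R h)" "s *\<^sub>R h"] by simp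
      finally show ?thesis .
    qed
    have "(\<integral>x. diff_op h w x * \<phi> x \<partial>lborel) = (\<integral>x. w (x + h) * \<phi> x \<partial>lborel) - (\<integral>x. w x * \<phi> x \<partial>lborel)"
      using integrable_mult_test_fun[OF _ \<phi>, of w] integrable_mult_test_fun[OF _ \<phi>, of "\<lambda>x. w (x + h)"] w
      by (simp add: diff_op_def left_diff_distrib integrable_translate_iff)
    also have "(\<integral>x. w (x + h) * \<phi> x \<partial>lborel) = (\<integral>x. w x * \<phi> (x - h) \<partial>lborel)"
      using integral_translate[of "\<lambda>x. w x * \<phi> (x - h)" h] by simp
    also have "(\<integral>x. w x * \<phi> (x - h) \<partial>lborel) - (\<integral>x. w x * \<phi> x \<partial>lborel) = (\<integral>x. w x * (\<phi> (x - h) - \<phi> x) \<partial>lborel)"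
      using integrable_mult_test_fun[OF w \<phi>] integrable_mult_test_fun[OF w test_fun_affine(1)[OF \<phi>, where r = 1 and z = "- h"]]
      by (simp add: right_diff_distrib)
    also have "\<dots> = - (\<integral>x. (\<integral>s. w (x + 0) * ?i s * ?\<Psi> (x - s *\<^sub>R h) \<partial>lborel) \<partial>lborel)"
      unfolding line by (simp add: mult.assoc mult.commute[of "?i _"])
    also have "\<dots> = - (\<integral>s. (\<integral>x. w (x + 0) * ?i s * ?\<Psi> (x - s *\<^sub>R h) \<partial>lborel) \<partial>lborel)"
      by (subst integral_swap_translate_kernel[OF w i, where B = B' and \<tau> = "\<lambda>_. 0"]) (auto intro: B')
    also have "\<dots> = (\<integral>s. ?i s * (- (\<integral>x. w x * ?\<Psi> (x - s *\<^sub>R h) \<partial>lborel)) \<partial>lborel)"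
      by (simp add: mult.assoc mult.left_commute[of _ "?i _"])
    also have "\<dots> = (\<integral>s. (\<integral>x. V (x + s *\<^sub>R h) * ?i s * \<phi> x \<partial>lborel) \<partial>lborel)"
      unfolding weak by (simp add: mult.assoc mult.left_commute[of _ "?i _"])
    also have "\<dots> = (\<integral>x. (\<integral>s. V (x + s *\<^sub>R h) * ?i s * \<phi> x \<partial>lborel) \<partial>lborel)"
      by (subst integral_swap_translate_kernel[OF V i, where B = B]) (auto intro: B)
    also have "\<dots> = (\<integral>x. ?W x * \<phi> x \<partial>lborel)" by simp
    finally have "(\<integral>x. (diff_op h w x - ?W x) * \<phi> x \<partial>lborel) = 0"
      using integrable_mult_test_fun[OF W \<phi>] integrable_mult_test_fun[OF dw \<phi>] by (simp add: left_diff_distrib)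
    moreover have "(\<lambda>x. (diff_op h w x - ?W x) * \<phi> x) \<in> borel_measurable borel"
      using W dw by auto
    ultimately show "(\<integral>x. (diff_op h w x - ?W x) * \<phi> x \<partial>lebesgue) = 0"
      by (simp add: integral_completion)
  qed simp
  then show ?thesis by simp
qed

lemma L1_norm_diff_op_le:
  fixes w :: "'a::euclidean_space \<Rightarrow> real" and v :: "'a \<Rightarrow> 'a \<Rightarrow> real" and h :: 'a
  assumes w: "integrable lborel w" and v: "\<And>b. b \<in> Basis \<Longrightarrow> integrable lborel (v b)"
    and wp: "\<And>b. b \<in> Basis \<Longrightarrow> weak_partial UNIV b w (v b)"
  shows "L1_norm (diff_op h w) \<le> ennreal (norm h) * (\<Sum>b\<in>Basis. L1_norm (v b))"
proof -
  define V where "V x = (\<Sum>b\<in>Basis. (h \<bullet> b) * v b x)" for x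
  have mv: "v b \<in> borel_measurable borel" if "b \<in> Basis" for b using v[OF that] by auto
  have mV [measurable]: "V \<in> borel_measurable borel"
    unfolding V_def[abs_def] using mv by (intro borel_measurable_sum borel_measurable_times) auto
  have "L1_norm (diff_op h w) = L1_norm (\<lambda>x. \<integral>s. V (x + s *\<^sub>R h) * indicator {0..1} s \<partial>lborel)"
    unfolding V_def by (rule L1_norm_cong_AE[OF diff_op_eq_integral_weak_gradient[OF w v wp]])
  also have "\<dots> \<le> (\<integral>\<^sup>+s. L1_norm (\<lambda>x. V (x + s *\<^sub>R h) * indicator {0..1} s) \<partial>lborel)"
    by (rule L1_norm_Minkowski) measurable
  also have "\<dots> = (\<integral>\<^sup>+s. L1_norm V * indicator {0..1::real} s \<partial>lborel)"
  proof (intro nn_integral_cong)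
    fix s :: real
    show "L1_norm (\<lambda>x. V (x + s *\<^sub>R h) * indicator {0..1} s) = L1_norm V * indicator {0..1::real} s"
      using L1_norm_translate[OF mV, of "s *\<^sub>R h"] by (cases "s \<in> {0..1}") auto
  qed
  also have "\<dots> = L1_norm V" by (simp add: nn_integral_cmult_indicator)
  also have "\<dots> \<le> (\<Sum>b\<in>Basis. L1_norm (\<lambda>x. (h \<bullet> b) * v b x))"
    unfolding V_def[abs_def] using mv by (intro L1_norm_sum) auto
  also have "\<dots> = (\<Sum>b\<in>Basis. ennreal \<bar>h \<bullet> b\<bar> * L1_norm (v b))"
    using mv by (intro sum.cong refl L1_norm_cmult)
  also have "\<dots> \<le> (\<Sum>b\<in>Basis. ennreal (norm h) * L1_norm (v b))"
    by (intro sum_mono mult_right_mono ennreal_leI) (auto simp: Basis_le_norm)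
  finally show ?thesis by (simp add: sum_distrib_left)
qed

lemma sum_lists_length_Suc:
  fixes F :: "'a list \<Rightarrow> 'b::comm_monoid_add"
  assumes "finite A"
  shows "(\<Sum>bs | set bs \<subseteq> A \<and> length bs = Suc j. F bs)
      = (\<Sum>b\<in>A. \<Sum>bs | set bs \<subseteq> A \<and> length bs = j. F (b # bs))"
proof -
  let ?L = "{bs. set bs \<subseteq> A \<and> length bs = j}"
  have e: "{bs. set bs \<subseteq> A \<and> length bs = Suc j} = (\<lambda>(b, bs). b # bs) ` (A \<times> ?L)"
    by (force simp: length_Suc_conv image_iff)
  show ?thesis
    unfolding e sum.cartesian_product by (subst sum.reindex) (auto simp: inj_on_def case_prod_beta')
qed

text \<open>Each of j differences is traded for one derivative and one factor of the step length,
  while p differences remain. With p = 2 the remainder is what a Besov seminorm of order at most 1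
  controls for the top derivatives.\<close>

lemma L1_norm_diff_op_power_le:
  fixes v :: "'a::euclidean_space multiset \<Rightarrow> 'a \<Rightarrow> real"
  assumes v: "\<And>\<alpha>. size \<alpha> \<le> l \<Longrightarrow> integrable lborel (v \<alpha>)"
    and wp: "\<And>\<alpha> b. b \<in> Basis \<Longrightarrow> size \<alpha> < l \<Longrightarrow> weak_partial UNIV b (v \<alpha>) (v (add_mset b \<alpha>))"
    and "size \<alpha> + j \<le> l"
  shows "L1_norm ((diff_op h ^^ (j + p)) (v \<alpha>)) \<le> ennreal (norm h ^ j) *
    (\<Sum>bs | set bs \<subseteq> Basis \<and> length bs = j. L1_norm ((diff_op h ^^ p) (v (mset bs + \<alpha>))))"
  using \<open>size \<alpha> + j \<le> l\<close>
proof (induction j arbitrary: \<alpha>)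
  case 0
  have *: "{bs. set bs \<subseteq> (Basis :: 'a set) \<and> length bs = 0} = {[]}" by auto
  show ?case unfolding * by simp
next
  case (Suc j)
  let ?F = "\<lambda>\<alpha>. L1_norm ((diff_op h ^^ p) (v \<alpha>))"
  have "L1_norm ((diff_op h ^^ (Suc j + p)) (v \<alpha>)) = L1_norm (diff_op h ((diff_op h ^^ (j + p)) (v \<alpha>)))"
    by simp
  also have "\<dots> \<le> ennreal (norm h) * (\<Sum>b\<in>Basis. L1_norm ((diff_op h ^^ (j + p)) (v (add_mset b \<alpha>))))"
    using Suc.prems by (intro L1_norm_diff_op_le diff_op_power_integrable diff_op_power_weak_partial v wp) auto
  also have "\<dots> \<le> ennreal (norm h) * (\<Sum>b\<in>Basis. ennreal (norm h ^ j) *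
      (\<Sum>bs | set bs \<subseteq> Basis \<and> length bs = j. ?F (mset bs + add_mset b \<alpha>)))"
    using Suc.prems by (intro mult_left_mono sum_mono Suc.IH) auto
  also have "\<dots> = ennreal (norm h ^ Suc j) * (\<Sum>b\<in>Basis.
      (\<Sum>bs | set bs \<subseteq> Basis \<and> length bs = j. ?F (mset (b # bs) + \<alpha>)))"
    by (simp add: sum_distrib_left[symmetric] ennreal_mult mult.assoc)
  also have "\<dots> = ennreal (norm h ^ Suc j) *
      (\<Sum>bs | set bs \<subseteq> Basis \<and> length bs = Suc j. ?F (mset bs + \<alpha>))"
    by (subst sum_lists_length_Suc) auto
  finally show ?case .
qed

section \<open>Averaging kernels\<close>

text \<open>Boundedness makes the integrand of \<open>average\<close> integrable at every x and not
  just at almost every x, so identities such as the telescoping of averages hold pointwise.\<close>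

definition bounded_kernel :: "('a::euclidean_space \<Rightarrow> real) \<Rightarrow> bool" where
  "bounded_kernel \<kappa> \<longleftrightarrow> integrable lborel \<kappa> \<and> (\<exists>B. \<forall>y. \<bar>\<kappa> y\<bar> \<le> B)"

text \<open>A correlation, with x + r y in place of x - r y, so that the error
  \<open>u - average r \<kappa> u\<close> is expressed by forward differences. The price is the sign
  in \<open>average_weak_partial\<close>.\<close>

definition average :: "real \<Rightarrow> ('a::euclidean_space \<Rightarrow> real) \<Rightarrow> ('a \<Rightarrow> real) \<Rightarrow> 'a \<Rightarrow> real" where
  "average r \<kappa> u x = (\<integral>y. u (x + r *\<^sub>R y) * \<kappa> y \<partial>lborel)"

lemma bounded_kernel_measurable: "bounded_kernel \<kappa> \<Longrightarrow> \<kappa> \<in> borel_measurable borel"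
  by (auto simp: bounded_kernel_def)

lemma bounded_kernel_cmult: "bounded_kernel \<kappa> \<Longrightarrow> bounded_kernel (\<lambda>y. c * \<kappa> y)"
proof -
  assume k: "bounded_kernel \<kappa>"
  then obtain B where "\<And>y. \<bar>\<kappa> y\<bar> \<le> B" by (auto simp: bounded_kernel_def)
  then have "\<bar>c * \<kappa> y\<bar> \<le> \<bar>c\<bar> * B" for y by (simp add: abs_mult mult_left_mono)
  with k show ?thesis by (auto simp: bounded_kernel_def)
qed

lemma bounded_kernel_sum:
  assumes "\<And>i. i \<in> I \<Longrightarrow> bounded_kernel (\<kappa> i)"
  shows "bounded_kernel (\<lambda>y. \<Sum>i\<in>I. \<kappa> i y)"
proof -
  have "\<forall>i\<in>I. \<exists>B. \<forall>y. \<bar>\<kappa> i y\<bar> \<le> B" using assms by (auto simp: bounded_kernel_def)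
  then obtain B where "\<And>i y. i \<in> I \<Longrightarrow> \<bar>\<kappa> i y\<bar> \<le> B i" by metis
  then have "\<bar>\<Sum>i\<in>I. \<kappa> i y\<bar> \<le> (\<Sum>i\<in>I. B i)" for y
    by (intro order_trans[OF sum_abs] sum_mono)
  with assms show ?thesis by (auto simp: bounded_kernel_def)
qed

lemma bounded_kernel_dilate:
  assumes k: "bounded_kernel \<kappa>" and c: "0 < c"
  shows "bounded_kernel (\<lambda>y. \<kappa> (c *\<^sub>R y))"
  using k c bounded_kernel_measurable[OF k] by (auto simp: bounded_kernel_def integrable_dilate_iff)

lemma bounded_kernel_continuous:
  assumes c: "continuous_on UNIV \<kappa>" and van: "\<And>x. x \<notin> cbox p q \<Longrightarrow> \<kappa> x = 0"
  shows "bounded_kernel \<kappa>"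
proof -
  have "compact (\<kappa> ` cbox p q)"
    using continuous_on_subset[OF c, of "cbox p q"] by (intro compact_continuous_image) auto
  then obtain B where B: "0 < B" "\<And>x. x \<in> cbox p q \<Longrightarrow> \<bar>\<kappa> x\<bar> \<le> B"
    using bounded_pos[of "\<kappa> ` cbox p q"] compact_imp_bounded by auto
  have bd: "\<bar>\<kappa> x\<bar> \<le> B" for x
    using B van[of x] by (cases "x \<in> cbox p q") auto
  have "integrable lborel (\<lambda>x. indicator (cbox p q) x * \<kappa> x)"
    by (rule integrable_bounded_mult[OF _ _ bd])
      (use c in \<open>auto simp: borel_measurable_continuous_onI emeasure_lborel_cbox_eq\<close>)
  moreover have "indicator (cbox p q) x * \<kappa> x = \<kappa> x" for x
    using van[of x] by (cases "x \<in> cbox p q") auto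
  ultimately show ?thesis using bd by (auto simp: bounded_kernel_def)
qed

context
  fixes r :: real and \<kappa> u :: "'a::euclidean_space \<Rightarrow> real"
  assumes r: "0 < r" and k: "bounded_kernel \<kappa>" and u: "integrable lborel u"
begin

lemma [measurable]: "\<kappa> \<in> borel_measurable borel" "u \<in> borel_measurable borel"
  using k u by (auto simp: bounded_kernel_def)

lemma average_integrand_integrable: "integrable lborel (\<lambda>y. u (x + r *\<^sub>R y) * \<kappa> y)"
proof -
  obtain B where "\<And>y. \<bar>\<kappa> y\<bar> \<le> B" using k by (auto simp: bounded_kernel_def)
  moreover have "integrable lborel (\<lambda>y. u (x + r *\<^sub>R y))"
    using integrable_dilate_iff[of "\<lambda>y. u (y + x)" r] r u
    by (simp add: integrable_translate_iff add.commute)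
  ultimately show ?thesis by (intro integrable_bounded_mult[where B = B]) auto
qed

lemma average_integrable: "integrable lborel (average r \<kappa> u)"
proof -
  have "integrable (lborel \<Otimes>\<^sub>M lborel) (\<lambda>(y, x). u (x + r *\<^sub>R y) * \<kappa> y * 1)"
    by (rule integrable_translate_kernel[OF u, of _ _ _ 1]) (use k in \<open>auto simp: bounded_kernel_def\<close>)
  from lborel_pair.integrable_snd[OF this] show ?thesis by (simp add: average_def[abs_def])
qed

lemma average_measurable: "average r \<kappa> u \<in> borel_measurable borel"
  using average_integrable by auto

lemma L1_norm_average_le: "L1_norm (average r \<kappa> u) \<le> L1_norm \<kappa> * L1_norm u"
proof -
  have "L1_norm (average r \<kappa> u) \<le> (\<integral>\<^sup>+y. L1_norm (\<lambda>x. u (x + r *\<^sub>R y) * \<kappa> y) \<partial>lborel)"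
    unfolding average_def[abs_def] by (rule L1_norm_Minkowski) measurable
  also have "\<dots> = (\<integral>\<^sup>+y. ennreal \<bar>\<kappa> y\<bar> * L1_norm u \<partial>lborel)"
  proof (intro nn_integral_cong)
    fix y
    show "L1_norm (\<lambda>x. u (x + r *\<^sub>R y) * \<kappa> y) = ennreal \<bar>\<kappa> y\<bar> * L1_norm u"
      using L1_norm_cmult[of "\<lambda>x. u (x + r *\<^sub>R y)" "\<kappa> y"] L1_norm_translate[of u "r *\<^sub>R y"]
      by (simp add: mult.commute)
  qed
  also have "\<dots> = L1_norm \<kappa> * L1_norm u"
    unfolding L1_norm_lborel[of \<kappa>] by (rule nn_integral_multc) simp
  finally show ?thesis .
qed

lemma average_dual:
  assumes [measurable]: "\<psi> \<in> borel_measurable borel" and B: "\<And>x. \<bar>\<psi> x\<bar> \<le> B"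
  shows "(\<integral>x. average r \<kappa> u x * \<psi> x \<partial>lborel) = (\<integral>x. u x * (\<integral>y. \<kappa> y * \<psi> (x - r *\<^sub>R y) \<partial>lborel) \<partial>lborel)"
proof -
  have ki: "integrable lborel \<kappa>" using k by (simp add: bounded_kernel_def)
  have "(\<integral>x. average r \<kappa> u x * \<psi> x \<partial>lborel) = (\<integral>x. (\<integral>y. u (x + r *\<^sub>R y) * \<kappa> y * \<psi> x \<partial>lborel) \<partial>lborel)"
    by (simp add: average_def)
  also have "\<dots> = (\<integral>y. (\<integral>x. u (x + r *\<^sub>R y) * \<kappa> y * \<psi> x \<partial>lborel) \<partial>lborel)"
    by (rule integral_swap_translate_kernel[OF u ki, where B = B]) (auto intro: B)
  also have "\<dots> = (\<integral>y. (\<integral>x. u (x + 0) * \<kappa> y * \<psi> (x - r *\<^sub>R y) \<partial>lborel) \<partial>lborel)"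
  proof (rule Bochner_Integration.integral_cong[OF refl])
    fix y show "(\<integral>x. u (x + r *\<^sub>R y) * \<kappa> y * \<psi> x \<partial>lborel) = (\<integral>x. u (x + 0) * \<kappa> y * \<psi> (x - r *\<^sub>R y) \<partial>lborel)"
      using integral_translate[of "\<lambda>x. u x * \<kappa> y * \<psi> (x - r *\<^sub>R y)" "r *\<^sub>R y"] by simp
  qed
  also have "\<dots> = (\<integral>x. (\<integral>y. u (x + 0) * \<kappa> y * \<psi> (x - r *\<^sub>R y) \<partial>lborel) \<partial>lborel)"
    by (rule integral_swap_translate_kernel[OF u ki, where B = B, symmetric]) (auto intro: B)
  also have "\<dots> = (\<integral>x. u x * (\<integral>y. \<kappa> y * \<psi> (x - r *\<^sub>R y) \<partial>lborel) \<partial>lborel)"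
    by (simp add: mult.assoc)
  finally show ?thesis .
qed

end

lemma average_diff:
  assumes "0 < r" "bounded_kernel \<kappa>" "integrable lborel u" "integrable lborel v"
  shows "average r \<kappa> (\<lambda>x. u x - v x) x = average r \<kappa> u x - average r \<kappa> v x"
  using average_integrand_integrable[OF assms(1,2)] assms by (simp add: average_def left_diff_distrib)

lemma average_commute:
  fixes u :: "'a::euclidean_space \<Rightarrow> real"
  assumes r: "0 < r" and k: "bounded_kernel \<kappa>" and \<rho>: "0 < \<rho>" and l: "bounded_kernel \<nu>"
    and u: "integrable lborel u"
  shows "average r \<kappa> (average \<rho> \<nu> u) = average \<rho> \<nu> (average r \<kappa> u)"
proof
  fix x
  have [measurable]: "\<kappa> \<in> borel_measurable borel" "\<nu> \<in> borel_measurable borel" "u \<in> borel_measurable borel"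
    using k l u by (auto simp: bounded_kernel_def)
  have ki: "integrable lborel \<kappa>" using k by (simp add: bounded_kernel_def)
  obtain B where B: "\<And>y. \<bar>\<nu> y\<bar> \<le> B" using l by (auto simp: bounded_kernel_def)
  let ?u = "\<lambda>z. u (x + \<rho> *\<^sub>R z)"
  have ui: "integrable lborel ?u"
    using integrable_dilate_iff[of "\<lambda>y. u (y + x)" \<rho>] \<rho> u
    by (simp add: integrable_translate_iff add.commute)
  \<comment> \<open>The exchange lemma wants an undilated inner variable. Absorbing the dilation by
    \<rho> into the function leaves a shift by (r / \<rho>) y.\<close>
  have e: "?u (z + (r / \<rho>) *\<^sub>R y) = u (x + r *\<^sub>R y + \<rho> *\<^sub>R z)" for y z
    using \<rho> by (simp add: algebra_simps)
  have "average r \<kappa> (average \<rho> \<nu> u) x = (\<integral>y. (\<integral>z. ?u (z + (r / \<rho>) *\<^sub>R y) * \<kappa> y * \<nu> z \<partial>lborel) \<partial>lborel)"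
    unfolding e average_def by (simp add: mult.assoc mult.left_commute[of _ "\<kappa> _"] mult.commute[of _ "\<kappa> _"])
  also have "\<dots> = (\<integral>z. (\<integral>y. ?u (z + (r / \<rho>) *\<^sub>R y) * \<kappa> y * \<nu> z \<partial>lborel) \<partial>lborel)"
    by (rule integral_swap_translate_kernel[OF ui ki, where B = B, symmetric]) (auto intro: B)
  also have "\<dots> = average \<rho> \<nu> (average r \<kappa> u) x"
    unfolding e average_def by (simp add: add.assoc add.commute[of "r *\<^sub>R _"])
  finally show "average r \<kappa> (average \<rho> \<nu> u) x = average \<rho> \<nu> (average r \<kappa> u) x" .
qed

text \<open>After the substitution z = x + r y the variable x occurs only in the kernel, as \<kappa>
  ((z - x) / r), and differentiating it there gives -1 / r. This is how a merely integrable u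
  acquires derivatives.\<close>

lemma average_weak_partial:
  fixes u :: "'a::euclidean_space \<Rightarrow> real"
  assumes r: "0 < r" and k: "bounded_kernel \<kappa>" and k': "bounded_kernel \<kappa>'" and u: "integrable lborel u"
    and w: "weak_partial UNIV b \<kappa> \<kappa>'" and b: "b \<in> Basis"
  shows "weak_partial UNIV b (average r \<kappa> u) (\<lambda>x. (- 1 / r) * average r \<kappa>' u x)"
  unfolding weak_partial_def
proof
  fix \<phi> :: "'a \<Rightarrow> real" assume \<phi>: "\<phi> \<in> test_fun UNIV"
  have \<phi>b: "partial_deriv b \<phi> \<in> test_fun UNIV" using \<phi> b by (rule test_fun_partial_deriv)
  obtain B where B: "\<And>x. \<bar>\<phi> x\<bar> \<le> B" using test_fun_bounded[OF \<phi>] by auto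
  obtain B' where B': "\<And>x. \<bar>partial_deriv b \<phi> x\<bar> \<le> B'" using test_fun_bounded[OF \<phi>b] by auto
  have inner: "(\<integral>y. \<kappa> y * partial_deriv b \<phi> (x - r *\<^sub>R y) \<partial>lborel) = (1 / r) * (\<integral>y. \<kappa>' y * \<phi> (x - r *\<^sub>R y) \<partial>lborel)" for x
  proof -
    let ?\<phi> = "\<lambda>y. \<phi> (x + (- r) *\<^sub>R y)"
    have t: "?\<phi> \<in> test_fun UNIV" "\<And>y. partial_deriv b ?\<phi> y = (- r) * partial_deriv b \<phi> (x + (- r) *\<^sub>R y)"
      using test_fun_affine(1)[OF \<phi>, of "- r"] test_fun_affine(2)[OF \<phi> _ b, of "- r"] r by auto
    have "(\<integral>y. \<kappa> y * partial_deriv b ?\<phi> y \<partial>lborel) = - (\<integral>y. \<kappa>' y * ?\<phi> y \<partial>lborel)"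
      using w t(1) unfolding weak_partial_def by blast
    moreover have "(\<integral>y. \<kappa> y * partial_deriv b ?\<phi> y \<partial>lborel)
        = (- r) * (\<integral>y. \<kappa> y * partial_deriv b \<phi> (x - r *\<^sub>R y) \<partial>lborel)"
      unfolding t(2) by (simp add: mult.left_commute[of _ r])
    ultimately show ?thesis using r by (simp add: field_simps)
  qed
  have "(\<integral>x. average r \<kappa> u x * partial_deriv b \<phi> x \<partial>lborel)
      = (\<integral>x. u x * ((1 / r) * (\<integral>y. \<kappa>' y * \<phi> (x - r *\<^sub>R y) \<partial>lborel)) \<partial>lborel)"
    unfolding inner[symmetric] by (rule average_dual[OF r k u _ B']) (use test_fun_borel[OF \<phi>b] in simp)
  also have "\<dots> = (1 / r) * (\<integral>x. average r \<kappa>' u x * \<phi> x \<partial>lborel)"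
    unfolding average_dual[OF r k' u test_fun_borel[OF \<phi>] B] by (simp add: mult.left_commute[of _ "1 / r"])
  also have "\<dots> = - (\<integral>x. (- 1 / r) * average r \<kappa>' u x * \<phi> x \<partial>lborel)"
    by (simp add: mult.assoc)
  finally show "(\<integral>x. average r \<kappa> u x * partial_deriv b \<phi> x \<partial>lborel)
      = - (\<integral>x. (- 1 / r) * average r \<kappa>' u x * \<phi> x \<partial>lborel)" .
qed

text \<open>By the product rule the claim says that the directional derivative of g \<phi> has
  integral 0.\<close>

lemma weak_partial_classical:
  fixes g g' :: "'a::euclidean_space \<Rightarrow> real"
  assumes g: "integrable lborel g" and g': "integrable lborel g'"
    and D: "\<And>x s. ((\<lambda>s. g (x + s *\<^sub>R b)) has_real_derivative g' (x + s *\<^sub>R b)) (at s)"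
    and C: "continuous_on UNIV g'" and b: "b \<in> Basis"
  shows "weak_partial UNIV b g g'"
  unfolding weak_partial_def
proof
  fix \<phi> :: "'a \<Rightarrow> real" assume \<phi>: "\<phi> \<in> test_fun UNIV"
  have \<phi>b: "partial_deriv b \<phi> \<in> test_fun UNIV" using \<phi> b by (rule test_fun_partial_deriv)
  note i = integrable_mult_test_fun[OF g \<phi>] integrable_mult_test_fun[OF g' \<phi>] integrable_mult_test_fun[OF g \<phi>b]
  note D\<phi> = DERIV_line_Basis[OF smooth_fun_differentiable[OF test_fun_smooth[OF \<phi>]] b]
  have gc: "continuous_on UNIV (\<lambda>s. g (x + s *\<^sub>R b))" for x
    using D by (intro continuous_at_imp_continuous_on ballI) (rule DERIV_isCont)
  have "(\<integral>x. g' x * \<phi> x + g x * partial_deriv b \<phi> x \<partial>lborel) = 0"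
  proof (rule integral_directional_derivative_eq_0[where g = "\<lambda>x. g x * \<phi> x" and b = b])
    show "((\<lambda>s. g (x + s *\<^sub>R b) * \<phi> (x + s *\<^sub>R b)) has_real_derivative
      g' (x + s *\<^sub>R b) * \<phi> (x + s *\<^sub>R b) + g (x + s *\<^sub>R b) * partial_deriv b \<phi> (x + s *\<^sub>R b)) (at s)" for x s
      using DERIV_mult[OF D[of x s] D\<phi>[where x = x and s = s and A = UNIV]] by (simp add: mult.commute add.commute)
    show "continuous_on UNIV (\<lambda>s. g' (x + s *\<^sub>R b) * \<phi> (x + s *\<^sub>R b) + g (x + s *\<^sub>R b) * partial_deriv b \<phi> (x + s *\<^sub>R b))" for x
      by (intro continuous_on_add continuous_on_mult gc
          continuous_on_compose2[OF C] continuous_on_compose2[OF test_fun_continuous[OF \<phi>]]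
          continuous_on_compose2[OF test_fun_continuous[OF \<phi>b]]) (auto intro!: continuous_intros)
  qed (use i in auto)
  then show "(\<integral>x. g x * partial_deriv b \<phi> x \<partial>lborel) = - (\<integral>x. g' x * \<phi> x \<partial>lborel)"
    using i by simp
qed

text \<open>The kernel combines the dilations of one bump by \<open>1, ..., M\<close> with the coefficients of the
  \<open>M\<close>-th difference, so that the averaging error is an average of \<open>M\<close>-th differences.\<close>

lemma difference_kernel:
  assumes "1 \<le> M"
  obtains \<Psi> :: "'a::euclidean_space multiset \<Rightarrow> 'a \<Rightarrow> real" and \<psi> :: "'a \<Rightarrow> real" and R :: real
  where "\<And>\<beta>. bounded_kernel (\<Psi> \<beta>)"
    "\<And>\<beta> b. b \<in> Basis \<Longrightarrow> weak_partial UNIV b (\<Psi> \<beta>) (\<Psi> (add_mset b \<beta>))"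
    "bounded_kernel \<psi>" "0 < R" "\<And>y. R < norm y \<Longrightarrow> \<psi> y = 0"
    "\<And>r u x. 0 < r \<Longrightarrow> integrable lborel u \<Longrightarrow>
      u x - average r (\<Psi> {#}) u x = (-1) ^ M * (\<integral>y. \<psi> y * (diff_op (r *\<^sub>R y) ^^ M) u x \<partial>lborel)"
proof (rule box_bump_sequence[of "- One :: 'a" One])
  fix \<Phi> :: "nat \<Rightarrow> 'a multiset \<Rightarrow> 'a \<Rightarrow> real"
  assume \<Phi>: "\<And>k \<beta>. continuous_on UNIV (\<Phi> k \<beta>)"
    "\<And>k \<beta> x. \<Phi> k \<beta> differentiable (at x)"
    "\<And>k \<beta> b. b \<in> Basis \<Longrightarrow> partial_deriv b (\<Phi> k \<beta>) = \<Phi> k (add_mset b \<beta>)"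
    "\<And>k \<beta> x. x \<notin> cbox (- One) One \<Longrightarrow> \<Phi> k \<beta> x = 0"
    "\<And>k x. 0 \<le> \<Phi> k {#} x" "\<And>k x. 0 < \<Phi> k {#} x \<longleftrightarrow> x \<in> box (- One) One"
  define c where "c = (\<integral>y. \<Phi> 0 {#} y \<partial>lborel)"
  define \<eta> where "\<eta> \<beta> y = \<Phi> 0 \<beta> y / c" for \<beta> y
  have bk\<Phi>: "bounded_kernel (\<Phi> 0 \<beta>)" for \<beta>
    using \<Phi>(1,4) by (rule bounded_kernel_continuous)
  have "c \<noteq> 0"
  proof
    assume "c = 0"
    then have "AE y in lborel. \<Phi> 0 {#} y = 0"
      using bk\<Phi>[of "{#}"] \<Phi>(5) by (subst integral_nonneg_eq_0_iff_AE[symmetric]) (auto simp: c_def bounded_kernel_def)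
    then have "AE y in lborel. y \<notin> box (- One) (One :: 'a)"
      by eventually_elim (simp add: \<Phi>(6)[of 0, symmetric])
    then have "emeasure lborel (box (- One) (One :: 'a)) = 0"
      by (subst (asm) AE_iff_measurable[OF _ refl]) auto
    moreover have "emeasure lborel (box (- One) (One :: 'a)) = ennreal (\<Prod>b\<in>Basis. (One - (- One :: 'a)) \<bullet> b)"
      by (rule emeasure_lborel_box) (simp add: inner_minus_left)
    moreover have "(\<Prod>b\<in>Basis. (One - (- One :: 'a)) \<bullet> b) = (\<Prod>b\<in>(Basis :: 'a set). 2)"
      by (intro prod.cong) (auto simp: inner_add_left)
    ultimately show False by simp
  qed
  have bk\<eta>: "bounded_kernel (\<eta> \<beta>)" for \<beta>
    using bounded_kernel_cmult[OF bk\<Phi>[of \<beta>], of "1 / c"] by (simp add: \<eta>_def[abs_def])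
  have one: "(\<integral>y. \<eta> {#} y \<partial>lborel) = 1"
    using \<open>c \<noteq> 0\<close> by (simp add: \<eta>_def c_def)
  \<comment> \<open>The coefficients of the M-th difference up to the common sign (-1) ^ (M + 1).
    Index 0 is left out of the kernel: \<open>co 0\<close> is -1 and \<eta> has integral 1, so that
    index accounts for u x itself.\<close>
  define co where "co k = (-1) ^ Suc k * real (M choose k)" for k
  \<comment> \<open>The power DIM('a) keeps the integral of the dilated bump, and each derivative
    contributes one more factor 1 / k by the chain rule.\<close>
  define \<Psi> where "\<Psi> \<beta> y = (\<Sum>k=1..M. (co k * (1 / real k) ^ (DIM('a) + size \<beta>)) * \<eta> \<beta> ((1 / real k) *\<^sub>R y))" for \<beta> y
  have bk\<Psi>: "bounded_kernel (\<Psi> \<beta>)" for \<beta>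
    unfolding \<Psi>_def[abs_def] by (intro bounded_kernel_sum bounded_kernel_cmult bounded_kernel_dilate bk\<eta>) simp
  have C\<eta>: "continuous_on UNIV (\<eta> \<beta>)" for \<beta>
    unfolding \<eta>_def[abs_def] by (intro continuous_intros \<Phi>(1)) (use \<open>c \<noteq> 0\<close> in simp)
  have C\<Psi>: "continuous_on UNIV (\<Psi> \<beta>)" for \<beta>
    unfolding \<Psi>_def[abs_def]
    by (intro continuous_intros continuous_on_compose2[OF C\<eta>]) auto
  have D\<Psi>: "((\<lambda>s. \<Psi> \<beta> (x + s *\<^sub>R b)) has_real_derivative \<Psi> (add_mset b \<beta>) (x + s *\<^sub>R b)) (at s)"
    if b: "b \<in> Basis" for \<beta> x s b
  proof -
    have *: "((\<lambda>s. \<eta> \<beta> ((1 / real k) *\<^sub>R (x + s *\<^sub>R b))) has_real_derivative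
        (1 / real k) * \<eta> (add_mset b \<beta>) ((1 / real k) *\<^sub>R (x + s *\<^sub>R b))) (at s)" if "1 \<le> k" for k
    proof -
      have "((\<lambda>s. \<Phi> 0 \<beta> ((1 / real k) *\<^sub>R x + (s * (1 / real k)) *\<^sub>R b)) has_real_derivative
        \<Phi> 0 (add_mset b \<beta>) ((1 / real k) *\<^sub>R x + (s * (1 / real k)) *\<^sub>R b) * (1 / real k)) (at s)"
      proof -
        have "((\<lambda>s. s * (1 / real k)) has_real_derivative 1 / real k) (at s)"
          using DERIV_cmult_right[OF DERIV_ident, of "1 / real k" s UNIV] by simp
        from DERIV_chain2[OF DERIV_line_Basis[OF \<Phi>(2) b, where A = UNIV] this] show ?thesis
          unfolding \<Phi>(3)[OF b] .
      qed
      from DERIV_cmult[OF this, of "1 / c"] show ?thesis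
        using that by (simp add: \<eta>_def scaleR_add_right mult.commute)
    qed
    have "((\<lambda>s. \<Psi> \<beta> (x + s *\<^sub>R b)) has_real_derivative
      (\<Sum>k=1..M. (co k * (1 / real k) ^ (DIM('a) + size \<beta>)) * ((1 / real k) * \<eta> (add_mset b \<beta>) ((1 / real k) *\<^sub>R (x + s *\<^sub>R b))))) (at s)"
      unfolding \<Psi>_def by (intro DERIV_sum DERIV_cmult *) simp
    then show ?thesis by (simp add: \<Psi>_def mult_ac)
  qed
  have wp: "weak_partial UNIV b (\<Psi> \<beta>) (\<Psi> (add_mset b \<beta>))" if "b \<in> Basis" for b \<beta>
    using bk\<Psi> by (intro weak_partial_classical D\<Psi> C\<Psi> that) (auto simp: bounded_kernel_def)
  obtain R where R: "0 < R" "\<And>y. y \<in> cbox (- One) (One :: 'a) \<Longrightarrow> norm y \<le> R"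
    using bounded_pos[of "cbox (- One) (One :: 'a)"] bounded_cbox by blast
  have van: "\<eta> {#} y = 0" if "R < norm y" for y
    using R(2)[of y] \<Phi>(4)[of y 0 "{#}"] that by (auto simp: \<eta>_def)
  have err: "u x - average r (\<Psi> {#}) u x = (-1) ^ M * (\<integral>y. \<eta> {#} y * (diff_op (r *\<^sub>R y) ^^ M) u x \<partial>lborel)"
    if r: "0 < r" and u: "integrable lborel u" for r u x
  proof -
    have [measurable]: "u \<in> borel_measurable borel" "\<eta> {#} \<in> borel_measurable borel"
      using u bounded_kernel_measurable[OF bk\<eta>] by auto
    let ?I = "\<lambda>k. \<integral>y. u (x + (r * real k) *\<^sub>R y) * \<eta> {#} y \<partial>lborel"
    have I: "integrable lborel (\<lambda>y. u (x + (r * real k) *\<^sub>R y) * \<eta> {#} y)" for k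
    proof (cases "k = 0")
      case True then show ?thesis using bk\<eta>[of "{#}"] by (simp add: bounded_kernel_def)
    next
      case False then show ?thesis using r by (intro average_integrand_integrable[OF _ bk\<eta> u]) simp
    qed
    have scale: "(\<integral>y. u (x + r *\<^sub>R y) * ((1 / real k) ^ DIM('a) * \<eta> {#} ((1 / real k) *\<^sub>R y)) \<partial>lborel) = ?I k"
      and scale_i: "integrable lborel (\<lambda>y. u (x + r *\<^sub>R y) * \<eta> {#} ((1 / real k) *\<^sub>R y))"
      if "1 \<le> k" for k
    proof -
      have "(\<integral>y. u (x + r *\<^sub>R y) * ((1 / real k) ^ DIM('a) * \<eta> {#} ((1 / real k) *\<^sub>R y)) \<partial>lborel)
        = real k ^ DIM('a) * (\<integral>y. u (x + r *\<^sub>R (real k *\<^sub>R y)) * ((1 / real k) ^ DIM('a) * \<eta> {#} ((1 / real k) *\<^sub>R (real k *\<^sub>R y))) \<partial>lborel)"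
        by (rule integral_dilate) (use that in auto)
      also have "(\<lambda>y. u (x + r *\<^sub>R (real k *\<^sub>R y)) * ((1 / real k) ^ DIM('a) * \<eta> {#} ((1 / real k) *\<^sub>R (real k *\<^sub>R y))))
          = (\<lambda>y. (1 / real k) ^ DIM('a) * (u (x + (r * real k) *\<^sub>R y) * \<eta> {#} y))"
        using that by (auto simp: fun_eq_iff)
      also have "real k ^ DIM('a) * (\<integral>y. (1 / real k) ^ DIM('a) * (u (x + (r * real k) *\<^sub>R y) * \<eta> {#} y) \<partial>lborel)
          = real k ^ DIM('a) * (1 / real k) ^ DIM('a) * ?I k"
        by (simp only: integral_mult_right_zero mult.assoc)
      also have "\<dots> = ?I k" using that by (simp add: power_one_over)
      finally show "(\<integral>y. u (x + r *\<^sub>R y) * ((1 / real k) ^ DIM('a) * \<eta> {#} ((1 / real k) *\<^sub>R y)) \<partial>lborel) = ?I k" .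
      show "integrable lborel (\<lambda>y. u (x + r *\<^sub>R y) * \<eta> {#} ((1 / real k) *\<^sub>R y))"
        using that by (intro average_integrand_integrable[OF r bounded_kernel_dilate[OF bk\<eta>] u]) simp
    qed
    have "average r (\<Psi> {#}) u x = (\<integral>y. (\<Sum>k=1..M. co k * (u (x + r *\<^sub>R y) * ((1 / real k) ^ DIM('a) * \<eta> {#} ((1 / real k) *\<^sub>R y)))) \<partial>lborel)"
      by (simp add: average_def \<Psi>_def sum_distrib_left mult_ac)
    also have "\<dots> = (\<Sum>k=1..M. co k * ?I k)"
    proof (subst Bochner_Integration.integral_sum)
      fix k assume k: "k \<in> {1..M}"
      show "integrable lborel (\<lambda>y. co k * (u (x + r *\<^sub>R y) * ((1 / real k) ^ DIM('a) * \<eta> {#} ((1 / real k) *\<^sub>R y))))"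
      proof -
        have "integrable lborel (\<lambda>y. (co k * (1 / real k) ^ DIM('a)) * (u (x + r *\<^sub>R y) * \<eta> {#} ((1 / real k) *\<^sub>R y)))"
          using k by (intro integrable_mult_right scale_i) simp
        then show ?thesis by (simp only: mult_ac)
      qed
    qed (simp add: scale)
    finally have av: "average r (\<Psi> {#}) u x = (\<Sum>k=1..M. co k * ?I k)" .
    have "(\<integral>y. \<eta> {#} y * (diff_op (r *\<^sub>R y) ^^ M) u x \<partial>lborel)
        = (\<integral>y. (\<Sum>k\<le>M. (-1) ^ (M - k) * real (M choose k) * (u (x + (r * real k) *\<^sub>R y) * \<eta> {#} y)) \<partial>lborel)"
      by (simp add: diff_op_power sum_distrib_left mult_ac)
    also have "\<dots> = (\<Sum>k\<le>M. (-1) ^ (M - k) * real (M choose k) * ?I k)"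
      using I by (subst Bochner_Integration.integral_sum) auto
    also have "(-1) ^ M * \<dots> = (\<Sum>k\<le>M. - co k * ?I k)"
    proof -
      have "(-1) ^ M * ((-1) ^ (M - k) * real (M choose k) * z) = - co k * z" if "k \<le> M" for k z
      proof -
        have "(-1) ^ M * (-1) ^ (M - k) = ((-1) ^ k :: real)"
          using that by (auto simp: le_iff_add power_add mult.assoc)
        then show ?thesis by (simp add: co_def mult.assoc[symmetric])
      qed
      then show ?thesis by (simp add: sum_distrib_left)
    qed
    also have "\<dots> = u x - (\<Sum>k=1..M. co k * ?I k)"
    proof -
      have "{..M} = insert 0 {1..M}" by auto
      then show ?thesis by (simp add: co_def one sum_negf)
    qed
    finally show ?thesis unfolding av by simp
  qed
  show thesis
    by (rule that[of \<Psi> "\<eta> {#}" R]) (fact bk\<Psi> bk\<eta> wp R van err)+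
qed

lemma L1_norm_average_error_le:
  fixes u :: "'a::euclidean_space \<Rightarrow> real"
  assumes u: "integrable lborel u" and \<psi>: "bounded_kernel \<psi>"
    and err: "\<And>x. u x - average r \<kappa> u x = (-1) ^ M * (\<integral>y. \<psi> y * (diff_op (r *\<^sub>R y) ^^ M) u x \<partial>lborel)"
  shows "L1_norm (\<lambda>x. u x - average r \<kappa> u x) \<le> (\<integral>\<^sup>+y. ennreal \<bar>\<psi> y\<bar> * L1_norm ((diff_op (r *\<^sub>R y) ^^ M) u) \<partial>lborel)"
proof -
  have [measurable]: "u \<in> borel_measurable borel" "\<psi> \<in> borel_measurable borel"
    using u \<psi> by (auto simp: bounded_kernel_def)
  have "L1_norm (\<lambda>x. u x - average r \<kappa> u x) = L1_norm (\<lambda>x. \<integral>y. \<psi> y * (diff_op (r *\<^sub>R y) ^^ M) u x \<partial>lborel)"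
    unfolding err L1_norm_lborel by (simp add: abs_mult)
  also have "\<dots> \<le> (\<integral>\<^sup>+y. L1_norm (\<lambda>x. \<psi> y * (diff_op (r *\<^sub>R y) ^^ M) u x) \<partial>lborel)"
    by (rule L1_norm_Minkowski) measurable
  also have "\<dots> = (\<integral>\<^sup>+y. ennreal \<bar>\<psi> y\<bar> * L1_norm ((diff_op (r *\<^sub>R y) ^^ M) u) \<partial>lborel)"
    by (intro nn_integral_cong L1_norm_cmult) measurable
  finally show ?thesis .
qed

section \<open>Decomposition of Besov functions into smooth pieces\<close>

text \<open>The pieces \<open>g i\<close> live at scale \<open>r i\<close>; \<open>g i \<beta>\<close> is the derivative \<open>\<partial>\<^sup>\<beta>\<close> of \<open>g i {#}\<close>.\<close>

definition scale_decomposition ::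
    "nat \<Rightarrow> real \<Rightarrow> ('a::euclidean_space \<Rightarrow> real) \<Rightarrow> ennreal \<Rightarrow> bool" where
  "scale_decomposition k s f B \<longleftrightarrow> (\<exists>g r. (\<forall>i::nat. 0 < r i \<and> r i \<le> (1::real)) \<and> r \<longlonglongrightarrow> 0 \<and>
     (\<forall>i \<beta>. integrable lborel (g i \<beta>)) \<and>
     (\<forall>i \<beta>. \<forall>b\<in>Basis. weak_partial UNIV b (g i \<beta>) (g i (add_mset b \<beta>))) \<and>
     (\<lambda>N. L1_norm (\<lambda>x. f x - (\<Sum>i<N. g i {#} x))) \<longlonglongrightarrow> 0 \<and>
     (\<forall>\<beta>. set_mset \<beta> \<subseteq> Basis \<and> size \<beta> \<le> k \<longrightarrow>
        (\<Sum>i. ennreal (r i powr (real (size \<beta>) - s)) * L1_norm (g i \<beta>)) \<le> B))"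

section \<open>Series of extended reals and sums over dyadic balls\<close>

lemma suminf_ennreal_Suc: "(\<Sum>i. f i) = f 0 + (\<Sum>i. f (Suc i))" for f :: "nat \<Rightarrow> ennreal"
  using sums_Suc[OF summable_sums[OF summableI, of "\<lambda>i. f (Suc i)"]]
  by (simp add: sums_iff add.commute)

lemma ennreal_suminf_finite_tendsto_0:
  fixes A :: "nat \<Rightarrow> ennreal"
  assumes fin: "(\<Sum>i. A i) < \<infinity>"
  shows "A \<longlonglongrightarrow> 0"
proof -
  have "A i < \<infinity>" for i
    using sum_le_suminf[OF summableI, of "{i}" A] fin by (auto intro: le_less_trans)
  then have A: "A i = ennreal (enn2real (A i))" for i by (simp add: less_top)
  then have "(\<Sum>i. ennreal (enn2real (A i))) \<noteq> top" using fin by simp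
  then have "summable (\<lambda>i. enn2real (A i))" by (intro summable_suminf_not_top) auto
  then have "(\<lambda>i. enn2real (A i)) \<longlonglongrightarrow> 0" by (rule summable_LIMSEQ_zero)
  then have "(\<lambda>i. ennreal (enn2real (A i))) \<longlonglongrightarrow> ennreal 0" by (rule tendsto_ennrealI)
  then show ?thesis using A by simp
qed

text \<open>The terms counted are an initial segment of a growing geometric series, so their sum is
  at most q / (q - 1) times the last one, which is at most Z.\<close>

lemma geometric_truncated_sum:
  fixes q Z :: real
  assumes q: "1 < q" and Z: "0 \<le> Z"
  shows "(\<Sum>i<N. q ^ i * (if q ^ i \<le> Z then 1 else 0)) \<le> q / (q - 1) * Z"
proof -
  let ?S = "\<lambda>N. \<Sum>i<N. q ^ i * (if q ^ i \<le> Z then 1 else 0)"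
  \<comment> \<open>The second bound carries the induction: q ^ N / (q - 1) + q ^ N equals q / (q -
    1) * q ^ N.\<close>
  have "?S N \<le> q / (q - 1) * Z \<and> ?S N \<le> q ^ N / (q - 1)"
  proof (induction N)
    case 0 then show ?case using assms by simp
  next
    case (Suc N)
    show ?case
    proof (cases "q ^ N \<le> Z")
      case True
      then have "?S (Suc N) \<le> q ^ N / (q - 1) + q ^ N" using Suc.IH by simp
      also have e: "q ^ N / (q - 1) + q ^ N = q / (q - 1) * q ^ N" using q by (simp add: field_simps)
      finally have 1: "?S (Suc N) \<le> q / (q - 1) * q ^ N" .
      also have "\<dots> \<le> q / (q - 1) * Z" using q True by (intro mult_left_mono) auto
      finally show ?thesis using 1 by simp
    next
      case False
      have "q ^ N / (q - 1) \<le> q ^ Suc N / (q - 1)" using q by (intro divide_right_mono) auto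
      with False Suc.IH show ?thesis by simp
    qed
  qed
  then show ?thesis by blast
qed

lemma L1_norm_diff_op_borel [measurable]:
  fixes v :: "'a::euclidean_space \<Rightarrow> real"
  assumes [measurable]: "v \<in> borel_measurable borel"
  shows "(\<lambda>h. L1_norm ((diff_op h ^^ n) v)) \<in> borel_measurable borel"
  unfolding L1_norm_lborel by measurable

text \<open>After exchanging sum and integral, a point h counts at index i only while 2 ^ i is at
  most R / \<bar>h\<bar>. The truncated series with ratio 2 powr p is then a multiple of (R /
  \<bar>h\<bar>) powr p: the dyadic form of the Besov weight.\<close>

lemma dyadic_ball_sum_le:
  fixes D :: "'a::euclidean_space \<Rightarrow> ennreal" and p R :: real
  assumes [measurable]: "D \<in> borel_measurable borel" and D0: "D 0 = 0" and p: "0 < p" and R: "0 < R"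
  shows "(\<Sum>i. ennreal ((2 powr p) ^ i) * (\<integral>\<^sup>+h. indicator (cball 0 (R * (1/2) ^ i)) h * D h \<partial>lborel))
    \<le> ennreal (2 powr p / (2 powr p - 1) * R powr p) * (\<integral>\<^sup>+h. D h / ennreal (norm h powr p) \<partial>lborel)"
proof -
  let ?q = "2 powr p"
  let ?I = "\<lambda>i h. indicator (cball (0::'a) (R * (1/2) ^ i)) h :: real"
  have q: "1 < ?q" using p by simp
  have pt: "(\<Sum>i. ennreal (?q ^ i * ?I i h)) \<le> ennreal (?q / (?q - 1) * (R / norm h) powr p)"
    if h: "h \<noteq> 0" for h
  proof (intro suminf_le_const summableI)
    fix N
    have e: "?I i h = (if ?q ^ i \<le> (R / norm h) powr p then 1 else 0)" for i
    proof -
      have "?q ^ i = (2 ^ i) powr p" by (simp add: powr_power[symmetric] powr_powr powr_realpow[symmetric] mult.commute)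
      then have "?q ^ i \<le> (R / norm h) powr p \<longleftrightarrow> 2 ^ i \<le> R / norm h"
        using powr_less_mono2[OF p, of "R / norm h" "2 ^ i"] powr_mono2[of p "2 ^ i" "R / norm h"] p R
        by (cases "2 ^ i \<le> R / norm h") auto
      also have "\<dots> \<longleftrightarrow> norm h \<le> R * (1/2) ^ i"
        using h by (simp add: field_simps power_one_over)
      finally show ?thesis by (simp add: indicator_def)
    qed
    have "(\<Sum>i<N. ennreal (?q ^ i * ?I i h)) = ennreal (\<Sum>i<N. ?q ^ i * ?I i h)"
      by (intro sum_ennreal) auto
    also have "\<dots> \<le> ennreal (?q / (?q - 1) * (R / norm h) powr p)"
      unfolding e by (intro ennreal_leI geometric_truncated_sum q) auto
    finally show "(\<Sum>i<N. ennreal (?q ^ i * ?I i h)) \<le> ennreal (?q / (?q - 1) * (R / norm h) powr p)" .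
  qed
  have mI: "(\<lambda>h. indicator (cball 0 (R * (1/2) ^ i)) h * D h) \<in> borel_measurable lborel" for i
    by (intro borel_measurable_times_ennreal borel_measurable_indicator) auto
  have e1: "ennreal (?q ^ i) * (indicator (cball 0 (R * (1/2) ^ i)) h * D h) = ennreal (?q ^ i * ?I i h) * D h" for i h
    by (cases "h \<in> cball 0 (R * (1/2) ^ i)") auto
  have "(\<Sum>i. ennreal (?q ^ i) * (\<integral>\<^sup>+h. indicator (cball 0 (R * (1/2) ^ i)) h * D h \<partial>lborel))
      = (\<Sum>i. \<integral>\<^sup>+h. ennreal (?q ^ i) * (indicator (cball 0 (R * (1/2) ^ i)) h * D h) \<partial>lborel)"
    by (simp only: nn_integral_cmult[OF mI])
  also have "\<dots> = (\<integral>\<^sup>+h. (\<Sum>i. ennreal (?q ^ i) * (indicator (cball 0 (R * (1/2) ^ i)) h * D h)) \<partial>lborel)"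
    by (rule nn_integral_suminf[symmetric]) (intro borel_measurable_times_ennreal borel_measurable_const mI)
  also have "\<dots> = (\<integral>\<^sup>+h. (\<Sum>i. ennreal (?q ^ i * ?I i h)) * D h \<partial>lborel)"
    by (simp only: e1 ennreal_suminf_multc)
  also have "\<dots> \<le> (\<integral>\<^sup>+h. ennreal (?q / (?q - 1) * R powr p) * (D h / ennreal (norm h powr p)) \<partial>lborel)"
  proof (intro nn_integral_mono)
    fix h :: 'a
    show "(\<Sum>i. ennreal (?q ^ i * ?I i h)) * D h \<le> ennreal (?q / (?q - 1) * R powr p) * (D h / ennreal (norm h powr p))"
    proof (cases "h = 0")
      \<comment> \<open>The origin lies in every ball and the series of weights is infinite there;
        \<open>D 0 = 0\<close> makes the product 0.\<close>
      case True then show ?thesis using D0 by simp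
    next
      case False
      have "(\<Sum>i. ennreal (?q ^ i * ?I i h)) * D h \<le> ennreal (?q / (?q - 1) * (R / norm h) powr p) * D h"
        by (intro mult_right_mono pt False) simp
      also have "\<dots> = ennreal (?q / (?q - 1) * R powr p) * (D h / ennreal (norm h powr p))"
      proof -
        have "?q / (?q - 1) * (R / norm h) powr p = (?q / (?q - 1) * R powr p) * inverse (norm h powr p)"
          using R False by (simp add: powr_divide field_simps)
        then have "ennreal (?q / (?q - 1) * (R / norm h) powr p)
            = ennreal (?q / (?q - 1) * R powr p) * ennreal (inverse (norm h powr p))"
          using q by (simp only:) (rule ennreal_mult, auto)
        moreover have "ennreal (inverse (norm h powr p)) = inverse (ennreal (norm h powr p))"
          using False by (simp add: inverse_ennreal)
        ultimately show ?thesis by (simp add: divide_ennreal_def mult_ac)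
      qed
      finally show ?thesis .
    qed
  qed
  also have "\<dots> = ennreal (?q / (?q - 1) * R powr p) * (\<integral>\<^sup>+h. D h / ennreal (norm h powr p) \<partial>lborel)"
    by (rule nn_integral_cmult) measurable
  finally show ?thesis .
qed

lemma L1_norm_diff_op_0 [simp]: "L1_norm ((diff_op 0 ^^ Suc n) v) = 0"
proof -
  have "diff_op 0 w = (\<lambda>x. 0)" for w :: "'a \<Rightarrow> real" by (simp add: diff_op_def[abs_def])
  then show ?thesis by simp
qed

text \<open>No condition restricts the elements of \<alpha> to the basis, which keeps inductions
  over indices free of side conditions. Indices without meaning can be filled with 0.\<close>

definition derivative_family :: "nat \<Rightarrow> ('a::euclidean_space multiset \<Rightarrow> 'a \<Rightarrow> real) \<Rightarrow> bool" where
  "derivative_family l v \<longleftrightarrow> (\<forall>\<alpha>. size \<alpha> \<le> l \<longrightarrow> integrable lborel (v \<alpha>)) \<and>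
     (\<forall>\<alpha>. \<forall>b\<in>Basis. size \<alpha> < l \<longrightarrow> weak_partial UNIV b (v \<alpha>) (v (add_mset b \<alpha>)))"

text \<open>Second differences are used for every \<sigma>, also for \<sigma> < 1, so that one
  estimate includes \<sigma> = 1. The sum over lists matches the bound of
  \<open>L1_norm_diff_op_power_le\<close>.\<close>

definition second_difference_energy ::
    "nat \<Rightarrow> real \<Rightarrow> ('a::euclidean_space multiset \<Rightarrow> 'a \<Rightarrow> real) \<Rightarrow> ennreal" where
  "second_difference_energy l \<sigma> v = (\<Sum>bs | set bs \<subseteq> Basis \<and> length bs = l.
     \<integral>\<^sup>+h. L1_norm ((diff_op h ^^ 2) (v (mset bs))) / ennreal (norm h powr (real DIM('a) + \<sigma>)) \<partial>lborel)"

text \<open>The error at scale r averages differences of order l + 2 with steps r y. Trading l of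
  them for derivatives yields r ^ l, and the substitution h = r y yields r ^ -DIM('a) and a ball of
  radius R r. Together with the weight r powr -(l + \<sigma>) this leaves r powr -p for p = DIM('a)
  + \<sigma>, and \<open>dyadic_ball_sum_le\<close> restores the integral over h.\<close>

lemma averaging_error_sum_le:
  fixes \<psi> :: "'a::euclidean_space \<Rightarrow> real" and l :: nat and \<sigma> R :: real
  assumes \<psi>: "bounded_kernel \<psi>" and R: "0 < R" and van: "\<And>y. R < norm y \<Longrightarrow> \<psi> y = 0"
    and \<sigma>: "0 < \<sigma>"
    and err: "\<And>r u x. 0 < r \<Longrightarrow> integrable lborel u \<Longrightarrow>
      u x - average r \<kappa> u x = (-1) ^ (l + 2) * (\<integral>y. \<psi> y * (diff_op (r *\<^sub>R y) ^^ (l + 2)) u x \<partial>lborel)"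
  shows "\<exists>C>0. \<forall>v :: 'a multiset \<Rightarrow> 'a \<Rightarrow> real. derivative_family l v \<longrightarrow>
    (\<Sum>i. ennreal (((1/2) ^ i) powr - (real l + \<sigma>)) * L1_norm (\<lambda>x. v {#} x - average ((1/2) ^ i) \<kappa> (v {#}) x))
      \<le> ennreal C * second_difference_energy l \<sigma> v"
proof -
  obtain B where B: "\<And>y. \<bar>\<psi> y\<bar> \<le> B" using \<psi> by (auto simp: bounded_kernel_def)
  then have B0: "0 \<le> B" by (meson abs_ge_zero order_trans)
  define p where "p = real DIM('a) + \<sigma>"
  have p: "0 < p" using \<sigma> by (simp add: p_def)
  \<comment> \<open>\<open>B + 1\<close> keeps the constant positive even for B = 0. R ^ l comes
    from the lengths of the steps, and the last factor from
    \<open>dyadic_ball_sum_le\<close>.\<close>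
  define C where "C = (B + 1) * R ^ l * (2 powr p / (2 powr p - 1) * R powr p)"
  have "0 < C" using B0 R p by (auto simp: C_def intro!: mult_pos_pos divide_pos_pos)
  moreover have "(\<Sum>i. ennreal (((1/2) ^ i) powr - (real l + \<sigma>)) * L1_norm (\<lambda>x. v {#} x - average ((1/2) ^ i) \<kappa> (v {#}) x))
      \<le> ennreal C * second_difference_energy l \<sigma> v"
    if fam: "derivative_family l v" for v :: "'a multiset \<Rightarrow> 'a \<Rightarrow> real"
  proof -
    have v: "integrable lborel (v \<alpha>)" if "size \<alpha> \<le> l" for \<alpha>
      using fam that by (simp add: derivative_family_def)
    have wp: "weak_partial UNIV b (v \<alpha>) (v (add_mset b \<alpha>))" if "b \<in> Basis" "size \<alpha> < l" for \<alpha> b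
      using fam that by (simp add: derivative_family_def)
    let ?L = "{bs. set bs \<subseteq> (Basis :: 'a set) \<and> length bs = l}"
    let ?D = "\<lambda>bs h. L1_norm ((diff_op h ^^ 2) (v (mset bs)))"
    let ?J = "\<lambda>i bs. \<integral>\<^sup>+h. indicator (cball 0 (R * (1/2) ^ i)) h * ?D bs h \<partial>lborel"
    have finL: "finite ?L" by (rule finite_lists_length_eq) simp
    have mv: "v (mset bs) \<in> borel_measurable borel" if "bs \<in> ?L" for bs
      using v[of "mset bs"] that by auto
    have mD: "?D bs \<in> borel_measurable borel" if "bs \<in> ?L" for bs
      using mv[OF that] by measurable
    have term_le: "ennreal (((1/2) ^ i) powr - (real l + \<sigma>)) * L1_norm (\<lambda>x. v {#} x - average ((1/2) ^ i) \<kappa> (v {#}) x)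
      \<le> ennreal ((B + 1) * R ^ l) * (\<Sum>bs\<in>?L. ennreal ((2 powr p) ^ i) * ?J i bs)" for i
    proof -
      define r :: real where "r = (1/2) ^ i"
      have r: "0 < r" by (simp add: r_def)
      have "L1_norm (\<lambda>x. v {#} x - average r \<kappa> (v {#}) x)
        \<le> (\<integral>\<^sup>+y. ennreal \<bar>\<psi> y\<bar> * L1_norm ((diff_op (r *\<^sub>R y) ^^ (l + 2)) (v {#})) \<partial>lborel)"
        using v[of "{#}"] by (intro L1_norm_average_error_le[OF _ \<psi>] err r) auto
      also have "\<dots> \<le> (\<integral>\<^sup>+y. ennreal ((B + 1) * R ^ l * r ^ l) * (\<Sum>bs\<in>?L. indicator (cball 0 R) y * ?D bs (r *\<^sub>R y)) \<partial>lborel)"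
      proof (intro nn_integral_mono)
        fix y :: 'a
        show "ennreal \<bar>\<psi> y\<bar> * L1_norm ((diff_op (r *\<^sub>R y) ^^ (l + 2)) (v {#}))
          \<le> ennreal ((B + 1) * R ^ l * r ^ l) * (\<Sum>bs\<in>?L. indicator (cball 0 R) y * ?D bs (r *\<^sub>R y))"
        proof (cases "norm y \<le> R")
          case False then show ?thesis using van[of y] by simp
        next
          case True
          have "L1_norm ((diff_op (r *\<^sub>R y) ^^ (l + 2)) (v {#})) \<le> ennreal (norm (r *\<^sub>R y) ^ l) * (\<Sum>bs\<in>?L. ?D bs (r *\<^sub>R y))"
            using L1_norm_diff_op_power_le[where l = l and v = v and \<alpha> = "{#}" and j = l and h = "r *\<^sub>R y" and p = 2, OF v wp] by simp
          also have "\<dots> \<le> ennreal (R ^ l * r ^ l) * (\<Sum>bs\<in>?L. ?D bs (r *\<^sub>R y))"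
            using True r by (intro mult_right_mono ennreal_leI)
              (auto simp: power_mult_distrib mult.commute intro!: mult_left_mono power_mono)
          finally have "ennreal \<bar>\<psi> y\<bar> * L1_norm ((diff_op (r *\<^sub>R y) ^^ (l + 2)) (v {#}))
            \<le> ennreal (B + 1) * (ennreal (R ^ l * r ^ l) * (\<Sum>bs\<in>?L. ?D bs (r *\<^sub>R y)))"
            using B[of y] by (intro mult_mono ennreal_leI) auto
          then show ?thesis
            using True R r B0 by (simp add: ennreal_mult mult.assoc)
        qed
      qed
      also have "\<dots> = ennreal ((B + 1) * R ^ l * r ^ l) * (\<Sum>bs\<in>?L. \<integral>\<^sup>+y. indicator (cball 0 R) y * ?D bs (r *\<^sub>R y) \<partial>lborel)"
      proof -
        have m: "(\<lambda>y. indicator (cball 0 R) y * ?D bs (r *\<^sub>R y)) \<in> borel_measurable borel" if "bs \<in> ?L" for bs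
          using measurable_compose[OF _ mD[OF that], of "\<lambda>y. r *\<^sub>R y" borel]
          by (intro borel_measurable_times_ennreal borel_measurable_indicator) auto
        have "(\<integral>\<^sup>+y. (\<Sum>bs\<in>?L. indicator (cball 0 R) y * ?D bs (r *\<^sub>R y)) \<partial>lborel)
            = (\<Sum>bs\<in>?L. \<integral>\<^sup>+y. indicator (cball 0 R) y * ?D bs (r *\<^sub>R y) \<partial>lborel)"
          by (rule nn_integral_sum) (use m in simp)
        moreover have "(\<lambda>y. \<Sum>bs\<in>?L. indicator (cball 0 R) y * ?D bs (r *\<^sub>R y)) \<in> borel_measurable lborel"
          by (rule borel_measurable_sum) (use m in simp)
        ultimately show ?thesis by (simp only: nn_integral_cmult)
      qed
      also have "(\<Sum>bs\<in>?L. \<integral>\<^sup>+y. indicator (cball 0 R) y * ?D bs (r *\<^sub>R y) \<partial>lborel) = (\<Sum>bs\<in>?L. ennreal (1 / r ^ DIM('a)) * ?J i bs)"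
      proof (intro sum.cong refl)
        fix bs assume bs: "bs \<in> ?L"
        have [measurable]: "?D bs \<in> borel_measurable borel" by (rule mD[OF bs])
        have "?J i bs = ennreal (r ^ DIM('a)) * (\<integral>\<^sup>+y. indicator (cball 0 (R * (1/2) ^ i)) (r *\<^sub>R y) * ?D bs (r *\<^sub>R y) \<partial>lborel)"
          by (rule nn_integral_dilate[OF _ r])
            (intro borel_measurable_times_ennreal borel_measurable_indicator mD bs, auto)
        also have "(\<lambda>y::'a. indicator (cball 0 (R * (1/2) ^ i)) (r *\<^sub>R y) :: ennreal) = indicator (cball 0 R)"
          using r by (auto simp: fun_eq_iff indicator_def r_def[symmetric] mult.commute[of r])
        finally have "ennreal (1 / r ^ DIM('a)) * ?J i bs = (ennreal (1 / r ^ DIM('a)) * ennreal (r ^ DIM('a))) * (\<integral>\<^sup>+y. indicator (cball 0 R) y * ?D bs (r *\<^sub>R y) \<partial>lborel)"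
          by (simp add: mult.assoc)
        also have "ennreal (1 / r ^ DIM('a)) * ennreal (r ^ DIM('a)) = 1"
          using r by (simp add: ennreal_mult[symmetric] del: ennreal_mult)
        finally show "(\<integral>\<^sup>+y. indicator (cball 0 R) y * ?D bs (r *\<^sub>R y) \<partial>lborel) = ennreal (1 / r ^ DIM('a)) * ?J i bs" by simp
      qed
      finally have "ennreal (r powr - (real l + \<sigma>)) * L1_norm (\<lambda>x. v {#} x - average r \<kappa> (v {#}) x)
        \<le> ennreal (r powr - (real l + \<sigma>)) * (ennreal ((B + 1) * R ^ l * r ^ l) * (ennreal (1 / r ^ DIM('a)) * (\<Sum>bs\<in>?L. ?J i bs)))"
        by (intro mult_left_mono) (auto simp: sum_distrib_left)
      also have "\<dots> = (ennreal (r powr - (real l + \<sigma>)) * ennreal ((B + 1) * R ^ l * r ^ l) * ennreal (1 / r ^ DIM('a))) * (\<Sum>bs\<in>?L. ?J i bs)"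
        by (simp add: mult.assoc)
      also have "ennreal (r powr - (real l + \<sigma>)) * ennreal ((B + 1) * R ^ l * r ^ l) * ennreal (1 / r ^ DIM('a))
        = ennreal (r powr - (real l + \<sigma>) * ((B + 1) * R ^ l * r ^ l) * (1 / r ^ DIM('a)))"
        using B0 R r by (subst (1 2) ennreal_mult) (auto intro!: mult_nonneg_nonneg)
      also have "r powr - (real l + \<sigma>) * ((B + 1) * R ^ l * r ^ l) * (1 / r ^ DIM('a)) = (B + 1) * R ^ l * (2 powr p) ^ i"
      proof -
        have "r powr - (real l + \<sigma>) * r ^ l * (1 / r ^ DIM('a)) = r powr (- (real l + \<sigma>) + real l - real DIM('a))"
          using r by (simp only: powr_diff powr_add powr_realpow) simp
        also have "- (real l + \<sigma>) + real l - real DIM('a) = - p" by (simp add: p_def)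
        also have "r powr - p = (2 powr p) ^ i"
        proof -
          have "r = 2 powr - real i" by (simp add: r_def powr_minus powr_realpow power_one_over inverse_eq_divide)
          then have "r powr - p = 2 powr (real i * p)" by (simp add: powr_powr)
          also have "\<dots> = (2 powr p) ^ i" by (simp add: powr_power mult.commute)
          finally show ?thesis .
        qed
        finally show ?thesis by (simp add: mult_ac)
      qed
      also have "ennreal ((B + 1) * R ^ l * (2 powr p) ^ i) = ennreal ((B + 1) * R ^ l) * ennreal ((2 powr p) ^ i)"
        using B0 R by (intro ennreal_mult) auto
      finally show ?thesis by (simp add: r_def sum_distrib_left mult.assoc)
    qed
    have "(\<Sum>i. ennreal (((1/2) ^ i) powr - (real l + \<sigma>)) * L1_norm (\<lambda>x. v {#} x - average ((1/2) ^ i) \<kappa> (v {#}) x))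
      \<le> (\<Sum>i. ennreal ((B + 1) * R ^ l) * (\<Sum>bs\<in>?L. ennreal ((2 powr p) ^ i) * ?J i bs))"
      by (intro suminf_le term_le summableI)
    also have "\<dots> = ennreal ((B + 1) * R ^ l) * (\<Sum>bs\<in>?L. \<Sum>i. ennreal ((2 powr p) ^ i) * ?J i bs)"
      by (subst ennreal_suminf_cmult, subst suminf_sum) (auto intro: summableI)
    also have "\<dots> \<le> ennreal ((B + 1) * R ^ l) * (\<Sum>bs\<in>?L. ennreal (2 powr p / (2 powr p - 1) * R powr p)
        * (\<integral>\<^sup>+h. ?D bs h / ennreal (norm h powr p) \<partial>lborel))"
      by (intro mult_left_mono sum_mono dyadic_ball_sum_le mD p R)
        (auto simp: L1_norm_diff_op_0[where n = 1, simplified] numeral_2_eq_2)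
    also have "\<dots> = ennreal C * (\<Sum>bs\<in>?L. \<integral>\<^sup>+h. ?D bs h / ennreal (norm h powr p) \<partial>lborel)"
    proof -
      have "ennreal C = ennreal ((B + 1) * R ^ l) * ennreal (2 powr p / (2 powr p - 1) * R powr p)"
        unfolding C_def using B0 R ge_one_powr_ge_zero[of 2 p] p by (intro ennreal_mult) auto
      then show ?thesis by (simp add: sum_distrib_left mult.assoc)
    qed
    finally show ?thesis by (simp only: second_difference_energy_def p_def)
  qed
  ultimately show ?thesis by blast
qed

text \<open>With \<open>P i\<close> the averaging operator at scale \<open>2 ^ -i\<close>, the pieces are
  \<open>P 0 (P 0 f)\<close> and \<open>(P (i + 1) + P i) (P (i + 1) f - P i f)\<close>. Since the operators commute the
  sums telescope to \<open>P N (P N f)\<close>, and the outer operators provide the derivatives.\<close>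

lemma scale_decomposition_positive:
  fixes k l :: nat and \<sigma> :: real
  assumes \<sigma>: "0 < \<sigma>"
  shows "\<exists>C>0. \<forall>v :: 'a::euclidean_space multiset \<Rightarrow> 'a \<Rightarrow> real.
    derivative_family l v \<longrightarrow> second_difference_energy l \<sigma> v < \<infinity> \<longrightarrow>
      scale_decomposition k (real l + \<sigma>) (v {#})
        (ennreal C * (L1_norm (v {#}) + second_difference_energy l \<sigma> v))"
proof (rule difference_kernel[of "l + 2"])
  show "1 \<le> l + 2" by simp
next
  fix \<Psi> :: "'a multiset \<Rightarrow> 'a \<Rightarrow> real" and \<psi> :: "'a \<Rightarrow> real" and R :: real
  assume bk: "\<And>\<beta>. bounded_kernel (\<Psi> \<beta>)"
    and wp\<Psi>: "\<And>\<beta> b. b \<in> Basis \<Longrightarrow> weak_partial UNIV b (\<Psi> \<beta>) (\<Psi> (add_mset b \<beta>))"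
    and \<psi>: "bounded_kernel \<psi>" "0 < R" "\<And>y. R < norm y \<Longrightarrow> \<psi> y = 0"
    and err: "\<And>r u x. 0 < r \<Longrightarrow> integrable lborel u \<Longrightarrow>
      u x - average r (\<Psi> {#}) u x = (-1) ^ (l + 2) * (\<integral>y. \<psi> y * (diff_op (r *\<^sub>R y) ^^ (l + 2)) u x \<partial>lborel)"
  let ?s = "real l + \<sigma>"
  let ?S = "second_difference_energy l \<sigma> :: ('a multiset \<Rightarrow> 'a \<Rightarrow> real) \<Rightarrow> ennreal"
  let ?M = "\<Union>j\<le>k. multi_indices j :: 'a multiset set"
  have finM: "finite ?M" by (simp add: finite_multi_indices)
  \<comment> \<open>One constant for the L1 norms of all derivatives of the kernel up to order k,
    enlarged by 1 so that it is positive.\<close>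
  define K where "K = 1 + (\<Sum>\<beta>\<in>?M. \<integral>y. \<bar>\<Psi> \<beta> y\<bar> \<partial>lborel)"
  have K1: "1 \<le> K" unfolding K_def by (simp add: sum_nonneg)
  have K: "L1_norm (\<Psi> \<beta>) \<le> ennreal K" if "\<beta> \<in> ?M" for \<beta>
  proof -
    have "(\<integral>y. \<bar>\<Psi> \<beta> y\<bar> \<partial>lborel) \<le> (\<Sum>\<beta>\<in>?M. \<integral>y. \<bar>\<Psi> \<beta> y\<bar> \<partial>lborel)"
      using that finM by (intro member_le_sum) auto
    then show ?thesis
      using bk[of \<beta>] by (subst L1_norm_eq_integral) (auto simp: bounded_kernel_def K_def intro!: ennreal_leI)
  qed
  have emp: "{#} \<in> ?M" by (auto simp: multi_indices_def)
  obtain C1 where C1: "0 < C1" and sum_le: "\<And>v :: 'a multiset \<Rightarrow> 'a \<Rightarrow> real. derivative_family l v \<Longrightarrow>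
      (\<Sum>i. ennreal (((1/2) ^ i) powr - ?s) * L1_norm (\<lambda>x. v {#} x - average ((1/2) ^ i) (\<Psi> {#}) (v {#}) x)) \<le> ennreal C1 * ?S v"
    using averaging_error_sum_le[OF \<psi> \<sigma> err] by blast
  \<comment> \<open>K * K belongs to the piece P 0 (P 0 f). For the others, 2 * K comes from the two
    outer operators, 2 powr s from comparing the weights of neighbouring scales, and C1 from the sum
    of the weighted averaging errors.\<close>
  define C where "C = K * K + 2 * K * (2 powr ?s + 1) * C1"
  have C: "0 < C" using K1 C1 by (auto simp: C_def intro!: add_pos_pos mult_pos_pos)
  show ?thesis
  proof (intro exI[of _ C] conjI C allI impI)
    fix v :: "'a multiset \<Rightarrow> 'a \<Rightarrow> real"
    assume fam: "derivative_family l v" and fin: "?S v < \<infinity>"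
    define f where "f = v {#}"
    have f: "integrable lborel f" using fam by (simp add: f_def derivative_family_def)
    define r :: "nat \<Rightarrow> real" where "r i = (1/2) ^ i" for i
    have r: "0 < r i" "r i \<le> 1" "r (Suc i) \<le> r i" for i by (auto simp: r_def power_le_one)
    define P where "P i = average (r i) (\<Psi> {#})" for i
    \<comment> \<open>The derivative of order \<beta> of P i u: by
      \<open>average_weak_partial\<close> every derivative falls on the kernel and brings a factor
      -1 / r i.\<close>
    define Q where "Q i \<beta> u x = (- 1 / r i) ^ size \<beta> * average (r i) (\<Psi> \<beta>) u x" for i \<beta> u x
    have QP: "Q i {#} u = P i u" for i u by (simp add: Q_def[abs_def] P_def)
    have Qi: "integrable lborel (Q i \<beta> u)" if "integrable lborel u" for i \<beta> u
      unfolding Q_def[abs_def] by (intro integrable_mult_right average_integrable r bk that)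
    have Qw: "weak_partial UNIV b (Q i \<beta> u) (Q i (add_mset b \<beta>) u)"
      if "b \<in> Basis" "integrable lborel u" for b i \<beta> u
      using weak_partial_cmult[OF average_weak_partial[OF r(1) bk bk that(2) wp\<Psi>[OF that(1)] that(1)], of "(- 1 / r i) ^ size \<beta>" i \<beta>]
      by (simp add: Q_def[abs_def] mult_ac)
    have Qn: "L1_norm (Q i \<beta> u) \<le> ennreal ((1 / r i) ^ size \<beta> * K) * L1_norm u"
      if "integrable lborel u" "\<beta> \<in> ?M" for i \<beta> u
    proof -
      have "L1_norm (Q i \<beta> u) = ennreal ((1 / r i) ^ size \<beta>) * L1_norm (average (r i) (\<Psi> \<beta>) u)"
        unfolding Q_def[abs_def] using L1_norm_cmult[OF average_measurable[OF r(1) bk that(1)]] r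
        by (simp add: power_abs abs_of_pos[OF r(1)])
      also have "\<dots> \<le> ennreal ((1 / r i) ^ size \<beta>) * (ennreal K * L1_norm u)"
        by (intro mult_left_mono order_trans[OF L1_norm_average_le[OF r(1) bk that(1)]] mult_right_mono K that) auto
      finally show ?thesis using r[of i] K1 by (simp add: ennreal_mult mult.assoc)
    qed
    have Pi: "integrable lborel (P i u)" if "integrable lborel u" for i u
      using Qi[OF that, of i "{#}"] by (simp add: QP)
    define w where "w i x = P (Suc i) f x - P i f x" for i x
    have wi: "integrable lborel (w i)" for i
      unfolding w_def[abs_def] using Pi[OF f] by auto
    define e where "e i = L1_norm (\<lambda>x. f x - P i f x)" for i
    define A where "A i = ennreal (r i powr - ?s) * e i" for i
    have sumA: "(\<Sum>i. A i) \<le> ennreal C1 * ?S v"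
      using sum_le[OF fam] by (simp add: A_def e_def P_def r_def f_def)
    have w_le: "L1_norm (w i) \<le> e i + e (Suc i)" for i
    proof -
      have "w i = (\<lambda>x. (f x - P i f x) - (f x - P (Suc i) f x))" by (simp add: w_def fun_eq_iff)
      then have "L1_norm (w i) = L1_norm (\<lambda>x. (f x - P i f x) - (f x - P (Suc i) f x))" by (rule arg_cong)
      also have "\<dots> \<le> e i + e (Suc i)" unfolding e_def using f Pi[OF f]
        by (intro L1_norm_diff) auto
      finally show ?thesis .
    qed
    define g where "g i \<beta> x = (case i of 0 \<Rightarrow> Q 0 \<beta> (P 0 f) x | Suc i \<Rightarrow> Q (Suc i) \<beta> (w i) x + Q i \<beta> (w i) x)" for i \<beta> x
    have g0: "g 0 \<beta> = Q 0 \<beta> (P 0 f)" and gS: "g (Suc i) \<beta> = (\<lambda>x. Q (Suc i) \<beta> (w i) x + Q i \<beta> (w i) x)" for i \<beta>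
      by (simp_all add: g_def fun_eq_iff)
    have gi: "integrable lborel (g i \<beta>)" for i \<beta>
      by (cases i) (auto simp: g0 gS intro!: Qi wi Pi f Bochner_Integration.integrable_add)
    have gw: "weak_partial UNIV b (g i \<beta>) (g i (add_mset b \<beta>))" if "b \<in> Basis" for b i \<beta>
      using that by (cases i) (auto simp: g0 gS intro!: weak_partial_add Qi Qw wi Pi f)
    have tele: "(\<Sum>i<Suc N. g i {#} x) = P N (P N f) x" for N x
    proof (induction N)
      case 0 then show ?case by (simp add: g0 QP)
    next
      case (Suc N)
      \<comment> \<open>Commuting the averages cancels the two mixed terms of the product, which
        leaves a difference of squares.\<close>
      have "P (Suc N) (P N f) = P N (P (Suc N) f)"
        unfolding P_def by (rule average_commute[OF r(1) bk r(1) bk f])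
      then have "g (Suc N) {#} x = P (Suc N) (P (Suc N) f) x - P N (P N f) x"
        unfolding gS QP w_def[abs_def]
        using average_diff[OF r(1) bk Pi[OF f] Pi[OF f], of _ "{#}" "Suc N" N x]
        by (simp add: P_def[symmetric])
      then show ?case using Suc by simp
    qed
    have A_fin: "(\<Sum>i. A i) < \<infinity>" using sumA fin by (auto intro: le_less_trans simp: ennreal_mult_less_top)
    then have A0: "A \<longlonglongrightarrow> 0" by (rule ennreal_suminf_finite_tendsto_0)
    have eA: "e i \<le> A i" for i
    proof -
      have "1 \<le> r i powr - ?s" using r[of i] \<sigma> powr_mono'[of "- ?s" 0 "r i"] by simp
      then have "ennreal 1 * e i \<le> A i" unfolding A_def by (intro mult_right_mono ennreal_leI) auto
      then show ?thesis by simp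
    qed
    have conv: "(\<lambda>N. L1_norm (\<lambda>x. f x - (\<Sum>i<N. g i {#} x))) \<longlonglongrightarrow> 0"
    proof (rule LIMSEQ_imp_Suc, rule tendsto_sandwich[OF _ _ tendsto_const])
      show "\<forall>\<^sub>F N in sequentially. L1_norm (\<lambda>x. f x - (\<Sum>i<Suc N. g i {#} x)) \<le> ennreal (1 + K) * A N"
      proof (intro always_eventually allI)
        fix N
        let ?d = "\<lambda>x. f x - P N f x"
        have d: "integrable lborel ?d" using f Pi[OF f] by auto
        \<comment> \<open>Adding and subtracting P N f reduces the error of the iterated average to
          that of a single average.\<close>
        have "(\<lambda>x. f x - (\<Sum>i<Suc N. g i {#} x)) = (\<lambda>x. ?d x + P N ?d x)"
          using average_diff[OF r(1) bk f Pi[OF f], of N "{#}" N] unfolding tele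
          by (simp add: P_def fun_eq_iff)
        then have "L1_norm (\<lambda>x. f x - (\<Sum>i<Suc N. g i {#} x)) \<le> L1_norm ?d + L1_norm (P N ?d)"
          using d Pi[OF d] by (auto intro!: L1_norm_add)
        also have "\<dots> \<le> e N + ennreal K * e N"
          using Qn[OF d emp, of N] by (intro add_mono) (auto simp: QP e_def)
        also have "\<dots> = ennreal (1 + K) * e N" using K1 by (simp add: ennreal_plus distrib_right)
        also have "\<dots> \<le> ennreal (1 + K) * A N" by (intro mult_left_mono eA) simp
        finally show "L1_norm (\<lambda>x. f x - (\<Sum>i<Suc N. g i {#} x)) \<le> ennreal (1 + K) * A N" .
      qed
      show "(\<lambda>N. ennreal (1 + K) * A N) \<longlonglongrightarrow> 0"
        using ennreal_tendsto_cmult[OF _ A0, of "ennreal (1 + K)"] by simp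
    qed simp
    have bound: "(\<Sum>i. ennreal (r i powr (real (size \<beta>) - ?s)) * L1_norm (g i \<beta>)) \<le> ennreal C * (L1_norm f + ?S v)"
      if \<beta>: "set_mset \<beta> \<subseteq> Basis" "size \<beta> \<le> k" for \<beta>
    proof -
      have \<beta>M: "\<beta> \<in> ?M" using \<beta> by (auto simp: multi_indices_def)
      let ?T = "\<lambda>i. ennreal (r i powr (real (size \<beta>) - ?s)) * L1_norm (g i \<beta>)"
      have T0: "?T 0 \<le> ennreal (K * K) * L1_norm f"
      proof -
        have "?T 0 \<le> ennreal K * L1_norm (P 0 f)"
          using Qn[OF Pi[OF f] \<beta>M, of 0 0] by (simp add: g0 r_def)
        also have "\<dots> \<le> ennreal K * (ennreal K * L1_norm f)"
          using Qn[OF f emp, of 0] by (intro mult_left_mono) (auto simp: QP)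
        finally show ?thesis using K1 by (simp add: ennreal_mult mult.assoc)
      qed
      have TS: "?T (Suc i) \<le> ennreal (2 * K) * (ennreal (2 powr ?s) * A i + A (Suc i))" for i
      proof -
        let ?r = "r (Suc i)"
        have "L1_norm (g (Suc i) \<beta>) \<le> L1_norm (Q (Suc i) \<beta> (w i)) + L1_norm (Q i \<beta> (w i))"
          unfolding gS using Qi[OF wi] by (intro L1_norm_add) auto
        also have "\<dots> \<le> ennreal ((1 / ?r) ^ size \<beta> * K) * L1_norm (w i) + ennreal ((1 / ?r) ^ size \<beta> * K) * L1_norm (w i)"
        proof (intro add_mono Qn wi \<beta>M)
          \<comment> \<open>A derivative is cheaper at the coarser scale r i, so both outer
            operators are charged at the finer scale.\<close>
          have "(1 / r i) ^ size \<beta> \<le> (1 / ?r) ^ size \<beta>"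
            using r by (intro power_mono divide_left_mono) (auto intro: less_imp_le[OF r(1)])
          then have "ennreal ((1 / r i) ^ size \<beta> * K) \<le> ennreal ((1 / ?r) ^ size \<beta> * K)"
            using K1 by (intro ennreal_leI mult_right_mono) auto
          then show "L1_norm (Q i \<beta> (w i)) \<le> ennreal ((1 / ?r) ^ size \<beta> * K) * L1_norm (w i)"
            using Qn[OF wi \<beta>M, of i i] by (meson mult_right_mono order_trans zero_le)
        qed
        also have "\<dots> = ennreal (2 * K * (1 / ?r) ^ size \<beta>) * L1_norm (w i)"
        proof -
          have "0 \<le> (1 / ?r) ^ size \<beta> * K" using r(1)[of "Suc i"] K1 by simp
          then have "ennreal ((1 / ?r) ^ size \<beta> * K + (1 / ?r) ^ size \<beta> * K)
              = ennreal ((1 / ?r) ^ size \<beta> * K) + ennreal ((1 / ?r) ^ size \<beta> * K)"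
            by (intro ennreal_plus)
          moreover have "(1 / ?r) ^ size \<beta> * K + (1 / ?r) ^ size \<beta> * K = 2 * K * (1 / ?r) ^ size \<beta>" by simp
          ultimately show ?thesis by (simp only: distrib_right)
        qed
        also have "\<dots> \<le> ennreal (2 * K * (1 / ?r) ^ size \<beta>) * (e i + e (Suc i))"
          by (intro mult_left_mono w_le) simp
        finally have "?T (Suc i) \<le> ennreal (?r powr (real (size \<beta>) - ?s)) * (ennreal (2 * K * (1 / ?r) ^ size \<beta>) * (e i + e (Suc i)))"
          by (intro mult_left_mono) auto
        also have "\<dots> = ennreal (?r powr (real (size \<beta>) - ?s) * (2 * K * (1 / ?r) ^ size \<beta>)) * (e i + e (Suc i))"
          using r[of "Suc i"] K1 by (subst ennreal_mult) (auto simp: mult.assoc)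
        also have "?r powr (real (size \<beta>) - ?s) * (2 * K * (1 / ?r) ^ size \<beta>) = 2 * K * ?r powr - ?s"
        proof -
          have "?r powr (real (size \<beta>) - ?s) = ?r powr real (size \<beta>) * ?r powr - ?s"
            by (simp only: powr_add[symmetric] diff_conv_add_uminus)
          then have "?r powr (real (size \<beta>) - ?s) = ?r ^ size \<beta> * ?r powr - ?s"
            using r(1)[of "Suc i"] by (simp only: powr_realpow)
          moreover have "?r ^ size \<beta> * X * (2 * K * (1 / ?r) ^ size \<beta>) = 2 * K * X" for X
            using r(1)[of "Suc i"] by (simp add: power_one_over)
          ultimately show ?thesis by (simp only:)
        qed
        also have "ennreal (2 * K * ?r powr - ?s) * (e i + e (Suc i))
            = ennreal (2 * K) * (ennreal (?r powr - ?s) * e i + A (Suc i))"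
          using K1 by (simp add: ennreal_mult A_def distrib_left mult.assoc)
        also have "?r powr - ?s = 2 powr ?s * r i powr - ?s"
        proof -
          have "?r = (1/2) * r i" by (simp add: r_def)
          then have "?r powr - ?s = (1/2) powr - ?s * r i powr - ?s"
            using r(1)[of i] by (simp only: powr_mult)
          moreover have "(1/2::real) powr - X = 2 powr X" for X
            by (simp add: powr_minus powr_divide)
          ultimately show ?thesis by (simp only:)
        qed
        also have "ennreal (2 powr ?s * r i powr - ?s) * e i = ennreal (2 powr ?s) * A i"
          by (simp add: A_def ennreal_mult mult.assoc)
        finally show ?thesis .
      qed
      have "(\<Sum>i. ?T i) = ?T 0 + (\<Sum>i. ?T (Suc i))" by (rule suminf_ennreal_Suc)
      also have "\<dots> \<le> ennreal (K * K) * L1_norm f + (\<Sum>i. ennreal (2 * K) * (ennreal (2 powr ?s) * A i + A (Suc i)))"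
        by (intro add_mono T0 suminf_le TS summableI)
      also have "(\<Sum>i. ennreal (2 * K) * (ennreal (2 powr ?s) * A i + A (Suc i)))
          = ennreal (2 * K) * (ennreal (2 powr ?s) * (\<Sum>i. A i) + (\<Sum>i. A (Suc i)))"
        by (simp add: suminf_add[symmetric] summableI)
      also have "\<dots> \<le> ennreal (2 * K) * (ennreal (2 powr ?s) * (\<Sum>i. A i) + (\<Sum>i. A i))"
        by (intro mult_left_mono add_mono order_refl) (simp_all add: suminf_ennreal_Suc[of A])
      also have "\<dots> = ennreal (2 * K * (2 powr ?s + 1)) * (\<Sum>i. A i)"
        using K1 by (simp add: ennreal_mult ennreal_plus distrib_right mult.assoc)
      also have "\<dots> \<le> ennreal (2 * K * (2 powr ?s + 1)) * (ennreal C1 * ?S v)"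
        by (intro mult_left_mono sumA) simp
      also have "\<dots> = ennreal (2 * K * (2 powr ?s + 1) * C1) * ?S v"
        using K1 C1 by (subst ennreal_mult[of _ C1]) (auto simp: mult.assoc)
      finally have "(\<Sum>i. ?T i) \<le> ennreal (K * K) * L1_norm f + ennreal (2 * K * (2 powr ?s + 1) * C1) * ?S v"
        by (simp add: add_left_mono)
      also have "\<dots> \<le> ennreal C * L1_norm f + ennreal C * ?S v"
        using K1 C1 by (intro add_mono mult_right_mono ennreal_leI) (auto simp: C_def)
      finally show ?thesis by (simp add: distrib_left)
    qed
    have r0: "r \<longlonglongrightarrow> 0" unfolding r_def by (rule LIMSEQ_realpow_zero) auto
    show "scale_decomposition k ?s (v {#}) (ennreal C * (L1_norm (v {#}) + ?S v))"
      unfolding scale_decomposition_def f_def[symmetric]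
      by (intro exI[of _ g] exI[of _ r] conjI allI ballI impI r gi gw conv r0) (auto intro: bound)
  qed
qed

section \<open>Decomposition of integrable functions\<close>

lemma L1_norm_dominated_convergence:
  fixes s :: "nat \<Rightarrow> 'a::euclidean_space \<Rightarrow> real"
  assumes s: "\<And>i. s i \<in> borel_measurable borel" and f: "f \<in> borel_measurable borel"
    and w: "integrable lborel w"
    and lim: "\<And>x. (\<lambda>i. s i x) \<longlonglongrightarrow> f x" and bound: "\<And>i x. \<bar>s i x\<bar> \<le> w x"
  shows "(\<lambda>i. L1_norm (\<lambda>x. f x - s i x)) \<longlonglongrightarrow> 0"
proof -
  have fw: "\<bar>f x\<bar> \<le> w x" for x
    using tendsto_rabs[OF lim[of x]] bound by (intro LIMSEQ_le_const2) auto
  have b2: "norm \<bar>f x - s i x\<bar> \<le> 2 * w x" for i x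
    using fw[of x] bound[of i x] by simp
  have int: "integrable lborel (\<lambda>x. f x - s i x)" for i
    by (rule Bochner_Integration.integrable_bound[of _ "\<lambda>x. 2 * w x"])
      (use s f w b2[of _ i] in \<open>auto intro: order_trans[OF _ abs_ge_self]\<close>)
  have "(\<lambda>i. \<integral>x. \<bar>f x - s i x\<bar> \<partial>lborel) \<longlonglongrightarrow> (\<integral>x. 0 \<partial>(lborel :: 'a measure))"
  proof (rule integral_dominated_convergence[where w = "\<lambda>x. 2 * w x" and f = "\<lambda>_. 0" and s = "\<lambda>i x. \<bar>f x - s i x\<bar>"])
    show "AE x in lborel. (\<lambda>i. \<bar>f x - s i x\<bar>) \<longlonglongrightarrow> 0"
    proof (intro always_eventually allI)
      fix x
      have "(\<lambda>i. \<bar>f x - s i x\<bar>) \<longlonglongrightarrow> \<bar>f x - f x\<bar>" by (intro tendsto_intros lim)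
      then show "(\<lambda>i. \<bar>f x - s i x\<bar>) \<longlonglongrightarrow> 0" by simp
    qed
  qed (use s f w b2 in auto)
  then have "(\<lambda>i. ennreal (\<integral>x. \<bar>f x - s i x\<bar> \<partial>lborel)) \<longlonglongrightarrow> ennreal 0"
    by (intro tendsto_ennrealI) simp
  then show ?thesis by (simp add: L1_norm_eq_integral[OF int])
qed

section \<open>Density of smooth families in L1\<close>

definition smooth_family :: "('a::euclidean_space multiset \<Rightarrow> 'a \<Rightarrow> real) \<Rightarrow> bool" where
  "smooth_family g \<longleftrightarrow> (\<forall>\<beta>. integrable lborel (g \<beta>)) \<and>
     (\<forall>\<beta>. \<forall>b\<in>Basis. weak_partial UNIV b (g \<beta>) (g (add_mset b \<beta>)))"

lemma smooth_family_add:
  "smooth_family g \<Longrightarrow> smooth_family h \<Longrightarrow> smooth_family (\<lambda>\<beta> x. g \<beta> x + h \<beta> x)"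
  unfolding smooth_family_def by (auto intro!: weak_partial_add)

lemma smooth_family_cmult: "smooth_family g \<Longrightarrow> smooth_family (\<lambda>\<beta> x. c * g \<beta> x)"
  unfolding smooth_family_def by (auto intro!: weak_partial_cmult)

lemma smooth_family_diff:
  "smooth_family g \<Longrightarrow> smooth_family h \<Longrightarrow> smooth_family (\<lambda>\<beta> x. g \<beta> x - h \<beta> x)"
  using smooth_family_add[of g "\<lambda>\<beta> x. (-1) * h \<beta> x"] smooth_family_cmult[of h "-1"] by simp

definition smoothly_approximable :: "('a::euclidean_space \<Rightarrow> real) \<Rightarrow> bool" where
  "smoothly_approximable f \<longleftrightarrow> integrable lborel f \<and>
     (\<forall>\<epsilon>>0. \<exists>g. smooth_family g \<and> L1_norm (\<lambda>x. f x - g {#} x) < ennreal \<epsilon>)"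

lemma smoothly_approximableD:
  assumes "smoothly_approximable f" "0 < \<epsilon>"
  obtains g where "smooth_family g" "L1_norm (\<lambda>x. f x - g {#} x) < ennreal \<epsilon>"
  using assms unfolding smoothly_approximable_def by blast

lemma smoothly_approximable_closed:
  assumes f: "integrable lborel f"
    and ap: "\<And>\<epsilon>. 0 < \<epsilon> \<Longrightarrow> \<exists>h. smoothly_approximable h \<and> L1_norm (\<lambda>x. f x - h x) < ennreal \<epsilon>"
  shows "smoothly_approximable f"
  unfolding smoothly_approximable_def
proof (intro conjI allI impI f)
  fix \<epsilon> :: real assume "0 < \<epsilon>"
  then obtain h where h: "smoothly_approximable h" "L1_norm (\<lambda>x. f x - h x) < ennreal (\<epsilon> / 2)"
    using ap[of "\<epsilon> / 2"] by auto
  have "0 < \<epsilon> / 2" using \<open>0 < \<epsilon>\<close> by simp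
  from smoothly_approximableD[OF h(1) this] obtain g where
    g: "smooth_family g" "L1_norm (\<lambda>x. h x - g {#} x) < ennreal (\<epsilon> / 2)" .
  have "integrable lborel h" "integrable lborel (g {#})"
    using h g by (auto simp: smoothly_approximable_def smooth_family_def)
  then have "L1_norm (\<lambda>x. (f x - h x) + (h x - g {#} x)) \<le> L1_norm (\<lambda>x. f x - h x) + L1_norm (\<lambda>x. h x - g {#} x)"
    using f by (intro L1_norm_add) auto
  also have "\<dots> < ennreal (\<epsilon> / 2) + ennreal (\<epsilon> / 2)" by (intro add_strict_mono h g)
  also have "\<dots> = ennreal \<epsilon>" using \<open>0 < \<epsilon>\<close> by (simp add: ennreal_plus[symmetric] del: ennreal_plus)
  finally show "\<exists>g. smooth_family g \<and> L1_norm (\<lambda>x. f x - g {#} x) < ennreal \<epsilon>"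
    using g by (intro exI[of _ g]) simp
qed

lemma smoothly_approximable_limit:
  assumes f: "integrable lborel f" and h: "\<And>i::nat. smoothly_approximable (h i)"
    and lim: "(\<lambda>i. L1_norm (\<lambda>x. f x - h i x)) \<longlonglongrightarrow> 0"
  shows "smoothly_approximable f"
proof (rule smoothly_approximable_closed[OF f])
  fix \<epsilon> :: real assume "0 < \<epsilon>"
  then have "eventually (\<lambda>i. L1_norm (\<lambda>x. f x - h i x) < ennreal \<epsilon>) sequentially"
    using lim by (intro order_tendstoD) auto
  then obtain i where "L1_norm (\<lambda>x. f x - h i x) < ennreal \<epsilon>"
    using eventually_happens'[OF sequentially_bot] by blast
  with h show "\<exists>h. smoothly_approximable h \<and> L1_norm (\<lambda>x. f x - h x) < ennreal \<epsilon>" by blast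
qed

lemma smooth_family_approximable: "smooth_family g \<Longrightarrow> smoothly_approximable (g {#})"
  unfolding smoothly_approximable_def smooth_family_def by (auto intro!: exI[of _ g])

lemma smoothly_approximable_add:
  assumes f: "smoothly_approximable f" and h: "smoothly_approximable h"
  shows "smoothly_approximable (\<lambda>x. f x + h x)"
  unfolding smoothly_approximable_def
proof (intro conjI allI impI)
  have fh: "integrable lborel f" "integrable lborel h" using f h by (auto simp: smoothly_approximable_def)
  then show "integrable lborel (\<lambda>x. f x + h x)" by auto
  fix \<epsilon> :: real assume "0 < \<epsilon>"
  then have e2: "0 < \<epsilon> / 2" by simp
  from smoothly_approximableD[OF f e2] obtain g where
    g: "smooth_family g" "L1_norm (\<lambda>x. f x - g {#} x) < ennreal (\<epsilon> / 2)" .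
  from smoothly_approximableD[OF h e2] obtain g' where
    g': "smooth_family g'" "L1_norm (\<lambda>x. h x - g' {#} x) < ennreal (\<epsilon> / 2)" .
  have "integrable lborel (g {#})" "integrable lborel (g' {#})" using g g' by (auto simp: smooth_family_def)
  then have "L1_norm (\<lambda>x. (f x - g {#} x) + (h x - g' {#} x)) \<le> L1_norm (\<lambda>x. f x - g {#} x) + L1_norm (\<lambda>x. h x - g' {#} x)"
    using fh by (intro L1_norm_add) auto
  also have "\<dots> < ennreal (\<epsilon> / 2) + ennreal (\<epsilon> / 2)" by (intro add_strict_mono g g')
  also have "\<dots> = ennreal \<epsilon>" using \<open>0 < \<epsilon>\<close> by (simp add: ennreal_plus[symmetric] del: ennreal_plus)
  finally show "\<exists>g. smooth_family g \<and> L1_norm (\<lambda>x. f x + h x - g {#} x) < ennreal \<epsilon>"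
    using smooth_family_add[OF g(1) g'(1)]
    by (intro exI[of _ "\<lambda>\<beta> x. g \<beta> x + g' \<beta> x"]) (simp add: algebra_simps)
qed

lemma smoothly_approximable_cmult:
  assumes f: "smoothly_approximable f"
  shows "smoothly_approximable (\<lambda>x. c * f x)"
  unfolding smoothly_approximable_def
proof (intro conjI allI impI)
  have fi: "integrable lborel f" using f by (auto simp: smoothly_approximable_def)
  then show "integrable lborel (\<lambda>x. c * f x)" by auto
  fix \<epsilon> :: real assume e: "0 < \<epsilon>"
  have "0 < \<epsilon> / (1 + \<bar>c\<bar>)" using e by (intro divide_pos_pos) auto
  from smoothly_approximableD[OF f this] obtain g where
    g: "smooth_family g" "L1_norm (\<lambda>x. f x - g {#} x) < ennreal (\<epsilon> / (1 + \<bar>c\<bar>))" .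
  have gi: "integrable lborel (g {#})" using g by (auto simp: smooth_family_def)
  have "L1_norm (\<lambda>x. c * (f x - g {#} x)) = ennreal \<bar>c\<bar> * L1_norm (\<lambda>x. f x - g {#} x)"
    using fi gi by (intro L1_norm_cmult) auto
  also have "\<dots> \<le> ennreal \<bar>c\<bar> * ennreal (\<epsilon> / (1 + \<bar>c\<bar>))"
    using g by (intro mult_left_mono) auto
  also have "\<dots> = ennreal (\<bar>c\<bar> * (\<epsilon> / (1 + \<bar>c\<bar>)))" using e by (intro ennreal_mult[symmetric]) auto
  also have "\<dots> < ennreal \<epsilon>"
    using e by (intro ennreal_lessI) (auto simp: divide_simps algebra_simps)
  finally show "\<exists>g. smooth_family g \<and> L1_norm (\<lambda>x. c * f x - g {#} x) < ennreal \<epsilon>"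
    using smooth_family_cmult[OF g(1)]
    by (intro exI[of _ "\<lambda>\<beta> x. c * g \<beta> x"]) (simp add: right_diff_distrib)
qed

lemma smoothly_approximable_box: "smoothly_approximable (indicator (box p q))"
proof (rule box_bump_sequence[of p q])
  fix \<Phi> :: "nat \<Rightarrow> 'a multiset \<Rightarrow> 'a \<Rightarrow> real"
  assume \<Phi>: "\<And>k \<beta>. continuous_on UNIV (\<Phi> k \<beta>)"
      "\<And>k \<beta> x. \<Phi> k \<beta> differentiable (at x)"
      "\<And>k \<beta> b. b \<in> Basis \<Longrightarrow> partial_deriv b (\<Phi> k \<beta>) = \<Phi> k (add_mset b \<beta>)"
      "\<And>k \<beta> x. x \<notin> cbox p q \<Longrightarrow> \<Phi> k \<beta> x = 0"
      "\<And>k x. 0 \<le> \<Phi> k {#} x" "\<And>k x. \<Phi> k {#} x \<le> 1"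
      "\<And>x. (\<lambda>k. \<Phi> k {#} x) \<longlonglongrightarrow> indicator (box p q) x"
  have i: "integrable lborel (\<Phi> k \<beta>)" for k \<beta>
    using bounded_kernel_continuous[OF \<Phi>(1,4)] by (simp add: bounded_kernel_def)
  have sf: "smooth_family (\<Phi> k)" for k
    unfolding smooth_family_def
  proof (intro conjI allI ballI i)
    fix \<beta> and b :: 'a assume b: "b \<in> Basis"
    show "weak_partial UNIV b (\<Phi> k \<beta>) (\<Phi> k (add_mset b \<beta>))"
    proof (rule weak_partial_classical[OF i i _ \<Phi>(1) b])
      show "((\<lambda>s. \<Phi> k \<beta> (x + s *\<^sub>R b)) has_real_derivative \<Phi> k (add_mset b \<beta>) (x + s *\<^sub>R b)) (at s)" for x s
        using DERIV_line_Basis[OF \<Phi>(2) b, where A = UNIV] unfolding \<Phi>(3)[OF b] by auto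
    qed
  qed
  have m: "\<Phi> k \<beta> \<in> borel_measurable borel" for k \<beta> using i[of k \<beta>] by auto
  show ?thesis
  proof (rule smoothly_approximable_limit[OF _ smooth_family_approximable[OF sf]])
    show "integrable lborel (indicator (box p q) :: 'a \<Rightarrow> real)"
      by (simp add: emeasure_lborel_box_eq)
    show "(\<lambda>i. L1_norm (\<lambda>x. indicator (box p q) x - \<Phi> i {#} x)) \<longlonglongrightarrow> 0"
    proof (rule L1_norm_dominated_convergence[where w = "indicator (cbox p q)"])
      show "\<bar>\<Phi> i {#} x\<bar> \<le> indicator (cbox p q) x" for i x
        using \<Phi>(4)[of x i "{#}"] \<Phi>(5,6)[of i x] by (cases "x \<in> cbox p q") auto
    qed (auto intro: m \<Phi>(7) simp: emeasure_lborel_cbox_eq)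
  qed
qed

text \<open>Dynkin's argument, started from boxes. Intersecting with one fixed box keeps all
  indicator functions integrable, so complements are taken inside that box and disjoint unions
  converge by domination.\<close>

lemma smoothly_approximable_bounded_set:
  fixes p q :: "'a::euclidean_space"
  assumes "A \<in> sets borel"
  shows "smoothly_approximable (indicator (A \<inter> box p q))"
proof -
  let ?C = "box p q"
  have ind: "integrable lborel (indicator (A \<inter> ?C) :: 'a \<Rightarrow> real)" if "A \<in> sets borel" for A
  proof -
    have "emeasure lborel (A \<inter> ?C) \<le> emeasure lborel ?C" using that by (intro emeasure_mono) auto
    then show ?thesis using that by (simp add: emeasure_lborel_box_eq le_less_trans)
  qed
  let ?G = "range (\<lambda>(a, b). box a b :: 'a set)"
  have G: "Int_stable ?G" "?G \<subseteq> Pow UNIV"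
    by (auto simp: Int_stable_def box_Int_box)
  have "A \<in> sigma_sets UNIV ?G" using assms by (simp add: borel_eq_box)
  with G show ?thesis
  proof (induction rule: sigma_sets_induct_disjoint)
    case (basic A)
    then obtain a b where A: "A = box a b" by auto
    have "\<exists>p' q'. A \<inter> ?C = box p' q'" unfolding A box_Int_box by blast
    then show ?case using smoothly_approximable_box by metis
  next
    case empty
    have "box p p = ({} :: 'a set)" by simp
    with smoothly_approximable_box[of p p] show ?case by (simp only: Int_empty_left)
  next
    case (compl A)
    have "smoothly_approximable (\<lambda>x. indicator ?C x + (-1) * indicator (A \<inter> ?C) x)"
      by (intro smoothly_approximable_add smoothly_approximable_box smoothly_approximable_cmult compl.IH)
    also have "(\<lambda>x. indicator ?C x + (-1) * indicator (A \<inter> ?C) x :: real) = indicator ((UNIV - A) \<inter> ?C)"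
      by (auto simp: fun_eq_iff indicator_def)
    finally show ?case .
  next
    case (union A)
    then have A: "A i \<in> sets borel" for i by (auto simp: borel_eq_box)
    let ?s = "\<lambda>n x. \<Sum>i<n. indicator (A i \<inter> ?C) x :: real"
    have s: "smoothly_approximable (?s n)" for n
    proof (induction n)
      case 0
      have "box p p = ({} :: 'a set)" by simp
      moreover have "(\<lambda>x. 0) = (indicator {} :: 'a \<Rightarrow> real)" by (simp add: fun_eq_iff)
      ultimately show ?case using smoothly_approximable_box[of p p] by simp
    next
      case (Suc n) then show ?case using union.IH by (simp add: smoothly_approximable_add)
    qed
    have e: "?s n x = indicator ((\<Union>i<n. A i) \<inter> ?C) x" for n x
    proof -
      have "disjoint_family_on (\<lambda>i. A i \<inter> ?C) {..<n}"
        using union.hyps(1) by (auto simp: disjoint_family_on_def)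
      then have "indicator (\<Union>i<n. A i \<inter> ?C) x = ?s n x" by (intro indicator_UN_disjoint) auto
      then show ?thesis by (simp add: UN_extend_simps del: UN_simps)
    qed
    show ?case
    proof (rule smoothly_approximable_limit[OF ind s])
      show "(\<Union>i. A i) \<in> sets borel" using A by auto
      show "(\<lambda>n. L1_norm (\<lambda>x. indicator ((\<Union>i. A i) \<inter> ?C) x - ?s n x)) \<longlonglongrightarrow> 0"
      proof (rule L1_norm_dominated_convergence[where w = "indicator ?C"])
        show "(\<lambda>n. ?s n x) \<longlonglongrightarrow> indicator ((\<Union>i. A i) \<inter> ?C) x" for x
        proof (cases "x \<in> (\<Union>i. A i) \<inter> ?C")
          case True
          then obtain i where i: "x \<in> A i" "x \<in> ?C" by auto
          have "eventually (\<lambda>n. ?s n x = 1) sequentially"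
            using eventually_gt_at_top[of i]
          proof eventually_elim
            case (elim n)
            then have "x \<in> (\<Union>i<n. A i) \<inter> ?C" using i by auto
            then show ?case unfolding e by (rule indicator_simps(1))
          qed
          then show ?thesis using True by (simp add: tendsto_eventually)
        next
          case False
          then have "?s n x = 0" for n unfolding e by auto
          with False show ?thesis by simp
        qed
        show "\<bar>?s i x\<bar> \<le> indicator ?C x" for i x unfolding e by (auto simp: indicator_def)
      qed (use A in \<open>auto simp: emeasure_lborel_box_eq\<close>)
    qed
  qed
qed

text \<open>Approximability passes to linear combinations and L1 limits. Sets of finite measure are
  limits of their parts in growing boxes, and simple functions dominated by 2 \<bar>f\<bar> lead to
  f.\<close>

lemma integrable_smoothly_approximable:
  assumes "integrable lborel f"
  shows "smoothly_approximable f"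
  using assms
proof (induction rule: integrable_induct)
  case (base A c)
  let ?B = "\<lambda>n::nat. box (- real n *\<^sub>R One) (real n *\<^sub>R One) :: 'a set"
  have i: "integrable lborel (indicator A :: 'a \<Rightarrow> real)" using base by simp
  have "smoothly_approximable (indicator A)"
  proof (rule smoothly_approximable_limit[OF i smoothly_approximable_bounded_set])
    show "(\<lambda>n. L1_norm (\<lambda>x. indicator A x - indicator (A \<inter> ?B n) x)) \<longlonglongrightarrow> 0"
    proof (rule L1_norm_dominated_convergence[OF _ _ i])
      show "(\<lambda>n. indicator (A \<inter> ?B n) x :: real) \<longlonglongrightarrow> indicator A x" for x
      proof -
        have "x \<in> (\<Union>n::nat. box (- (real n *\<^sub>R One)) (real n *\<^sub>R One))" by (simp add: UN_box_eq_UNIV)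
        then obtain N where N: "x \<in> ?B N" by auto
        have "eventually (\<lambda>n. indicator (A \<inter> ?B n) x = (indicator A x :: real)) sequentially"
          using eventually_ge_at_top[of N]
        proof eventually_elim
          case (elim n)
          then have "?B N \<subseteq> ?B n" by (intro subset_box_imp) (auto simp: inner_Basis)
          with N show ?case by (auto simp: indicator_def)
        qed
        then show ?thesis by (rule tendsto_eventually)
      qed
      show "\<bar>indicator (A \<inter> ?B i) x :: real\<bar> \<le> indicator A x" for i x by (auto simp: indicator_def)
    qed (use base in auto)
  qed (use base in auto)
  from smoothly_approximable_cmult[OF this, of c] show ?case by (simp add: mult.commute)
next
  case (add f g) then show ?case by (intro smoothly_approximable_add)
next
  case (lim f s)
  show ?case
  proof (rule smoothly_approximable_limit[OF lim(4) lim(5)])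
    show "(\<lambda>i. L1_norm (\<lambda>x. f x - s i x)) \<longlonglongrightarrow> 0"
      using lim by (intro L1_norm_dominated_convergence[where w = "\<lambda>x. 2 * \<bar>f x\<bar>"]) auto
  qed
qed

text \<open>For \<open>s = 0\<close> the scales \<open>r i\<close> can be chosen after the pieces, as small as needed to
  absorb all derivatives: this is Gagliardo's nonlinear extension.\<close>

lemma scale_decomposition_L1:
  fixes f :: "'a::euclidean_space \<Rightarrow> real"
  assumes f: "integrable lborel f"
  shows "scale_decomposition k 0 f (ennreal 8 * L1_norm f)"
proof (cases "L1_norm f = 0")
  \<comment> \<open>The tolerances below are proportional to the norm of f and must be positive, so
    a null function is decomposed into zero pieces.\<close>
  case True
  have "weak_partial UNIV b (\<lambda>x. 0) (\<lambda>x. 0)" for b :: 'a by (simp add: weak_partial_def)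
  moreover have "(\<lambda>i. (1/2::real) ^ i) \<longlonglongrightarrow> 0" by (rule LIMSEQ_realpow_zero) auto
  ultimately show ?thesis
    unfolding scale_decomposition_def
    by (intro exI[of _ "\<lambda>i \<beta> x. 0"] exI[of _ "\<lambda>i. (1/2) ^ i"]) (auto simp: True power_le_one)
next
  case False
  define N where "N = (\<integral>x. \<bar>f x\<bar> \<partial>lborel)"
  have Nf: "L1_norm f = ennreal N" unfolding N_def by (rule L1_norm_eq_integral[OF f])
  with False have N: "0 < N" by (metis ennreal_eq_0_iff not_le)
  have "\<exists>h. smooth_family h \<and> L1_norm (\<lambda>x. f x - h {#} x) < ennreal (N * (1/2) ^ i)" for i
    using integrable_smoothly_approximable[OF f] N unfolding smoothly_approximable_def by simp
  then obtain h where h: "\<And>i. smooth_family (h i)"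
    and hf: "\<And>i. L1_norm (\<lambda>x. f x - h i {#} x) < ennreal (N * (1/2) ^ i)" by metis
  define g where "g i = (case i of 0 \<Rightarrow> h 0 | Suc i \<Rightarrow> (\<lambda>\<beta> x. h (Suc i) \<beta> x - h i \<beta> x))" for i
  have g: "smooth_family (g i)" for i
    by (cases i) (auto simp: g_def intro: h smooth_family_diff)
  have hi: "integrable lborel (h i \<beta>)" for i \<beta> using h by (simp add: smooth_family_def)
  have gi: "integrable lborel (g i \<beta>)" for i \<beta> using g by (simp add: smooth_family_def)
  have tele: "(\<Sum>i<Suc n. g i {#} x) = h n {#} x" for n x
    by (induction n) (auto simp: g_def)
  have conv: "(\<lambda>n. L1_norm (\<lambda>x. f x - (\<Sum>i<n. g i {#} x))) \<longlonglongrightarrow> 0"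
  proof (rule LIMSEQ_imp_Suc, rule tendsto_sandwich[OF _ _ tendsto_const])
    show "\<forall>\<^sub>F n in sequentially. L1_norm (\<lambda>x. f x - (\<Sum>i<Suc n. g i {#} x)) \<le> ennreal (N * (1/2) ^ n)"
      unfolding tele using hf by (intro always_eventually allI) (rule less_imp_le)
    have "(\<lambda>n. N * (1/2) ^ n) \<longlonglongrightarrow> N * 0" by (intro tendsto_intros LIMSEQ_realpow_zero) auto
    then show "(\<lambda>n. ennreal (N * (1/2) ^ n)) \<longlonglongrightarrow> 0"
      using tendsto_ennrealI by fastforce
  qed simp
  \<comment> \<open>Two consecutive errors sum to 3 N / 2 ^ i, and the first piece has norm at most
    2 N; rounding up to 4 makes the series sum to 8 N, the constant of the statement.\<close>
  have g_norm: "L1_norm (g i {#}) \<le> ennreal (4 * N * (1/2) ^ i)" for i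
  proof (cases i)
    case 0
    have "L1_norm (\<lambda>x. f x - (f x - h 0 {#} x)) \<le> L1_norm f + L1_norm (\<lambda>x. f x - h 0 {#} x)"
      using f hi by (intro L1_norm_diff) auto
    also have "\<dots> \<le> ennreal N + ennreal N"
      using hf[of 0] by (intro add_mono) (auto simp: Nf)
    also have "\<dots> \<le> ennreal (4 * N)" using N by (simp add: ennreal_plus[symmetric] del: ennreal_plus)
    finally show ?thesis by (simp add: 0 g_def)
  next
    case (Suc n)
    have "L1_norm (\<lambda>x. (f x - h n {#} x) - (f x - h (Suc n) {#} x))
        \<le> L1_norm (\<lambda>x. f x - h n {#} x) + L1_norm (\<lambda>x. f x - h (Suc n) {#} x)"
      using f hi by (intro L1_norm_diff) auto
    also have "\<dots> \<le> ennreal (N * (1/2) ^ n) + ennreal (N * (1/2) ^ Suc n)"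
      using hf by (intro add_mono less_imp_le)
    also have "\<dots> = ennreal (N * (1/2) ^ n + N * (1/2) ^ Suc n)" using N by (intro ennreal_plus[symmetric]) auto
    also have "\<dots> \<le> ennreal (4 * N * (1/2) ^ Suc n)" using N by (intro ennreal_leI) simp
    finally show ?thesis by (simp add: Suc g_def algebra_simps)
  qed
  let ?M = "\<Union>j\<le>k. multi_indices j :: 'a multiset set"
  have finM: "finite ?M" by (simp add: finite_multi_indices)
  define D where "D i = (\<Sum>\<beta>\<in>?M. \<integral>x. \<bar>g i \<beta> x\<bar> \<partial>lborel)" for i
  have D0: "0 \<le> D i" for i unfolding D_def by (intro sum_nonneg) auto
  \<comment> \<open>The first entry sends the scales to 0, the second gives r i * D i <= N / 2 ^ i.
    Since r i <= 1, higher powers of r i are covered as well; 1 + D i avoids division by 0.\<close>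
  define r where "r i = min ((1/2) ^ i) (N * (1/2) ^ i / (1 + D i))" for i :: nat
  have D1: "0 < 1 + D i" for i using D0[of i] by simp
  have r: "0 < r i" "r i \<le> (1/2) ^ i" for i using N D1[of i] by (auto simp: r_def)
  have r1: "r i \<le> 1" for i using r(2)[of i] by (simp add: order_trans power_le_one)
  have r0: "r \<longlonglongrightarrow> 0"
    by (rule tendsto_sandwich[OF _ _ tendsto_const LIMSEQ_realpow_zero[of "1/2"]])
      (use r in \<open>auto intro!: always_eventually less_imp_le\<close>)
  have rD: "r i * D i \<le> N * (1/2) ^ i" for i
  proof -
    have "r i * (1 + D i) \<le> N * (1/2) ^ i / (1 + D i) * (1 + D i)"
      using D1[of i] by (intro mult_right_mono) (auto simp: r_def)
    also have "\<dots> = N * (1/2) ^ i" using D1[of i] by simp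
    finally show ?thesis using r(1)[of i] by (simp add: distrib_left)
  qed
  have bound: "(\<Sum>i. ennreal (r i powr (real (size \<beta>) - 0)) * L1_norm (g i \<beta>)) \<le> ennreal 8 * L1_norm f"
    if \<beta>: "set_mset \<beta> \<subseteq> Basis" "size \<beta> \<le> k" for \<beta>
  proof -
    have t: "ennreal (r i powr (real (size \<beta>) - 0)) * L1_norm (g i \<beta>) \<le> ennreal (4 * N * (1/2) ^ i)" for i
    proof (cases "\<beta> = {#}")
      case True then show ?thesis using g_norm[of i] r(1)[of i] by simp
    next
      case False
      have "(\<integral>x. \<bar>g i \<beta> x\<bar> \<partial>lborel) \<le> D i"
        unfolding D_def using \<beta> finM by (intro member_le_sum) (auto simp: multi_indices_def)
      moreover have "r i powr real (size \<beta>) \<le> r i"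
      proof -
        have "1 \<le> size \<beta>" using False by (simp add: Suc_le_eq nonempty_has_size)
        then have "r i powr real (size \<beta>) \<le> r i powr 1"
          using r(1)[of i] r1[of i] by (intro powr_mono') auto
        then show ?thesis using r(1)[of i] by simp
      qed
      ultimately have "r i powr real (size \<beta>) * (\<integral>x. \<bar>g i \<beta> x\<bar> \<partial>lborel) \<le> r i * D i"
        using r(1)[of i] by (intro mult_mono) auto
      also have "\<dots> \<le> N * (1/2) ^ i" by (rule rD)
      also have "\<dots> \<le> 4 * N * (1/2) ^ i" using N by (intro mult_right_mono) auto
      finally show ?thesis
        by (simp add: L1_norm_eq_integral[OF gi] ennreal_mult[symmetric] ennreal_leI del: ennreal_mult)
    qed
    have "(\<lambda>i. 4 * N * (1/2) ^ i) sums (4 * N * (1 / (1 - 1/2)))"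
      by (intro sums_mult geometric_sums) auto
    then have "(\<Sum>i. ennreal (4 * N * (1/2) ^ i)) = ennreal (8 * N)"
      using N by (intro suminf_ennreal_eq) auto
    moreover have "(\<Sum>i. ennreal (r i powr (real (size \<beta>) - 0)) * L1_norm (g i \<beta>)) \<le> (\<Sum>i. ennreal (4 * N * (1/2) ^ i))"
      by (intro suminf_le t summableI)
    moreover have "ennreal (8 * N) = ennreal 8 * L1_norm f" unfolding Nf using N by (intro ennreal_mult) auto
    ultimately show ?thesis by (simp only:)
  qed
  show ?thesis
    unfolding scale_decomposition_def
    using g r r1 r0 conv bound
    by (intro exI[of _ g] exI[of _ r] conjI allI ballI impI) (auto simp: smooth_family_def)
qed

section \<open>Besov functions\<close>

lemma AE_lebesgue_translate:
  fixes h :: "'a::euclidean_space"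
  assumes "AE x in lebesgue. P x"
  shows "AE x in lebesgue. P (x + h)"
proof -
  have "AE x in lborel. P x" using assms by (simp add: AE_completion_iff)
  then obtain N where N: "{x. \<not> P x} \<subseteq> N" "N \<in> null_sets lborel"
    by (auto elim!: AE_E simp: null_sets_def)
  then have [measurable]: "N \<in> sets borel" by (auto simp: null_sets_def)
  have "emeasure lborel ((\<lambda>x. x + h) -` N \<inter> space lborel) = emeasure (distr lborel borel (\<lambda>x. x + h)) N"
    by (rule emeasure_distr[symmetric]) auto
  also have "distr lborel borel (\<lambda>x. x + h) = lborel"
  proof -
    have "(\<lambda>x. x + h) = (+) h" by (simp add: fun_eq_iff add.commute)
    then show ?thesis by (simp add: lborel_distr_plus)
  qed
  finally have "emeasure lborel ((\<lambda>x. x + h) -` N \<inter> space lborel) = emeasure lborel N" .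
  moreover have "(\<lambda>x. x + h) -` N \<in> sets borel"
    using measurable_sets[of "\<lambda>x. x + h" borel borel N] by simp
  ultimately have "(\<lambda>x. x + h) -` N \<in> null_sets lborel" using N(2) by (simp add: null_sets_def)
  then have "AE x in lborel. x \<notin> (\<lambda>x. x + h) -` N" by (rule AE_not_in)
  then have "AE x in lborel. P (x + h)" by eventually_elim (use N(1) in auto)
  then show ?thesis by (rule AE_completion)
qed

lemma L1_norm_diff_op_power_cong_AE:
  assumes "AE x in lebesgue. f x = g x"
  shows "L1_norm ((diff_op h ^^ n) f) = L1_norm ((diff_op h ^^ n) g)"
proof (rule L1_norm_cong_AE)
  have "AE x in lebesgue. \<forall>k\<in>{..n}. f (x + real k *\<^sub>R h) = g (x + real k *\<^sub>R h)"
    by (subst AE_ball_countable) (auto intro: AE_lebesgue_translate[OF assms])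
  then show "AE x in lebesgue. (diff_op h ^^ n) f x = (diff_op h ^^ n) g x"
    by eventually_elim (auto simp: diff_op_power intro!: sum.cong)
qed

text \<open>Besov functions are only Lebesgue measurable, while the exchanges of integrals need
  Borel functions; this is the bridge.\<close>

lemma integrable_lebesgue_borel_representative:
  assumes "integrable lebesgue f"
  obtains f' :: "'a::euclidean_space \<Rightarrow> real" where "integrable lborel f'" "AE x in lebesgue. f x = f' x"
proof -
  obtain f' where f': "f' \<in> borel_measurable lborel" "AE x in lborel. f x = f' x"
    using completion_ex_borel_measurable_real[of f lborel] assms by auto
  then have ae: "AE x in lebesgue. f x = f' x" by (intro AE_completion)
  have "integrable lebesgue f'"
    by (rule integrable_cong_AE_imp[OF assms]) (use f' ae in \<open>auto simp: measurable_completion\<close>)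
  then have "integrable lborel f'" using f' by (simp add: integrable_completion)
  with ae show ?thesis using that by blast
qed

lemma scale_decomposition_cong_AE:
  assumes "scale_decomposition k s f B" "AE x in lebesgue. f' x = f x" "B \<le> B'"
  shows "scale_decomposition k s f' B'"
proof -
  have "L1_norm (\<lambda>x. f' x - G x) = L1_norm (\<lambda>x. f x - G x)" for G
    by (rule L1_norm_cong_AE) (use assms(2) in eventually_elim, simp)
  with assms(1) show ?thesis
    unfolding scale_decomposition_def by (elim ex_forward) (auto intro: order_trans[OF _ assms(3)])
qed

text \<open>For \<sigma> = 1 the seminorm already contains second differences. For \<sigma> < 1 it
  contains first ones, and a second difference is the difference of two translates of a first one;
  hence the factor 2.\<close>

lemma second_difference_seminorm_le:
  fixes v f :: "'a::euclidean_space \<Rightarrow> real"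
  assumes \<sigma>: "0 < \<sigma>" "\<sigma> \<le> 1" and v [measurable]: "v \<in> borel_measurable borel"
    and ae: "AE x in lebesgue. f x = v x"
  shows "(\<integral>\<^sup>+h. L1_norm ((diff_op h ^^ 2) v) / ennreal (norm h powr (real DIM('a) + \<sigma>)) \<partial>lborel)
    \<le> 2 * besov_seminorm_base \<sigma> f"
proof -
  let ?n = "nat \<lfloor>\<sigma>\<rfloor> + 1" and ?w = "\<lambda>h :: 'a. ennreal (norm h powr (real DIM('a) + \<sigma>))"
  have base: "besov_seminorm_base \<sigma> f = (\<integral>\<^sup>+h. L1_norm ((diff_op h ^^ ?n) v) / ?w h \<partial>lborel)"
    unfolding besov_seminorm_base_def nn_integral_completion
    by (simp only: L1_norm_diff_op_power_cong_AE[OF ae])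
  have le: "L1_norm ((diff_op h ^^ 2) v) \<le> 2 * L1_norm ((diff_op h ^^ ?n) v)" for h
  proof (cases "\<sigma> = 1")
    case True
    have "L1_norm ((diff_op h ^^ 2) v) \<le> 2 * L1_norm ((diff_op h ^^ 2) v)"
      using mult_right_mono[of 1 "2::ennreal" "L1_norm ((diff_op h ^^ 2) v)"] by simp
    then show ?thesis using True by (simp add: numeral_2_eq_2)
  next
    case False
    then have "\<lfloor>\<sigma>\<rfloor> = 0" using \<sigma> by (simp add: floor_eq_iff)
    let ?d = "diff_op h v"
    have [measurable]: "?d \<in> borel_measurable borel" using diff_op_power_measurable[OF v, where n = 1] by simp
    have "L1_norm (\<lambda>x. ?d (x + h) - ?d x) \<le> L1_norm (\<lambda>x. ?d (x + h)) + L1_norm ?d"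
      by (rule L1_norm_diff) measurable
    also have "\<dots> = 2 * L1_norm ?d" by (simp add: L1_norm_translate mult_2)
    finally have "L1_norm (\<lambda>x. ?d (x + h) - ?d x) \<le> 2 * L1_norm ?d" .
    moreover have "(diff_op h ^^ 2) v = (\<lambda>x. ?d (x + h) - ?d x)"
      by (simp add: fun_eq_iff numeral_2_eq_2 diff_op_def)
    ultimately show ?thesis using \<open>\<lfloor>\<sigma>\<rfloor> = 0\<close> by simp
  qed
  have "(\<integral>\<^sup>+h. L1_norm ((diff_op h ^^ 2) v) / ?w h \<partial>lborel) \<le> (\<integral>\<^sup>+h. 2 * (L1_norm ((diff_op h ^^ ?n) v) / ?w h) \<partial>lborel)"
    unfolding divide_ennreal_def mult.assoc[symmetric]
    by (intro nn_integral_mono mult_right_mono le) simp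
  also have "\<dots> = 2 * besov_seminorm_base \<sigma> f"
    unfolding base by (rule nn_integral_cmult) measurable
  finally show ?thesis .
qed

text \<open>For an integer s > 1 the order is s - 1 and the remainder is exactly 1, not 0: this is
  the case that forces second differences.\<close>

lemma besov_order_bounds:
  assumes "1 < s"
  shows "1 \<le> besov_order s" "0 < s - real (besov_order s)" "s - real (besov_order s) \<le> 1"
proof -
  let ?A = "{j. 1 \<le> j \<and> real j < s}"
  have "?A \<subseteq> {..nat \<lceil>s\<rceil>}" by (auto simp: le_nat_iff) linarith
  then have fin: "finite ?A" by (rule finite_subset) simp
  have "1 \<in> ?A" using assms by simp
  then have "besov_order s \<in> ?A" unfolding besov_order_def using fin by (intro Max_in) auto
  then show "1 \<le> besov_order s" "0 < s - real (besov_order s)" by auto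
  show "s - real (besov_order s) \<le> 1"
  proof (rule ccontr)
    assume "\<not> ?thesis"
    then have "Suc (besov_order s) \<in> ?A" by auto
    then have "Suc (besov_order s) \<le> besov_order s"
      unfolding besov_order_def using fin by (intro Max_ge)
    then show False by simp
  qed
qed

lemma locally_integrable_measurable:
  assumes "locally_integrable UNIV g"
  shows "g \<in> borel_measurable lebesgue"
proof (rule borel_measurable_LIMSEQ_real)
  let ?B = "\<lambda>n::nat. cbox (- real n *\<^sub>R One) (real n *\<^sub>R One) :: 'a set"
  show "(\<lambda>x. indicator (?B n) x * g x) \<in> borel_measurable lebesgue" for n
    using assms by (auto simp: locally_integrable_def set_integrable_def dest!: spec[of _ "?B n"])
  show "(\<lambda>n. indicator (?B n) x * g x) \<longlonglongrightarrow> g x" for x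
  proof -
    have "x \<in> (\<Union>n::nat. box (- (real n *\<^sub>R One)) (real n *\<^sub>R One))" by (simp add: UN_box_eq_UNIV)
    then obtain N where N: "x \<in> box (- real N *\<^sub>R One) (real N *\<^sub>R One)" by auto
    have "eventually (\<lambda>n. indicator (?B n) x * g x = g x) sequentially"
      using eventually_ge_at_top[of N]
    proof eventually_elim
      case (elim n)
      then have "?B N \<subseteq> ?B n" by (intro subset_box_imp) (auto simp: inner_Basis)
      with N show ?case using box_subset_cbox by (auto simp: indicator_def)
    qed
    then show ?thesis by (rule tendsto_eventually)
  qed
qed

text \<open>A single derivative is one entry of the tensor, hence pointwise at most
  \<open>norm_nabla\<close>, whose integral is part of the finite norm.\<close>

lemma sobolev_weak_deriv_integrable:
  fixes f :: "'a::euclidean_space \<Rightarrow> real"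
  assumes f: "f \<in> sobolev UNIV (\<lambda>_. 1) l"
  shows "integrable lebesgue f"
    and "\<alpha> \<in> multi_indices j \<Longrightarrow> j \<le> l \<Longrightarrow> has_weak_deriv UNIV \<alpha> f (weak_deriv UNIV \<alpha> f)"
    and "\<alpha> \<in> multi_indices j \<Longrightarrow> 1 \<le> j \<Longrightarrow> j \<le> l \<Longrightarrow> integrable lebesgue (weak_deriv UNIV \<alpha> f)"
proof -
  have loc: "locally_integrable UNIV f" and norm: "sobolev_norm UNIV (\<lambda>_. 1) l f < \<infinity>"
    and ex: "\<And>j \<alpha>. j \<le> l \<Longrightarrow> \<alpha> \<in> multi_indices j \<Longrightarrow> \<exists>g. has_weak_deriv UNIV \<alpha> f g"
    using f by (auto simp: sobolev_def sobolev_loc_def)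
  have "(\<integral>\<^sup>+x. ennreal \<bar>f x\<bar> \<partial>lebesgue) < \<infinity>"
    using norm by (auto simp: sobolev_norm_def intro: le_less_trans)
  then show "integrable lebesgue f"
    using locally_integrable_measurable[OF loc] by (simp add: integrable_iff_bounded)
  show hw: "has_weak_deriv UNIV \<alpha> f (weak_deriv UNIV \<alpha> f)" if "\<alpha> \<in> multi_indices j" "j \<le> l" for \<alpha> j
    unfolding weak_deriv_def using ex[OF that(2,1)] by (rule someI_ex)
  show "integrable lebesgue (weak_deriv UNIV \<alpha> f)" if \<alpha>: "\<alpha> \<in> multi_indices j" and j: "1 \<le> j" "j \<le> l"
  proof -
    have "locally_integrable UNIV (weak_deriv UNIV \<alpha> f)"
      using hw[OF \<alpha> j(2)] by (simp add: has_weak_deriv_def)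
    then have "weak_deriv UNIV \<alpha> f \<in> borel_measurable lebesgue" by (rule locally_integrable_measurable)
    moreover have "(\<integral>\<^sup>+x. ennreal \<bar>weak_deriv UNIV \<alpha> f x\<bar> \<partial>lebesgue) < \<infinity>"
    proof -
      obtain as where as: "mset as = \<alpha>" using ex_mset by blast
      have pt: "\<bar>weak_deriv UNIV \<alpha> f x\<bar> \<le> norm_nabla UNIV j f x" for x
      proof -
        let ?L = "{bs. set bs \<subseteq> (Basis :: 'a set) \<and> length bs = j}"
        have "as \<in> ?L" using as \<alpha> by (auto simp: multi_indices_def)
        moreover have "finite ?L" by (rule finite_lists_length_eq) simp
        ultimately have "(weak_deriv UNIV (mset as) f x)\<^sup>2 \<le> (\<Sum>bs\<in>?L. (weak_deriv UNIV (mset bs) f x)\<^sup>2)"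
          by (intro member_le_sum[of as ?L "\<lambda>bs. (weak_deriv UNIV (mset bs) f x)\<^sup>2"]) auto
        then show ?thesis
          unfolding norm_nabla_def as by (intro real_le_rsqrt) simp
      qed
      have "(\<integral>\<^sup>+x. ennreal \<bar>weak_deriv UNIV \<alpha> f x\<bar> \<partial>lebesgue) \<le> (\<integral>\<^sup>+x. ennreal (norm_nabla UNIV j f x) \<partial>lebesgue)"
        by (intro nn_integral_mono ennreal_leI pt)
      also have "\<dots> \<le> (\<Sum>j=1..l. \<integral>\<^sup>+x. ennreal (norm_nabla UNIV j f x) \<partial>lebesgue)"
        using j by (intro member_le_sum) auto
      also have "\<dots> < \<infinity>" using norm by (auto simp: sobolev_norm_def intro: le_less_trans)
      finally show ?thesis .
    qed
    ultimately show ?thesis by (simp add: integrable_iff_bounded)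
  qed
qed

text \<open>Borel representatives of f and its weak derivatives up to order l form a
  \<open>derivative_family\<close>, and s = l + \<sigma> with 0 < \<sigma> <= 1. Here l is 0 for s
  <= 1 and the Besov order otherwise.\<close>

lemma scale_decomposition_besov:
  fixes s :: real
  assumes s: "0 < s"
  shows "\<exists>C>0. \<forall>f\<in>besov s. scale_decomposition k s (f :: 'a::euclidean_space \<Rightarrow> real) (ennreal C * besov_norm s f)"
proof (cases "s \<le> 1")
  case True
  obtain C where C: "0 < C" and *: "\<And>v :: 'a multiset \<Rightarrow> 'a \<Rightarrow> real. derivative_family 0 v \<Longrightarrow>
      second_difference_energy 0 s v < \<infinity> \<Longrightarrow> scale_decomposition k (real 0 + s) (v {#})
        (ennreal C * (L1_norm (v {#}) + second_difference_energy 0 s v))"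
    using scale_decomposition_positive[where l = 0 and k = k and 'a = 'a, OF s] by blast
  show ?thesis
  proof (intro exI[of _ "2 * C"] conjI ballI)
    show "0 < 2 * C" using C by simp
    fix f :: "'a \<Rightarrow> real" assume "f \<in> besov s"
    then have f: "integrable lebesgue f" and fin: "besov_seminorm_base s f < \<infinity>"
      using True by (auto simp: besov_def besov_seminorm_def)
    obtain f' where f': "integrable lborel f'" "AE x in lebesgue. f x = f' x"
      using integrable_lebesgue_borel_representative[OF f] .
    \<comment> \<open>With l = 0 only the empty index enters, so a constant family suffices.\<close>
    define E where "E = second_difference_energy 0 s (\<lambda>\<alpha>. f')"
    have L0: "{bs. set bs \<subseteq> (Basis :: 'a set) \<and> length bs = 0} = {[]}" by auto
    have E: "E \<le> 2 * besov_seminorm_base s f"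
      unfolding E_def second_difference_energy_def L0
      using second_difference_seminorm_le[OF s True _ f'(2)] f'(1) by simp
    have "E < \<infinity>"
      by (rule le_less_trans[OF E]) (use fin in \<open>simp add: ennreal_mult_less_top\<close>)
    then have "scale_decomposition k s f' (ennreal C * (L1_norm f' + E))"
      using *[of "\<lambda>\<alpha>. f'"] f'(1) by (simp add: derivative_family_def E_def)
    then show "scale_decomposition k s f (ennreal (2 * C) * besov_norm s f)"
    proof (rule scale_decomposition_cong_AE[OF _ f'(2)])
      have "L1_norm f' = L1_norm f" by (rule L1_norm_cong_AE) (use f'(2) in eventually_elim, simp)
      then have "L1_norm f' + E \<le> 2 * L1_norm f + 2 * besov_seminorm_base s f"
        using mult_right_mono[of 1 "2::ennreal" "L1_norm f"] E by (intro add_mono) auto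
      then have "ennreal C * (L1_norm f' + E) \<le> ennreal C * (2 * besov_norm s f)"
        using True by (intro mult_left_mono) (auto simp: besov_norm_def besov_seminorm_def distrib_left)
      also have "\<dots> = ennreal (2 * C) * besov_norm s f"
        using C by (simp add: ennreal_mult mult_ac)
      finally show "ennreal C * (L1_norm f' + E) \<le> ennreal (2 * C) * besov_norm s f" .
    qed
  qed
next
  case False
  define l where "l = besov_order s"
  define \<sigma> where "\<sigma> = s - real l"
  have l: "1 \<le> l" and \<sigma>: "0 < \<sigma>" "\<sigma> \<le> 1" and sl: "real l + \<sigma> = s"
    using besov_order_bounds[of s] False by (auto simp: l_def \<sigma>_def)
  let ?L = "{bs. set bs \<subseteq> (Basis :: 'a set) \<and> length bs = l}"
  obtain C where C: "0 < C" and *: "\<And>v :: 'a multiset \<Rightarrow> 'a \<Rightarrow> real. derivative_family l v \<Longrightarrow>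
      second_difference_energy l \<sigma> v < \<infinity> \<Longrightarrow> scale_decomposition k (real l + \<sigma>) (v {#})
        (ennreal C * (L1_norm (v {#}) + second_difference_energy l \<sigma> v))"
    using scale_decomposition_positive[where l = l and k = k and 'a = 'a, OF \<sigma>(1)] by blast
  \<comment> \<open>Every list of length l contributes at most twice the Besov seminorm to the
    energy.\<close>
  define c where "c = 1 + 2 * real (card ?L)"
  have c: "1 \<le> c" by (simp add: c_def)
  show ?thesis
  proof (intro exI[of _ "C * c"] conjI ballI)
    show "0 < C * c" using C c by simp
    fix f :: "'a \<Rightarrow> real" assume fB: "f \<in> besov s"
    then have f: "f \<in> sobolev UNIV (\<lambda>_. 1) l" and fin: "besov_seminorm s f < \<infinity>"
      using False by (auto simp: besov_def l_def)
    \<comment> \<open>At the empty index \<open>weak_deriv\<close> would return some function equal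
      to f almost everywhere; f itself is taken, whose integrability is known.\<close>
    define d where "d \<alpha> = (if \<alpha> = {#} then f else weak_deriv UNIV \<alpha> f)" for \<alpha>
    have dw: "has_weak_deriv UNIV \<alpha> f (d \<alpha>)" if "set_mset \<alpha> \<subseteq> Basis" "size \<alpha> \<le> l" for \<alpha>
    proof (cases "\<alpha> = {#}")
      case True
      have "locally_integrable UNIV f" using f by (simp add: sobolev_def sobolev_loc_def)
      then show ?thesis using True by (simp add: d_def has_weak_deriv_def)
    next
      case False
      then show ?thesis using sobolev_weak_deriv_integrable(2)[OF f, of \<alpha> "size \<alpha>"] that
        by (simp add: d_def multi_indices_def)
    qed
    have di: "integrable lebesgue (d \<alpha>)" if "set_mset \<alpha> \<subseteq> Basis" "size \<alpha> \<le> l" for \<alpha>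
      using sobolev_weak_deriv_integrable(1)[OF f] sobolev_weak_deriv_integrable(3)[OF f, of \<alpha> "size \<alpha>"] that
      by (auto simp: d_def multi_indices_def Suc_le_eq nonempty_has_size)
    have "\<exists>d'. integrable lborel d' \<and> (AE x in lebesgue. d \<alpha> x = d' x)" if "set_mset \<alpha> \<subseteq> Basis \<and> size \<alpha> \<le> l" for \<alpha>
      using integrable_lebesgue_borel_representative[OF di[of \<alpha>]] that by metis
    then obtain d' where d': "\<And>\<alpha>. set_mset \<alpha> \<subseteq> Basis \<and> size \<alpha> \<le> l \<Longrightarrow>
        integrable lborel (d' \<alpha>) \<and> (AE x in lebesgue. d \<alpha> x = d' \<alpha> x)" by metis
    \<comment> \<open>\<open>derivative_family\<close> speaks of all multisets. An index with an
      element outside the basis keeps it when a direction is added, so 0 is consistent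
      there.\<close>
    define v where "v \<alpha> = (if set_mset \<alpha> \<subseteq> Basis then d' \<alpha> else (\<lambda>x. 0))" for \<alpha>
    have vi: "integrable lborel (v \<alpha>)" if "size \<alpha> \<le> l" for \<alpha>
      using d'[of \<alpha>] that by (simp add: v_def)
    have vae: "AE x in lebesgue. d \<alpha> x = v \<alpha> x" if "set_mset \<alpha> \<subseteq> Basis" "size \<alpha> \<le> l" for \<alpha>
      using d'[of \<alpha>] that by (simp add: v_def)
    have vae': "AE x in lebesgue. v \<alpha> x = d \<alpha> x" if "set_mset \<alpha> \<subseteq> Basis" "size \<alpha> \<le> l" for \<alpha>
      using vae[OF that] by eventually_elim simp
    have vw: "weak_partial UNIV b (v \<alpha>) (v (add_mset b \<alpha>))" if b: "b \<in> Basis" and \<alpha>: "size \<alpha> < l" for b \<alpha>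
    proof (cases "set_mset \<alpha> \<subseteq> Basis")
      case True
      show ?thesis
        by (rule has_weak_deriv_weak_partial[OF dw dw True b _ vae' _ vae'])
          (use True b \<alpha> vi[of \<alpha>] vi[of "add_mset b \<alpha>"] in auto)
    next
      case False
      then show ?thesis by (auto simp: v_def weak_partial_def)
    qed
    have fam: "derivative_family l v" using vi vw by (simp add: derivative_family_def)
    have f_v: "AE x in lebesgue. f x = v {#} x" using vae[of "{#}"] by (simp add: d_def)
    define E where "E = second_difference_energy l \<sigma> v"
    have E: "E \<le> ennreal (2 * real (card ?L)) * besov_seminorm s f"
    proof -
      have "(\<integral>\<^sup>+h. L1_norm ((diff_op h ^^ 2) (v (mset bs))) / ennreal (norm h powr (real DIM('a) + \<sigma>)) \<partial>lborel)
        \<le> 2 * besov_seminorm s f" if bs: "bs \<in> ?L" for bs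
      proof -
        have m: "mset bs \<in> multi_indices l" using bs by (auto simp: multi_indices_def)
        have "mset bs \<noteq> {#}" using bs l by auto
        then have "AE x in lebesgue. weak_deriv UNIV (mset bs) f x = v (mset bs) x"
          using vae[of "mset bs"] bs by (simp add: d_def)
        then have "(\<integral>\<^sup>+h. L1_norm ((diff_op h ^^ 2) (v (mset bs))) / ennreal (norm h powr (real DIM('a) + \<sigma>)) \<partial>lborel)
          \<le> 2 * besov_seminorm_base \<sigma> (weak_deriv UNIV (mset bs) f)"
          using vi[of "mset bs"] bs by (intro second_difference_seminorm_le \<sigma>) auto
        also have "\<dots> \<le> 2 * (\<Sum>\<alpha>\<in>multi_indices l. besov_seminorm_base \<sigma> (weak_deriv UNIV \<alpha> f))"
          using m finite_multi_indices by (intro mult_left_mono member_le_sum) auto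
        also have "\<dots> = 2 * besov_seminorm s f"
          using False by (simp add: besov_seminorm_def l_def \<sigma>_def)
        finally show ?thesis .
      qed
      then have "E \<le> (\<Sum>bs\<in>?L. 2 * besov_seminorm s f)"
        unfolding E_def second_difference_energy_def by (intro sum_mono)
      also have "\<dots> = ennreal (2 * real (card ?L)) * besov_seminorm s f"
        by (simp add: ennreal_mult ennreal_of_nat_eq_real_of_nat mult_ac)
      finally show ?thesis .
    qed
    have "E < \<infinity>"
      by (rule le_less_trans[OF E]) (use fin in \<open>simp add: ennreal_mult_less_top\<close>)
    then have "scale_decomposition k s (v {#}) (ennreal C * (L1_norm (v {#}) + E))"
      using *[OF fam] by (simp add: sl E_def)
    then show "scale_decomposition k s f (ennreal (C * c) * besov_norm s f)"
    proof (rule scale_decomposition_cong_AE[OF _ f_v])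
      have "L1_norm (v {#}) = L1_norm f" by (rule L1_norm_cong_AE) (use f_v in eventually_elim, simp)
      also have "\<dots> \<le> sobolev_norm UNIV (\<lambda>_. 1) l f" by (simp add: sobolev_norm_def L1_norm_def)
      also have "\<dots> \<le> ennreal c * sobolev_norm UNIV (\<lambda>_. 1) l f"
        using mult_right_mono[of 1 "ennreal c" "sobolev_norm UNIV (\<lambda>_. 1) l f"] c by simp
      finally have "L1_norm (v {#}) + E \<le> ennreal c * sobolev_norm UNIV (\<lambda>_. 1) l f + ennreal c * besov_seminorm s f"
        by (intro add_mono order_trans[OF E] mult_right_mono ennreal_leI) (auto simp: c_def)
      then have "ennreal C * (L1_norm (v {#}) + E) \<le> ennreal C * (ennreal c * besov_norm s f)"
        using False by (intro mult_left_mono) (auto simp: besov_norm_def l_def distrib_left)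
      also have "\<dots> = ennreal (C * c) * besov_norm s f"
        using C c by (simp add: ennreal_mult mult.assoc)
      finally show "ennreal C * (L1_norm (v {#}) + E) \<le> ennreal (C * c) * besov_norm s f" .
    qed
  qed
qed

section \<open>Cutoff functions\<close>

text \<open>With y = t ^ N this shows that multiplying t ^ j / j! by (1 - t ^ N) ^ N leaves the
  coefficients below order N unchanged.\<close>

lemma one_minus_power_eq:
  fixes y :: "'a::comm_ring_1"
  shows "\<exists>z. (1 - y) ^ n = 1 + y * z"
proof (induction n)
  case 0 then show ?case by (intro exI[of _ 0]) simp
next
  case (Suc n)
  then obtain z where "(1 - y) ^ n = 1 + y * z" by blast
  then have "(1 - y) ^ Suc n = 1 + y * (z - 1 - y * z)" by (simp add: algebra_simps)
  then show ?case by blast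
qed

text \<open>The order of a zero drops by at most one under differentiation, as the product rule
  shows.\<close>

lemma dvd_pderiv_power:
  fixes x p :: "real poly"
  assumes "x ^ Suc n dvd p"
  shows "x ^ n dvd pderiv p"
proof -
  obtain z where "p = x ^ Suc n * z" using assms by (elim dvdE)
  then have "pderiv p = x ^ Suc n * pderiv z + z * (smult (of_nat (Suc n)) (x ^ n) * pderiv x)"
    by (simp only: pderiv_mult pderiv_power_Suc)
  moreover have "x ^ n dvd x ^ Suc n * pderiv z" by (intro dvd_mult2 le_imp_power_dvd) simp
  moreover have "x ^ n dvd z * (smult (of_nat (Suc n)) (x ^ n) * pderiv x)"
    by (intro dvd_mult dvd_mult2 dvd_smult dvd_refl)
  ultimately show ?thesis by (simp only: dvd_add)
qed

lemma higher_pderiv_root: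
  fixes p :: "real poly"
  assumes "[:- c, 1:] ^ n dvd p" "q < n"
  shows "poly ((pderiv ^^ q) p) c = 0"
proof -
  have "[:- c, 1:] ^ (n - q) dvd (pderiv ^^ q) p"
    using assms(2)
  proof (induction q)
    case 0 then show ?case using assms by simp
  next
    case (Suc q)
    then have "n - q = Suc (n - Suc q)" by simp
    with Suc show ?case using dvd_pderiv_power[of "[:- c, 1:]" "n - Suc q" "(pderiv ^^ q) p"] by simp
  qed
  moreover have "[:- c, 1:] dvd [:- c, 1:] ^ (n - q)" using assms(2) by (intro dvd_power) auto
  ultimately have "[:- c, 1:] dvd (pderiv ^^ q) p" by (rule dvd_trans[rotated])
  then show ?thesis by (simp add: poly_eq_0_iff_dvd)
qed

text \<open>The cutoff is \<open>t ^ j / j! * (1 - t ^ N) ^ N\<close> for \<open>t < 1\<close> with \<open>N = k + 2\<close>, continued by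
  \<open>0\<close>; the polynomial vanishes at \<open>1\<close> to order \<open>N\<close> and agrees with \<open>t ^ j / j!\<close> at \<open>0\<close> to
  order \<open>N\<close>.\<close>

lemma cutoff_family:
  fixes j k :: nat
  obtains \<theta> :: "nat \<Rightarrow> real \<Rightarrow> real" and C :: real
  where "0 < C"
    "\<And>q. \<theta> q \<in> borel_measurable borel"
    "\<And>q t. q \<le> k \<Longrightarrow> (\<theta> q has_real_derivative \<theta> (Suc q) t) (at t)"
    "\<And>q. q \<le> Suc k \<Longrightarrow> continuous_on UNIV (\<theta> q)"
    "\<And>q t. q \<le> Suc k \<Longrightarrow> 0 \<le> t \<Longrightarrow> \<bar>\<theta> q t\<bar> \<le> C"
    "\<And>q t. 1 \<le> t \<Longrightarrow> \<theta> q t = 0"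
    "\<And>q. q \<le> Suc k \<Longrightarrow> (\<theta> q \<longlongrightarrow> (if q = j then 1 else 0)) (at_right 0)"
proof -
  \<comment> \<open>The orders 0 to k + 1 must fit at both ends, that is, all q < N: at 0 for the
    traces, at 1 for the continuity of the last derivative.\<close>
  define N where "N = k + 2"
  define p :: "real poly" where "p = smult (1 / fact j) (monom 1 j * (1 - monom 1 N) ^ N)"
  define D where "D q = (pderiv ^^ q) p" for q
  define \<theta> where "\<theta> q t = (if t < 1 then poly (D q) t else 0)" for q and t :: real
  have root: "poly (D q) 1 = 0" if "q < N" for q
  proof -
    have "[:- 1, 1:] dvd (1 - monom 1 N :: real poly)"
      by (simp add: poly_eq_0_iff_dvd[symmetric] poly_monom)
    then have "[:- 1, 1:] ^ N dvd (1 - monom 1 N :: real poly) ^ N" by (rule dvd_power_same)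
    then have "[:- 1, 1:] ^ N dvd p" unfolding p_def by (intro dvd_smult dvd_mult)
    then show ?thesis unfolding D_def using that by (rule higher_pderiv_root)
  qed
  have zero: "poly (D q) 0 = (if q = j then 1 else 0)" if "q < N" for q
  proof -
    obtain z where z: "(1 - monom 1 N :: real poly) ^ N = 1 + monom 1 N * z"
      using one_minus_power_eq by blast
    have "coeff p q = (1 / fact j) * (coeff (monom 1 j) q + coeff (monom 1 (j + N) * z) q)"
      by (simp add: p_def z distrib_left mult.assoc[symmetric] mult_monom)
    also have "coeff (monom 1 (j + N) * z) q = 0" using that by (simp add: coeff_monom_mult)
    finally have "coeff p q = (if q = j then 1 / fact j else 0)" by simp
    moreover have "poly (D q) 0 = fact q * coeff p q"
      by (simp add: D_def poly_0_coeff_0 coeff_higher_pderiv pochhammer_fact)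
    ultimately show ?thesis by simp
  qed
  have pD: "(poly (D q) has_real_derivative poly (D (Suc q)) t) (at t)" for q t
    unfolding D_def by (simp add: poly_DERIV)
  have deriv: "(\<theta> q has_real_derivative \<theta> (Suc q) t) (at t)" if q: "q \<le> k" for q t
  proof -
    consider "t < 1" | "t = 1" | "1 < t" by linarith
    then show ?thesis
    proof cases
      case 1
      then have "eventually (\<lambda>y. \<theta> q y = poly (D q) y) (nhds t)"
        using eventually_nhds_in_open[of "{..<1}" t] by (auto elim!: eventually_mono simp: \<theta>_def)
      then show ?thesis using pD[of q t] 1 by (subst DERIV_cong_ev[OF refl _ refl]) (auto simp: \<theta>_def)
    next
      case 3
      then have "eventually (\<lambda>y. \<theta> q y = 0) (nhds t)"
        using eventually_nhds_in_open[of "{1<..}" t] by (auto elim!: eventually_mono simp: \<theta>_def)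
      then show ?thesis using 3 by (subst DERIV_cong_ev[OF refl _ refl, of _ "\<lambda>_. 0"]) (auto simp: \<theta>_def)
    next
      case 2
      have r: "poly (D q) 1 = 0" "poly (D (Suc q)) 1 = 0" using q root by (auto simp: N_def)
      have lim: "((\<lambda>y. (poly (D q) y - poly (D q) 1) / (y - 1)) \<longlongrightarrow> 0) (at 1)"
        using pD[of q 1] unfolding has_field_derivative_iff r by simp
      \<comment> \<open>At the junction the difference quotient of \<theta> is either 0 or that of
        the polynomial, which tends to 0 because 1 is a root of the next derivative too.\<close>
      have "((\<lambda>y. (\<theta> q y - \<theta> q 1) / (y - 1)) \<longlongrightarrow> 0) (at 1)"
        by (rule Lim_null_comparison[OF _ tendsto_rabs_zero[OF lim]])
          (auto simp: \<theta>_def r intro!: always_eventually)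
      then show ?thesis unfolding 2 has_field_derivative_iff by (simp add: \<theta>_def)
    qed
  qed
  have cont: "continuous_on UNIV (\<theta> q)" if "q \<le> Suc k" for q
  proof -
    have "continuous_on ({..1} \<union> {1..}) (\<lambda>t. if t < 1 then poly (D q) t else 0)"
    proof -
      have "continuous_on ({..1} \<union> {1..}) (\<lambda>t. if t \<le> 1 then poly (D q) t else 0)"
        using root[of q] that by (intro continuous_on_If) (auto intro!: continuous_intros simp: N_def)
      moreover have "(if t \<le> 1 then poly (D q) t else 0) = (if t < 1 then poly (D q) t else 0)" for t
        using root[of q] that by (auto simp: N_def)
      ultimately show ?thesis by simp
    qed
    moreover have "{..1} \<union> {1..} = (UNIV :: real set)" by auto
    ultimately show ?thesis by (simp add: \<theta>_def[abs_def])
  qed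
  have "\<exists>B. \<forall>t\<in>{0..1}. \<bar>poly (D q) t\<bar> \<le> B" for q
  proof -
    have "compact (poly (D q) ` {0..1})" by (intro compact_continuous_image) (auto intro!: continuous_intros)
    then show ?thesis using compact_imp_bounded[of "poly (D q) ` {0..1}"] by (auto simp: bounded_iff)
  qed
  then obtain B where B: "\<And>q t. t \<in> {0..1} \<Longrightarrow> \<bar>poly (D q) t\<bar> \<le> B q" by metis
  have B0: "0 \<le> B q" for q using B[of 0 q] by (auto intro: order_trans[OF abs_ge_zero])
  define C where "C = 1 + (\<Sum>q\<le>Suc k. B q)"
  have C: "\<bar>\<theta> q t\<bar> \<le> C" if "q \<le> Suc k" "0 \<le> t" for q t
  proof -
    have "B q \<le> (\<Sum>q\<le>Suc k. B q)" using that B0 by (intro member_le_sum) auto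
    moreover have "\<bar>\<theta> q t\<bar> \<le> B q" using B[of t q] B0[of q] that by (auto simp: \<theta>_def)
    ultimately show ?thesis by (simp add: C_def)
  qed
  have lim0: "(\<theta> q \<longlongrightarrow> (if q = j then 1 else 0)) (at_right 0)" if "q \<le> Suc k" for q
  proof -
    have "(\<theta> q \<longlongrightarrow> \<theta> q 0) (at_right 0)"
      using cont[OF that] by (auto simp: continuous_on_def intro: filterlim_mono at_le)
    then show ?thesis using zero[of q] that by (simp add: \<theta>_def N_def)
  qed
  have m: "\<theta> q \<in> borel_measurable borel" for q
    unfolding \<theta>_def[abs_def]
    by (intro measurable_If) (auto intro!: borel_measurable_continuous_onI continuous_intros)
  have "0 < C" unfolding C_def using B0 by (intro add_pos_nonneg sum_nonneg) auto
  then show ?thesis using that[of C \<theta>] m deriv cont C lim0 by (auto simp: \<theta>_def)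
qed

section \<open>Tensor products on the half-space\<close>

lemma open_halfspace: "open (halfspace :: ('a::euclidean_space \<times> real) set)"
proof -
  have "open (UNIV \<times> {0<..} :: ('a \<times> real) set)" by (intro open_Times) auto
  also have "UNIV \<times> {0<..} = (halfspace :: ('a \<times> real) set)" by (auto simp: halfspace_def)
  finally show ?thesis .
qed

lemma halfspace_borel [measurable]: "halfspace \<in> sets borel"
  using open_halfspace by (rule borel_open)

lemma test_fun_halfspace_bounds:
  assumes "\<phi> \<in> test_fun (halfspace :: ('a::euclidean_space \<times> real) set)"
  obtains \<delta> T where "0 < \<delta>" "\<delta> < T" "\<And>x t. t \<notin> {\<delta>..T} \<Longrightarrow> \<phi> (x, t) = 0"
proof -
  let ?K = "closure {p. \<phi> p \<noteq> 0}"
  have K: "compact ?K" "?K \<subseteq> halfspace" using assms by (auto simp: test_fun_def)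
  \<comment> \<open>Inserting 1 keeps the set nonempty when \<phi> is 0, and T + 1 in the result
    makes the interval nondegenerate.\<close>
  have c: "compact (insert 1 (snd ` ?K))"
    using K(1) by (intro compact_insert compact_continuous_image) (auto intro!: continuous_intros)
  obtain \<delta> where \<delta>: "\<delta> \<in> insert 1 (snd ` ?K)" "\<And>t. t \<in> insert 1 (snd ` ?K) \<Longrightarrow> \<delta> \<le> t"
    using compact_attains_inf[OF c] by auto
  obtain T where T: "T \<in> insert 1 (snd ` ?K)" "\<And>t. t \<in> insert 1 (snd ` ?K) \<Longrightarrow> t \<le> T"
    using compact_attains_sup[OF c] by auto
  have "0 < \<delta>" using \<delta>(1) K(2) by (auto simp: halfspace_def)
  moreover have "\<delta> < T + 1" using \<delta>(2)[of 1] T(2)[of 1] by simp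
  moreover have "\<phi> (x, t) = 0" if "t \<notin> {\<delta>..T + 1}" for x t
  proof (rule ccontr)
    assume "\<phi> (x, t) \<noteq> 0"
    then have "(x, t) \<in> ?K" using closure_subset[of "{p. \<phi> p \<noteq> 0}"] by blast
    then have "t \<in> insert 1 (snd ` ?K)" by (auto intro!: image_eqI[of _ snd "(x, t)"])
    then show False using \<delta>(2)[of t] T(2)[of t] that by auto
  qed
  ultimately show ?thesis using that by blast
qed

text \<open>The factor v is only bounded, and only for t > 0. Since \<phi> vanishes unless t lies in
  a compact interval of positive heights, v may be cut off to that interval, where it is integrable
  and Fubini's theorem applies.\<close>

lemma tensor_test_fun:
  fixes u :: "'a::euclidean_space \<Rightarrow> real" and v :: "real \<Rightarrow> real"
  assumes u: "integrable lborel u" and v [measurable]: "v \<in> borel_measurable borel"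
    and B: "\<And>t. 0 < t \<Longrightarrow> \<bar>v t\<bar> \<le> B" and \<phi>: "\<phi> \<in> test_fun halfspace"
  shows "integrable lborel (\<lambda>p. u (fst p) * v (snd p) * \<phi> p)"
    and "(\<integral>p. u (fst p) * v (snd p) * \<phi> p \<partial>lborel) = (\<integral>x. u x * (\<integral>t. v t * \<phi> (x, t) \<partial>lborel) \<partial>lborel)"
    and "(\<integral>p. u (fst p) * v (snd p) * \<phi> p \<partial>lborel) = (\<integral>t. v t * (\<integral>x. u x * \<phi> (x, t) \<partial>lborel) \<partial>lborel)"
proof -
  have [measurable]: "u \<in> borel_measurable borel" "\<phi> \<in> borel_measurable borel"
    using u test_fun_borel[OF \<phi>] by auto
  obtain \<delta> T where \<delta>: "0 < \<delta>" and van: "\<And>x t. t \<notin> {\<delta>..T} \<Longrightarrow> \<phi> (x, t) = 0"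
    using test_fun_halfspace_bounds[OF \<phi>] by metis
  obtain B' where B': "\<And>p. \<bar>\<phi> p\<bar> \<le> B'" using test_fun_bounded[OF \<phi>] by blast
  define k where "k t = indicator {\<delta>..T} t * v t" for t
  have k: "integrable lborel k"
  proof -
    have "\<bar>k t\<bar> \<le> B" for t using B[of t] B[of 1] \<delta> by (auto simp: k_def indicator_def intro: order_trans[OF abs_ge_zero])
    moreover have "k = (\<lambda>t. indicator {\<delta>..T} t * k t)" by (auto simp: k_def fun_eq_iff indicator_def)
    moreover have "integrable lborel (\<lambda>t. indicator {\<delta>..T} t * k t)" if "\<And>t. \<bar>k t\<bar> \<le> B"
      using that by (intro integrable_bounded_mult[where B = B]) (auto simp: k_def[abs_def] emeasure_lborel_Icc_eq)
    ultimately show ?thesis by metis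
  qed
  have kv: "k t * \<phi> (x, t) = v t * \<phi> (x, t)" for x t
    using van[of t x] by (cases "t \<in> {\<delta>..T}") (auto simp: k_def)
  \<comment> \<open>The shift by 0 puts the product into the shape required by
    \<open>integrable_translate_kernel\<close>.\<close>
  have kv': "u x * v t * \<phi> (x, t) = k (t + 0) * u x * \<phi> (x, t)" for x t
    using kv[of t x] by auto
  have "(\<lambda>(y, x). \<phi> (y, x)) \<in> borel_measurable (borel \<Otimes>\<^sub>M borel)"
    unfolding borel_prod by simp
  from integrable_translate_kernel[OF k u, of "\<lambda>_. 0" "\<lambda>x t. \<phi> (x, t)", OF _ this B']
  have I: "integrable (lborel \<Otimes>\<^sub>M lborel) (\<lambda>(x, t). u x * v t * \<phi> (x, t))"
    unfolding kv' by simp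
  have e: "(\<lambda>p. u (fst p) * v (snd p) * \<phi> p) = (\<lambda>(x, t). u x * v t * \<phi> (x, t))" by (auto simp: fun_eq_iff)
  show "integrable lborel (\<lambda>p. u (fst p) * v (snd p) * \<phi> p)"
    unfolding e lborel_prod[symmetric] by (rule I)
  show "(\<integral>p. u (fst p) * v (snd p) * \<phi> p \<partial>lborel) = (\<integral>x. u x * (\<integral>t. v t * \<phi> (x, t) \<partial>lborel) \<partial>lborel)"
    unfolding e lborel_prod[symmetric] lborel_pair.integral_fst[OF I, symmetric] by (simp add: mult.assoc)
  show "(\<integral>p. u (fst p) * v (snd p) * \<phi> p \<partial>lborel) = (\<integral>t. v t * (\<integral>x. u x * \<phi> (x, t) \<partial>lborel) \<partial>lborel)"
    unfolding e lborel_prod[symmetric] lborel_pair.integral_snd[OF I, symmetric]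
    by (simp add: mult.assoc mult.left_commute[of "u _" "v _"])
qed

lemma tensor_weak_partial_x:
  fixes u u' :: "'a::euclidean_space \<Rightarrow> real" and v :: "real \<Rightarrow> real"
  assumes u: "integrable lborel u" and u': "integrable lborel u'" and w: "weak_partial UNIV b u u'"
    and v: "v \<in> borel_measurable borel" "\<And>t. 0 < t \<Longrightarrow> \<bar>v t\<bar> \<le> B" and b: "b \<in> Basis"
  shows "weak_partial halfspace (b, 0) (\<lambda>p. u (fst p) * v (snd p)) (\<lambda>p. u' (fst p) * v (snd p))"
  unfolding weak_partial_def
proof
  fix \<phi> :: "'a \<times> real \<Rightarrow> real" assume \<phi>: "\<phi> \<in> test_fun halfspace"
  have \<phi>b: "partial_deriv (b, 0) \<phi> \<in> test_fun halfspace"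
    using \<phi> b by (intro test_fun_partial_deriv) (auto simp: Basis_prod_def)
  have "(\<integral>x. u x * partial_deriv (b, 0) \<phi> (x, t) \<partial>lborel) = - (\<integral>x. u' x * \<phi> (x, t) \<partial>lborel)" for t
    using w test_fun_slice(1)[OF \<phi>, of t] unfolding weak_partial_def test_fun_slice(2)[OF \<phi>, symmetric] by blast
  then have "(\<integral>t. v t * (\<integral>x. u x * partial_deriv (b, 0) \<phi> (x, t) \<partial>lborel) \<partial>lborel)
      = - (\<integral>t. v t * (\<integral>x. u' x * \<phi> (x, t) \<partial>lborel) \<partial>lborel)" by simp
  then show "(\<integral>p. u (fst p) * v (snd p) * partial_deriv (b, 0) \<phi> p \<partial>lborel)
      = - (\<integral>p. u' (fst p) * v (snd p) * \<phi> p \<partial>lborel)"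
    by (simp only: tensor_test_fun(3)[OF u v(1) v(2) \<phi>b] tensor_test_fun(3)[OF u' v(1) v(2) \<phi>])
qed

text \<open>Integration by parts in t for each fixed x. A test function on the half-space vanishes
  near t = 0, so no boundary term arises.\<close>

lemma tensor_weak_partial_t:
  fixes u :: "'a::euclidean_space \<Rightarrow> real" and v v' :: "real \<Rightarrow> real"
  assumes u: "integrable lborel u"
    and v: "\<And>t. 0 < t \<Longrightarrow> \<bar>v t\<bar> \<le> B" and v': "\<And>t. 0 < t \<Longrightarrow> \<bar>v' t\<bar> \<le> B'"
    and c': "continuous_on UNIV v'" and D: "\<And>t. (v has_real_derivative v' t) (at t)"
  shows "weak_partial halfspace (0, 1) (\<lambda>p. u (fst p) * v (snd p)) (\<lambda>p. u (fst p) * v' (snd p))"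
  unfolding weak_partial_def
proof
  fix \<phi> :: "'a \<times> real \<Rightarrow> real" assume \<phi>: "\<phi> \<in> test_fun halfspace"
  have c: "continuous_on UNIV v" using D by (intro continuous_at_imp_continuous_on ballI) (rule DERIV_isCont)
  have m: "v \<in> borel_measurable borel" "v' \<in> borel_measurable borel"
    using c c' by (auto intro: borel_measurable_continuous_onI)
  have b: "(0, 1) \<in> (Basis :: ('a \<times> real) set)" by (auto simp: Basis_prod_def)
  have \<phi>t: "partial_deriv (0, 1) \<phi> \<in> test_fun halfspace"
    using \<phi> b by (rule test_fun_partial_deriv)
  obtain \<delta> T where \<delta>T: "\<And>x t. t \<notin> {\<delta>..T} \<Longrightarrow> \<phi> (x, t) = 0"
    using test_fun_halfspace_bounds[OF \<phi>] by metis
  obtain \<delta>' T' where \<delta>T': "\<And>x t. t \<notin> {\<delta>'..T'} \<Longrightarrow> partial_deriv (0, 1) \<phi> (x, t) = 0"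
    using test_fun_halfspace_bounds[OF \<phi>t] by metis
  have "(\<integral>t. v t * partial_deriv (0, 1) \<phi> (x, t) \<partial>lborel) = - (\<integral>t. v' t * \<phi> (x, t) \<partial>lborel)" for x
  proof -
    have D\<phi>: "((\<lambda>t. \<phi> (x, t)) has_real_derivative partial_deriv (0, 1) \<phi> (x, t)) (at t)" for t
      using DERIV_line_Basis[OF smooth_fun_differentiable[OF test_fun_smooth[OF \<phi>]] b, of "(x, 0)" t UNIV] by simp
    have cx: "continuous_on UNIV (\<lambda>t. \<phi> (x, t))" "continuous_on UNIV (\<lambda>t. partial_deriv (0, 1) \<phi> (x, t))"
      by (auto intro!: continuous_on_compose2[OF test_fun_continuous[OF \<phi>]]
          continuous_on_compose2[OF test_fun_continuous[OF \<phi>t]] continuous_intros)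
    have ci: "integrable lborel (\<lambda>t. w t * f t)"
      if "continuous_on UNIV w" "continuous_on UNIV f" "\<And>t. t \<notin> {p..q} \<Longrightarrow> f t = 0" for w f :: "real \<Rightarrow> real" and p q
    proof -
      have "bounded_kernel (\<lambda>t. w t * f t)"
        by (rule bounded_kernel_continuous[of _ p q]) (use that in \<open>auto intro!: continuous_on_mult\<close>)
      then show ?thesis by (simp add: bounded_kernel_def)
    qed
    have i: "integrable lborel (\<lambda>t. v t * \<phi> (x, t))" "integrable lborel (\<lambda>t. v' t * \<phi> (x, t))"
      by (rule ci[OF c cx(1) \<delta>T] ci[OF c' cx(1) \<delta>T]; assumption)+
    have i': "integrable lborel (\<lambda>t. v t * partial_deriv (0, 1) \<phi> (x, t))"
      by (rule ci[OF c cx(2) \<delta>T'])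
    have "(\<integral>t. v' t * \<phi> (x, t) + v t * partial_deriv (0, 1) \<phi> (x, t) \<partial>lborel) = 0"
    proof (rule integral_directional_derivative_eq_0[where g = "\<lambda>t. v t * \<phi> (x, t)" and b = 1])
      show "integrable lborel (\<lambda>t. v t * \<phi> (x, t))" by (rule i)
      show "integrable lborel (\<lambda>t. v' t * \<phi> (x, t) + v t * partial_deriv (0, 1) \<phi> (x, t))" using i i' by auto
      show "((\<lambda>s. v (t + s *\<^sub>R 1) * \<phi> (x, t + s *\<^sub>R 1)) has_real_derivative
          v' (t + s *\<^sub>R 1) * \<phi> (x, t + s *\<^sub>R 1) + v (t + s *\<^sub>R 1) * partial_deriv (0, 1) \<phi> (x, t + s *\<^sub>R 1)) (at s)" for t s
      proof -
        have "((\<lambda>y. v y * \<phi> (x, y)) has_real_derivative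
          v' (s + t) * \<phi> (x, s + t) + v (s + t) * partial_deriv (0, 1) \<phi> (x, s + t)) (at (s + t))"
          using DERIV_mult[OF D D\<phi>, of "s + t"] by (simp add: mult.commute add.commute)
        then show ?thesis by (simp add: DERIV_shift add.commute)
      qed
      show "continuous_on UNIV (\<lambda>s. v' (t + s *\<^sub>R 1) * \<phi> (x, t + s *\<^sub>R 1) + v (t + s *\<^sub>R 1) * partial_deriv (0, 1) \<phi> (x, t + s *\<^sub>R 1))" for t
        by (intro continuous_on_add continuous_on_mult continuous_on_compose2[OF c] continuous_on_compose2[OF c']
            continuous_on_compose2[OF cx(1)] continuous_on_compose2[OF cx(2)]) (auto intro!: continuous_intros)
    qed
    then show ?thesis using i i' by simp
  qed
  then have "(\<integral>x. u x * (\<integral>t. v t * partial_deriv (0, 1) \<phi> (x, t) \<partial>lborel) \<partial>lborel)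
      = - (\<integral>x. u x * (\<integral>t. v' t * \<phi> (x, t) \<partial>lborel) \<partial>lborel)" by simp
  then show "(\<integral>p. u (fst p) * v (snd p) * partial_deriv (0, 1) \<phi> p \<partial>lborel)
      = - (\<integral>p. u (fst p) * v' (snd p) * \<phi> p \<partial>lborel)"
    by (simp only: tensor_test_fun(2)[OF u m(1) v \<phi>t] tensor_test_fun(2)[OF u m(2) v' \<phi>])
qed

lemma nn_integral_tensor:
  fixes f :: "'a::euclidean_space \<Rightarrow> ennreal" and h :: "real \<Rightarrow> ennreal"
  assumes [measurable]: "f \<in> borel_measurable borel" "h \<in> borel_measurable borel"
  shows "(\<integral>\<^sup>+p. f (fst p) * h (snd p) \<partial>lborel) = (\<integral>\<^sup>+x. f x \<partial>lborel) * (\<integral>\<^sup>+t. h t \<partial>lborel)"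
proof -
  have "(\<integral>\<^sup>+p. f (fst p) * h (snd p) \<partial>lborel) = (\<integral>\<^sup>+p. f (fst p) * h (snd p) \<partial>(lborel \<Otimes>\<^sub>M lborel))"
    by (simp only: lborel_prod)
  also have "\<dots> = (\<integral>\<^sup>+x. (\<integral>\<^sup>+t. f x * h t \<partial>lborel) \<partial>lborel)"
    by (subst lborel.nn_integral_fst[symmetric]) auto
  also have "\<dots> = (\<integral>\<^sup>+x. f x * (\<integral>\<^sup>+t. h t \<partial>lborel) \<partial>lborel)"
    by (simp add: nn_integral_cmult)
  also have "\<dots> = (\<integral>\<^sup>+x. f x \<partial>lborel) * (\<integral>\<^sup>+t. h t \<partial>lborel)"
    by (rule nn_integral_multc) simp
  finally show ?thesis .
qed

lemma nn_integral_powr_Icc: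
  assumes "-1 < a" "0 \<le> c"
  shows "(\<integral>\<^sup>+t. ennreal (t powr a) * indicator {0..c} t \<partial>lborel) = ennreal (c powr (a + 1) / (a + 1))"
  by (rule nn_integral_has_integral_lebesgue'[OF _ has_integral_powr_from_0]) (use assms in auto)

section \<open>Extension to the half-space\<close>

text \<open>On a product of a function of x and a function of t a multi-index splits: directions (b,
  0) act on the first factor, and the direction (0, 1) acts on the second.\<close>

definition x_part :: "('a::euclidean_space \<times> real) multiset \<Rightarrow> 'a multiset" where
  "x_part \<alpha> = image_mset fst (filter_mset (\<lambda>c. c \<noteq> (0, 1)) \<alpha>)"

definition t_part :: "('a::euclidean_space \<times> real) multiset \<Rightarrow> nat" where
  "t_part \<alpha> = count \<alpha> (0, 1)"

lemma x_part_t_part_simps: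
  "x_part {#} = {#}" "t_part {#} = 0"
  "x_part (add_mset (0, 1) \<alpha>) = x_part \<alpha>" "t_part (add_mset (0, 1) \<alpha>) = Suc (t_part \<alpha>)"
  "b \<in> Basis \<Longrightarrow> x_part (add_mset (b, 0) \<alpha>) = add_mset b (x_part \<alpha>)"
  "t_part (add_mset (b, 0) \<alpha>) = t_part \<alpha>"
  "x_part (replicate_mset q (0, 1)) = {#}" "t_part (replicate_mset q (0, 1)) = q"
  by (auto simp: x_part_def t_part_def filter_mset_eq_conv)

lemma size_x_part_t_part: "size \<alpha> = size (x_part \<alpha>) + t_part \<alpha>"
  by (induction \<alpha>) (auto simp: x_part_def t_part_def)

lemma x_part_Basis: "set_mset \<alpha> \<subseteq> Basis \<Longrightarrow> set_mset (x_part \<alpha>) \<subseteq> Basis"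
  by (auto simp: x_part_def Basis_prod_def)

lemma Basis_prod_cases:
  assumes "c \<in> (Basis :: ('a::euclidean_space \<times> real) set)"
  obtains b where "c = (b, 0)" "b \<in> Basis" | "c = (0, 1)"
  using assms by (auto simp: Basis_prod_def)

text \<open>On a compact subset of the half-space the height stays between two positive bounds. The
  weight is monotone in t, so it is at least its value at one of the two, whichever sign a
  has.\<close>

lemma locally_integrable_weighted:
  fixes G :: "'a::euclidean_space \<times> real \<Rightarrow> real"
  assumes [measurable]: "G \<in> borel_measurable borel"
    and fin: "(\<integral>\<^sup>+p. indicator halfspace p * ennreal (snd p powr a * \<bar>G p\<bar>) \<partial>lborel) < \<infinity>"
  shows "locally_integrable halfspace G"
  unfolding locally_integrable_def
proof (intro allI impI)
  fix K :: "('a \<times> real) set" assume K: "compact K \<and> K \<subseteq> halfspace"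
  then have [measurable]: "K \<in> sets borel" by (auto intro: borel_compact)
  have c: "compact (insert 1 (snd ` K))"
    using K by (intro compact_insert compact_continuous_image) (auto intro!: continuous_intros)
  obtain \<delta> where \<delta>: "\<delta> \<in> insert 1 (snd ` K)" "\<And>t. t \<in> insert 1 (snd ` K) \<Longrightarrow> \<delta> \<le> t"
    using compact_attains_inf[OF c] by auto
  obtain T where T: "\<And>t. t \<in> insert 1 (snd ` K) \<Longrightarrow> t \<le> T"
    using compact_attains_sup[OF c] by auto
  have "0 < \<delta>" using \<delta>(1) K by (auto simp: halfspace_def)
  have "0 < T" using T[of 1] by simp
  define w where "w = min (\<delta> powr a) (T powr a)"
  have w: "0 < w" using \<open>0 < \<delta>\<close> \<open>0 < T\<close> by (simp add: w_def)
  have wt: "w \<le> snd p powr a" if "p \<in> K" for p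
  proof -
    have t: "\<delta> \<le> snd p" "snd p \<le> T" using that \<delta>(2) T by auto
    show ?thesis
    proof (cases "0 \<le> a")
      case True
      then have "\<delta> powr a \<le> snd p powr a" using t \<open>0 < \<delta>\<close> by (intro powr_mono2) auto
      then show ?thesis by (simp add: w_def)
    next
      case False
      then have "T powr a \<le> snd p powr a" using t \<open>0 < \<delta>\<close> by (intro powr_mono2') auto
      then show ?thesis by (simp add: w_def)
    qed
  qed
  have "(\<integral>\<^sup>+p. ennreal (norm (indicator K p * G p)) \<partial>lborel)
      \<le> (\<integral>\<^sup>+p. ennreal (1 / w) * (indicator halfspace p * ennreal (snd p powr a * \<bar>G p\<bar>)) \<partial>lborel)"
  proof (intro nn_integral_mono)
    fix p :: "'a \<times> real"
    show "ennreal (norm (indicator K p * G p)) \<le> ennreal (1 / w) * (indicator halfspace p * ennreal (snd p powr a * \<bar>G p\<bar>))"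
    proof (cases "p \<in> K")
      case True
      then have "p \<in> halfspace" using K by auto
      have "w * \<bar>G p\<bar> \<le> snd p powr a * \<bar>G p\<bar>" using wt[OF True] by (intro mult_right_mono) auto
      then have "\<bar>G p\<bar> \<le> 1 / w * (snd p powr a * \<bar>G p\<bar>)" using w by (simp add: field_simps)
      then have "ennreal \<bar>G p\<bar> \<le> ennreal (1 / w * (snd p powr a * \<bar>G p\<bar>))" by (rule ennreal_leI)
      also have "\<dots> = ennreal (1 / w) * ennreal (snd p powr a * \<bar>G p\<bar>)" using w by (intro ennreal_mult) auto
      finally show ?thesis using True \<open>p \<in> halfspace\<close> by simp
    qed simp
  qed
  also have "\<dots> = ennreal (1 / w) * (\<integral>\<^sup>+p. indicator halfspace p * ennreal (snd p powr a * \<bar>G p\<bar>) \<partial>lborel)"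
  proof (rule nn_integral_cmult)
    have [measurable]: "(snd :: 'a \<times> real \<Rightarrow> real) \<in> borel_measurable borel"
      by (intro borel_measurable_continuous_onI continuous_intros)
    show "(\<lambda>p. indicator halfspace p * ennreal (snd p powr a * \<bar>G p\<bar>)) \<in> borel_measurable lborel"
      by measurable
  qed
  also have "\<dots> < \<infinity>" using fin by (simp add: ennreal_mult_less_top)
  finally have "integrable lborel (\<lambda>p. indicator K p * G p)" by (intro integrableI_bounded) auto
  then show "G absolutely_integrable_on K"
    unfolding set_integrable_def by (simp add: integrable_completion)
qed

text \<open>All orders q <= m - a are recorded, with limit 0 for q other than j, so that extensions
  for different j can be added without disturbing each other's traces.\<close>

definition trace_extension :: "nat \<Rightarrow> real \<Rightarrow> nat \<Rightarrow> ('a::euclidean_space \<Rightarrow> real) \<Rightarrow> ennreal \<Rightarrow>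
    (('a \<times> real) multiset \<Rightarrow> 'a \<times> real \<Rightarrow> real) \<Rightarrow> bool" where
  "trace_extension m a j f K G \<longleftrightarrow> (\<forall>\<alpha>. G \<alpha> \<in> borel_measurable borel) \<and>
     (\<forall>\<alpha>. \<forall>c\<in>Basis. size \<alpha> \<le> m \<longrightarrow> weak_partial halfspace c (G \<alpha>) (G (add_mset c \<alpha>))) \<and>
     (\<forall>\<alpha>. size \<alpha> \<le> m + 1 \<longrightarrow>
       (\<integral>\<^sup>+p. indicator halfspace p * ennreal (snd p powr a * \<bar>G \<alpha> p\<bar>) \<partial>lborel) \<le> K) \<and>
     (\<forall>q. real q \<le> real m - a \<longrightarrow>
       (\<forall>t>0. integrable lborel (\<lambda>x. G (replicate_mset q (0, 1)) (x, t))) \<and>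
       ((\<lambda>t. L1_norm (\<lambda>x. G (replicate_mset q (0, 1)) (x, t) - (if q = j then f x else 0))) \<longlongrightarrow> 0) (at_right 0))"

text \<open>Only the bound B enters and nothing about how the pieces were found, so linear pieces
  for s > 0 and nonlinear ones for s = 0 are treated alike.\<close>

lemma scale_extension:
  fixes m j :: nat and a s :: real
  assumes a: "-1 < a" and s: "s = real m - a - real j" "0 \<le> s"
  shows "\<exists>C>0. \<forall>(f :: 'a::euclidean_space \<Rightarrow> real) B.
    integrable lborel f \<longrightarrow> scale_decomposition (m + 1) s f B \<longrightarrow> B < \<infinity> \<longrightarrow>
      (\<exists>G. trace_extension m a j f (ennreal C * B) G)"
proof (rule cutoff_family[where j = j and k = m])
  fix \<theta> :: "nat \<Rightarrow> real \<Rightarrow> real" and C0 :: real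
  assume C0: "0 < C0"
    and \<theta>m [measurable]: "\<And>q. \<theta> q \<in> borel_measurable borel"
    and \<theta>D: "\<And>q t. q \<le> m \<Longrightarrow> (\<theta> q has_real_derivative \<theta> (Suc q) t) (at t)"
    and \<theta>c: "\<And>q. q \<le> Suc m \<Longrightarrow> continuous_on UNIV (\<theta> q)"
    and \<theta>b: "\<And>q t. q \<le> Suc m \<Longrightarrow> 0 \<le> t \<Longrightarrow> \<bar>\<theta> q t\<bar> \<le> C0"
    and \<theta>0: "\<And>q t. 1 \<le> t \<Longrightarrow> \<theta> q t = 0"
    and \<theta>l: "\<And>q. q \<le> Suc m \<Longrightarrow> (\<theta> q \<longlongrightarrow> (if q = j then 1 else 0)) (at_right 0)"
  \<comment> \<open>C0 bounds the cutoff, and 1 / (a + 1) comes from integrating t powr a over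
    [0, r]; here a > -1 is used.\<close>
  define C where "C = C0 / (a + 1)"
  have C: "0 < C" using C0 a by (simp add: C_def)
  show ?thesis
  proof (intro exI[of _ C] conjI C allI impI)
    fix f :: "'a \<Rightarrow> real" and B :: ennreal
    assume f: "integrable lborel f" and dec: "scale_decomposition (m + 1) s f B" and Bfin: "B < \<infinity>"
    obtain g :: "nat \<Rightarrow> 'a multiset \<Rightarrow> 'a \<Rightarrow> real" and r :: "nat \<Rightarrow> real" where
      D: "\<forall>i. 0 < r i \<and> r i \<le> 1" "r \<longlonglongrightarrow> 0" "\<forall>i \<beta>. integrable lborel (g i \<beta>)"
        "\<forall>i \<beta>. \<forall>b\<in>Basis. weak_partial UNIV b (g i \<beta>) (g i (add_mset b \<beta>))"
        "\<forall>\<beta>. set_mset \<beta> \<subseteq> Basis \<and> size \<beta> \<le> m + 1 \<longrightarrow>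
          (\<Sum>i. ennreal (r i powr (real (size \<beta>) - s)) * L1_norm (g i \<beta>)) \<le> B"
      and conv: "(\<lambda>N. L1_norm (\<lambda>x. f x - (\<Sum>i<N. g i {#} x))) \<longlonglongrightarrow> 0"
      using dec unfolding scale_decomposition_def by (elim exE conjE) (rule that)
    have r: "\<And>i. 0 < r i" "\<And>i. r i \<le> 1" "r \<longlonglongrightarrow> 0" using D(1,2) by auto
    have gi: "integrable lborel (g i \<beta>)" for i \<beta> using D(3) by blast
    have gw: "weak_partial UNIV b (g i \<beta>) (g i (add_mset b \<beta>))" if "b \<in> Basis" for i \<beta> b
      using D(4) that by blast
    have bound: "(\<Sum>i. ennreal (r i powr (real (size \<beta>) - s)) * L1_norm (g i \<beta>)) \<le> B"
      if "set_mset \<beta> \<subseteq> Basis" "size \<beta> \<le> m + 1" for \<beta> using D(5) that by blast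
    have gm [measurable]: "g i \<beta> \<in> borel_measurable borel" for i \<beta> using gi[of i \<beta>] by auto
    have fm [measurable]: "f \<in> borel_measurable borel" using f by auto
    \<comment> \<open>The q-th derivative of r ^ j * \<theta> (t / r), for q up to m + 1.\<close>
    define v where "v i q t = r i powr (real j - real q) * \<theta> q (t / r i)" for i q t
    have vm [measurable]: "v i q \<in> borel_measurable borel" for i q unfolding v_def[abs_def] by measurable
    have vb: "\<bar>v i q t\<bar> \<le> C0 * r i powr (real j - real q)" if "q \<le> Suc m" "0 \<le> t" for i q t
      using \<theta>b[OF that(1), of "t / r i"] that(2) r(1)[of i]
      by (simp add: v_def abs_mult mult.commute mult_right_mono)
    have v0: "v i q t = 0" if "r i \<le> t" for i q t
      using that r(1)[of i] \<theta>0[of "t / r i" q] by (simp add: v_def)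
    have vc: "continuous_on UNIV (v i q)" if "q \<le> Suc m" for i q
      unfolding v_def[abs_def]
      by (intro continuous_intros continuous_on_compose2[OF \<theta>c[OF that]]) (use r(1)[of i] in auto)
    have vD: "(v i q has_real_derivative v i (Suc q) t) (at t)" if "q \<le> m" for i q t
    proof -
      have "((\<lambda>t. t / r i) has_real_derivative 1 / r i) (at t)"
        using DERIV_cdivide[OF DERIV_ident] .
      from DERIV_cmult[OF DERIV_chain2[OF \<theta>D[OF that] this], of "r i powr (real j - real q)"]
      have "(v i q has_real_derivative r i powr (real j - real q) * (\<theta> (Suc q) (t / r i) * (1 / r i))) (at t)"
        by (simp add: v_def[abs_def])
      also have "r i powr (real j - real q) * (\<theta> (Suc q) (t / r i) * (1 / r i)) = v i (Suc q) t"
      proof -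
        have "r i powr (real j - real (Suc q)) = r i powr (real j - real q - 1)"
          by (rule arg_cong) simp
        also have "\<dots> = r i powr (real j - real q) * (1 / r i)"
          using r(1)[of i] by (simp add: powr_diff)
        finally show ?thesis by (simp add: v_def)
      qed
      finally show ?thesis .
    qed
    define T where "T i \<alpha> p = g i (x_part \<alpha>) (fst p) * v i (t_part \<alpha>) (snd p)" for i \<alpha> and p :: "'a \<times> real"
    \<comment> \<open>For t <= 0 the cutoffs need not vanish and the series may diverge. For indices
      outside the basis the decomposition gives no bound. Both cases are set to 0.\<close>
    define G where "G \<alpha> p = (if set_mset \<alpha> \<subseteq> Basis \<and> 0 < snd p then \<Sum>i. T i \<alpha> p else 0)" for \<alpha> and p :: "'a \<times> real"
    have [measurable]: "(fst :: 'a \<times> real \<Rightarrow> 'a) \<in> borel_measurable borel" "(snd :: 'a \<times> real \<Rightarrow> real) \<in> borel_measurable borel"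
      by (intro borel_measurable_continuous_onI continuous_intros)+
    have Tm [measurable]: "T i \<alpha> \<in> borel_measurable borel" for i \<alpha>
      unfolding T_def[abs_def] by measurable
    have Gm: "G \<alpha> \<in> borel_measurable borel" for \<alpha>
      unfolding G_def[abs_def] by measurable
    \<comment> \<open>One N serves all indices and all points above height \<delta>, because r i <
      \<delta> for large i. Hence G and its derivatives become sums with the same number of terms on
      the support of a test function.\<close>
    have fin: "\<exists>N. \<forall>n\<ge>N. \<forall>\<alpha> p. set_mset \<alpha> \<subseteq> Basis \<longrightarrow> \<delta> \<le> snd p \<longrightarrow> G \<alpha> p = (\<Sum>i<n. T i \<alpha> p)"
      if "0 < \<delta>" for \<delta>
    proof -
      have "eventually (\<lambda>i. r i < \<delta>) sequentially" using r(3) that by (rule order_tendstoD(2))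
      then obtain N where N: "\<And>i. N \<le> i \<Longrightarrow> r i < \<delta>" by (auto simp: eventually_sequentially)
      have "G \<alpha> p = (\<Sum>i<n. T i \<alpha> p)" if "N \<le> n" "set_mset \<alpha> \<subseteq> Basis" "\<delta> \<le> snd p" for n \<alpha> p
      proof -
        have "(\<Sum>i. T i \<alpha> p) = (\<Sum>i<n. T i \<alpha> p)"
        proof (rule suminf_finite)
          fix i assume "i \<notin> {..<n}"
          then have "r i \<le> snd p" using N[of i] that by auto
          then show "T i \<alpha> p = 0" by (simp add: T_def v0)
        qed simp
        then show ?thesis using that \<open>0 < \<delta>\<close> by (simp add: G_def)
      qed
      then show ?thesis by blast
    qed
    have wp: "weak_partial halfspace c (G \<alpha>) (G (add_mset c \<alpha>))" if c: "c \<in> Basis" and \<alpha>: "size \<alpha> \<le> m" for c \<alpha>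
    proof (cases "set_mset \<alpha> \<subseteq> Basis")
      case False
      then show ?thesis by (simp add: G_def weak_partial_def)
    next
      case True
      have t: "t_part \<alpha> \<le> m" using \<alpha> size_x_part_t_part[of \<alpha>] by simp
      have Tw: "weak_partial halfspace c (T i \<alpha>) (T i (add_mset c \<alpha>))" for i
        using c
      proof (cases rule: Basis_prod_cases)
        case (1 b)
        then show ?thesis
          unfolding T_def[abs_def] using t vb[of "t_part \<alpha>" _ i]
          by (auto simp: x_part_t_part_simps
              intro!: tensor_weak_partial_x[where B = "C0 * r i powr (real j - real (t_part \<alpha>))"] gi gw vm)
      next
        case 2
        show ?thesis
          unfolding T_def[abs_def] 2 x_part_t_part_simps
          by (rule tensor_weak_partial_t[OF gi vb vb vc vD]) (use t in auto)
      qed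
      show ?thesis
        unfolding weak_partial_def
      proof
        fix \<phi> :: "'a \<times> real \<Rightarrow> real" assume \<phi>: "\<phi> \<in> test_fun halfspace"
        have \<phi>c: "partial_deriv c \<phi> \<in> test_fun halfspace" using \<phi> c by (rule test_fun_partial_deriv)
        obtain \<delta>1 where \<delta>1: "0 < \<delta>1" "\<And>x t. t < \<delta>1 \<Longrightarrow> \<phi> (x, t) = 0"
          by (rule test_fun_halfspace_bounds[OF \<phi>]) auto
        obtain \<delta>2 where \<delta>2: "0 < \<delta>2" "\<And>x t. t < \<delta>2 \<Longrightarrow> partial_deriv c \<phi> (x, t) = 0"
          by (rule test_fun_halfspace_bounds[OF \<phi>c]) auto
        obtain n where n: "\<And>\<alpha> p. set_mset \<alpha> \<subseteq> Basis \<Longrightarrow> min \<delta>1 \<delta>2 \<le> snd p \<Longrightarrow> G \<alpha> p = (\<Sum>i<n. T i \<alpha> p)"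
          using fin[of "min \<delta>1 \<delta>2"] \<delta>1(1) \<delta>2(1) by auto
        have int: "integrable lborel (\<lambda>p. T i \<alpha>' p * \<psi> p)" if "t_part \<alpha>' \<le> Suc m" "\<psi> \<in> test_fun halfspace" for i \<alpha>' \<psi>
          unfolding T_def by (rule tensor_test_fun(1)[OF gi vm vb]) (use that in auto)
        have e1: "(\<integral>p. G \<alpha>' p * \<psi> p \<partial>lborel) = (\<Sum>i<n. \<integral>p. T i \<alpha>' p * \<psi> p \<partial>lborel)"
          if \<alpha>': "set_mset \<alpha>' \<subseteq> Basis" "t_part \<alpha>' \<le> Suc m" and \<psi>: "\<psi> \<in> test_fun halfspace"
            "\<And>x t. t < min \<delta>1 \<delta>2 \<Longrightarrow> \<psi> (x, t) = 0" for \<alpha>' \<psi>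
        proof -
          have "G \<alpha>' p * \<psi> p = (\<Sum>i<n. T i \<alpha>' p * \<psi> p)" for p
            using n[OF \<alpha>'(1), of p] \<psi>(2)[of "snd p" "fst p"]
            by (cases "min \<delta>1 \<delta>2 \<le> snd p") (auto simp: sum_distrib_right not_le)
          then show ?thesis using int[OF \<alpha>'(2) \<psi>(1)] by simp
        qed
        have ca: "set_mset (add_mset c \<alpha>) \<subseteq> Basis" "t_part (add_mset c \<alpha>) \<le> Suc m"
          using True c t by (auto simp: t_part_def)
        have "(\<integral>p. G \<alpha> p * partial_deriv c \<phi> p \<partial>lborel) = (\<Sum>i<n. \<integral>p. T i \<alpha> p * partial_deriv c \<phi> p \<partial>lborel)"
          by (rule e1) (use True t \<phi>c \<delta>2 in auto)
        also have "\<dots> = (\<Sum>i<n. - (\<integral>p. T i (add_mset c \<alpha>) p * \<phi> p \<partial>lborel))"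
          using Tw \<phi> by (intro sum.cong refl) (auto simp: weak_partial_def)
        also have "\<dots> = - (\<integral>p. G (add_mset c \<alpha>) p * \<phi> p \<partial>lborel)"
          by (subst e1[OF ca \<phi>]) (use \<delta>1 in \<open>auto simp: sum_negf\<close>)
        finally show "(\<integral>p. G \<alpha> p * partial_deriv c \<phi> p \<partial>lborel) = - (\<integral>p. G (add_mset c \<alpha>) p * \<phi> p \<partial>lborel)" .
      qed
    qed
    have norm: "(\<integral>\<^sup>+p. indicator halfspace p * ennreal (snd p powr a * \<bar>G \<alpha> p\<bar>) \<partial>lborel) \<le> ennreal C * B"
      if sz: "size \<alpha> \<le> m + 1" for \<alpha>
    proof (cases "set_mset \<alpha> \<subseteq> Basis")
      case False then show ?thesis by (simp add: G_def)
    next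
      case True
      let ?\<beta> = "x_part \<alpha>" and ?q = "t_part \<alpha>"
      have q: "?q \<le> Suc m" "size ?\<beta> \<le> m + 1" "real (size ?\<beta>) + real ?q \<le> real m + 1"
        using sz size_x_part_t_part[of \<alpha>] by auto
      let ?h = "\<lambda>i t. ennreal (C0 * r i powr (real j - real ?q)) * (ennreal (t powr a) * indicator {0..r i} t)"
      have pt: "indicator halfspace p * ennreal (snd p powr a * \<bar>G \<alpha> p\<bar>) \<le> (\<Sum>i. ennreal \<bar>g i ?\<beta> (fst p)\<bar> * ?h i (snd p))" for p
      proof (cases "p \<in> halfspace")
        case False then show ?thesis by simp
      next
        case p: True
        then have t: "0 < snd p" by (auto simp: halfspace_def)
        obtain n where n: "G \<alpha> p = (\<Sum>i<n. T i \<alpha> p)" using fin[OF t] True by blast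
        have Ti: "snd p powr a * \<bar>T i \<alpha> p\<bar> \<le> \<bar>g i ?\<beta> (fst p)\<bar> * (C0 * r i powr (real j - real ?q) * (snd p powr a * indicator {0..r i} (snd p)))" for i
        proof (cases "snd p \<le> r i")
          case True
          have "\<bar>T i \<alpha> p\<bar> \<le> \<bar>g i ?\<beta> (fst p)\<bar> * (C0 * r i powr (real j - real ?q))"
            unfolding T_def abs_mult using t by (intro mult_left_mono vb q) auto
          then have "snd p powr a * \<bar>T i \<alpha> p\<bar> \<le> snd p powr a * (\<bar>g i ?\<beta> (fst p)\<bar> * (C0 * r i powr (real j - real ?q)))"
            by (rule mult_left_mono) simp
          then show ?thesis using True t by (simp add: mult_ac)
        next
          case False
          then show ?thesis by (simp add: T_def v0)
        qed
        have "snd p powr a * \<bar>G \<alpha> p\<bar> \<le> (\<Sum>i<n. snd p powr a * \<bar>T i \<alpha> p\<bar>)"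
          unfolding n sum_distrib_left[symmetric] by (intro mult_left_mono sum_abs) simp
        also have "\<dots> \<le> (\<Sum>i<n. \<bar>g i ?\<beta> (fst p)\<bar> * (C0 * r i powr (real j - real ?q) * (snd p powr a * indicator {0..r i} (snd p))))"
          by (intro sum_mono Ti)
        finally have "ennreal (snd p powr a * \<bar>G \<alpha> p\<bar>)
            \<le> ennreal (\<Sum>i<n. \<bar>g i ?\<beta> (fst p)\<bar> * (C0 * r i powr (real j - real ?q) * (snd p powr a * indicator {0..r i} (snd p))))"
          by (rule ennreal_leI)
        also have "\<dots> = (\<Sum>i<n. ennreal (\<bar>g i ?\<beta> (fst p)\<bar> * (C0 * r i powr (real j - real ?q) * (snd p powr a * indicator {0..r i} (snd p)))))"
          using C0 by (intro sum_ennreal[symmetric]) auto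
        also have "\<dots> = (\<Sum>i<n. ennreal \<bar>g i ?\<beta> (fst p)\<bar> * ?h i (snd p))"
        proof (intro sum.cong refl)
          fix i
          have "ennreal (\<bar>g i ?\<beta> (fst p)\<bar> * (C0 * r i powr (real j - real ?q) * (snd p powr a * indicator {0..r i} (snd p))))
            = ennreal \<bar>g i ?\<beta> (fst p)\<bar> * (ennreal (C0 * r i powr (real j - real ?q)) * (ennreal (snd p powr a) * ennreal (indicator {0..r i} (snd p))))"
            using C0 by (simp add: ennreal_mult)
          then show "ennreal (\<bar>g i ?\<beta> (fst p)\<bar> * (C0 * r i powr (real j - real ?q) * (snd p powr a * indicator {0..r i} (snd p))))
            = ennreal \<bar>g i ?\<beta> (fst p)\<bar> * ?h i (snd p)" by (simp add: ennreal_indicator)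
        qed
        also have "\<dots> \<le> (\<Sum>i. ennreal \<bar>g i ?\<beta> (fst p)\<bar> * ?h i (snd p))"
          by (intro sum_le_suminf summableI) auto
        finally show ?thesis using p by simp
      qed
      have "(\<integral>\<^sup>+p. indicator halfspace p * ennreal (snd p powr a * \<bar>G \<alpha> p\<bar>) \<partial>lborel)
          \<le> (\<integral>\<^sup>+p. (\<Sum>i. ennreal \<bar>g i ?\<beta> (fst p)\<bar> * ?h i (snd p)) \<partial>lborel)"
        by (intro nn_integral_mono pt)
      also have "\<dots> = (\<Sum>i. \<integral>\<^sup>+p. ennreal \<bar>g i ?\<beta> (fst p)\<bar> * ?h i (snd p) \<partial>lborel)"
        by (rule nn_integral_suminf) measurable
      also have "\<dots> \<le> (\<Sum>i. ennreal C * (ennreal (r i powr (real (size ?\<beta>) - s)) * L1_norm (g i ?\<beta>)))"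
      proof (intro suminf_le summableI)
        fix i
        have "(\<integral>\<^sup>+p. ennreal \<bar>g i ?\<beta> (fst p)\<bar> * ?h i (snd p) \<partial>lborel) = L1_norm (g i ?\<beta>) * (\<integral>\<^sup>+t. ?h i t \<partial>lborel)"
          unfolding L1_norm_lborel by (rule nn_integral_tensor) measurable
        moreover have "(\<integral>\<^sup>+t. ?h i t \<partial>lborel) \<le> ennreal C * ennreal (r i powr (real (size ?\<beta>) - s))"
        proof -
          have "(\<integral>\<^sup>+t. ?h i t \<partial>lborel) = ennreal (C0 * r i powr (real j - real ?q)) * ennreal (r i powr (a + 1) / (a + 1))"
            using r(1)[of i] by (subst nn_integral_cmult) (auto simp: nn_integral_powr_Icc[OF a])
          also have "\<dots> = ennreal (C0 * r i powr (real j - real ?q) * (r i powr (a + 1) / (a + 1)))"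
            using C0 a by (intro ennreal_mult[symmetric]) auto
          also have "\<dots> \<le> ennreal (C * r i powr (real (size ?\<beta>) - s))"
          proof (rule ennreal_leI)
            have "C0 * r i powr (real j - real ?q) * (r i powr (a + 1) / (a + 1)) = C * r i powr (real j - real ?q + (a + 1))"
              by (simp add: C_def powr_add)
            \<comment> \<open>As s = m - a - j, the exponents differ by m + 1 - |\<beta>| - q, which
              is nonnegative, and r i <= 1.\<close>
            also have "\<dots> \<le> C * r i powr (real (size ?\<beta>) - s)"
              using C r(1,2)[of i] q(3) s(1) by (intro mult_left_mono powr_mono') auto
            finally show "C0 * r i powr (real j - real ?q) * (r i powr (a + 1) / (a + 1)) \<le> C * r i powr (real (size ?\<beta>) - s)" .
          qed
          also have "\<dots> = ennreal C * ennreal (r i powr (real (size ?\<beta>) - s))"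
            using C by (intro ennreal_mult) auto
          finally show ?thesis .
        qed
        ultimately have "(\<integral>\<^sup>+p. ennreal \<bar>g i ?\<beta> (fst p)\<bar> * ?h i (snd p) \<partial>lborel)
            \<le> L1_norm (g i ?\<beta>) * (ennreal C * ennreal (r i powr (real (size ?\<beta>) - s)))"
          by (simp only: mult_left_mono zero_le)
        then show "(\<integral>\<^sup>+p. ennreal \<bar>g i ?\<beta> (fst p)\<bar> * ?h i (snd p) \<partial>lborel)
            \<le> ennreal C * (ennreal (r i powr (real (size ?\<beta>) - s)) * L1_norm (g i ?\<beta>))"
          by (simp only: mult_ac)
      qed
      also have "\<dots> = ennreal C * (\<Sum>i. ennreal (r i powr (real (size ?\<beta>) - s)) * L1_norm (g i ?\<beta>))"
        by simp
      also have "\<dots> \<le> ennreal C * B"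
        by (intro mult_left_mono bound x_part_Basis True q) simp
      finally show ?thesis .
    qed
    have trace: "(\<forall>t>0. integrable lborel (\<lambda>x. G (replicate_mset q (0, 1)) (x, t))) \<and>
        ((\<lambda>t. L1_norm (\<lambda>x. G (replicate_mset q (0, 1)) (x, t) - (if q = j then f x else 0))) \<longlongrightarrow> 0) (at_right 0)"
      if q: "real q \<le> real m - a" for q
    proof -
      have qm: "q \<le> Suc m" using q a by linarith
      have RB: "set_mset (replicate_mset q (0, 1)) \<subseteq> (Basis :: ('a \<times> real) set)"
        by (auto simp: Basis_prod_def)
      let ?d = "if q = j then 1 else 0 :: real"
      have T: "T i (replicate_mset q (0, 1)) (x, t) = v i q t * g i {#} x" for i x t
        by (simp add: T_def x_part_t_part_simps)
      \<comment> \<open>The deviation at height t of the coefficient of the i-th piece from its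
        coefficient in the wanted trace.\<close>
      define c where "c i t = v i q t - ?d" for i t
      define \<nu> where "\<nu> i = (\<integral>x. \<bar>g i {#} x\<bar> \<partial>lborel)" for i
      have \<nu>: "L1_norm (g i {#}) = ennreal (\<nu> i)" "0 \<le> \<nu> i" for i
        using L1_norm_eq_integral[OF gi] by (auto simp: \<nu>_def)
      have rs1: "1 \<le> r i powr - s" for i
        using powr_mono'[of "- s" 0 "r i"] r(1,2)[of i] s(2) by simp
      \<comment> \<open>From q <= m - a follows j - q >= -s: this is the place where the order of
        the traces is limited. The summand 1 is absorbed since r i powr -s >= 1.\<close>
      have cb: "\<bar>c i t\<bar> \<le> (C0 + 1) * r i powr - s" if "0 < t" for i t
      proof -
        have "\<bar>v i q t\<bar> \<le> C0 * r i powr (real j - real q)" using that qm by (intro vb) auto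
        also have "\<dots> \<le> C0 * r i powr - s"
          using C0 r(1,2)[of i] q s(1) by (intro mult_left_mono powr_mono') auto
        finally have "\<bar>c i t\<bar> \<le> C0 * r i powr - s + 1" by (auto simp: c_def)
        also have "\<dots> \<le> (C0 + 1) * r i powr - s" using rs1[of i] by (simp add: distrib_right)
        finally show ?thesis .
      qed
      have c0: "(c i \<longlongrightarrow> 0) (at_right 0)" for i
      proof -
        have "filterlim (\<lambda>t. t / r i) (at_right 0) (at_right 0)"
          using r(1)[of i] by (intro filterlim_at_withinI) (auto intro!: tendsto_eq_intros simp: eventually_at_filter)
        from filterlim_compose[OF \<theta>l[OF qm] this]
        have "((\<lambda>t. r i powr (real j - real q) * \<theta> q (t / r i) - ?d) \<longlongrightarrow> r i powr (real j - real q) * ?d - ?d) (at_right 0)"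
          by (intro tendsto_intros) auto
        then show ?thesis using r(1)[of i] by (auto simp: c_def[abs_def] v_def split: if_splits)
      qed
      define M where "M i = (C0 + 1) * r i powr - s * \<nu> i" for i
      have M: "summable M"
      proof -
        have "(\<Sum>i. ennreal (r i powr - s * \<nu> i)) \<le> B"
          using bound[of "{#}"] by (simp add: \<nu> ennreal_mult)
        then have "(\<Sum>i. ennreal (r i powr - s * \<nu> i)) \<noteq> top" using Bfin by auto
        then have "summable (\<lambda>i. r i powr - s * \<nu> i)" by (intro summable_suminf_not_top) (auto simp: \<nu>)
        from summable_mult[OF this, of "C0 + 1"] show ?thesis by (simp add: M_def[abs_def] mult.assoc)
      qed
      have cM: "\<bar>c i t\<bar> * \<nu> i \<le> M i" if "0 < t" for i t
        unfolding M_def using cb[OF that] \<nu> by (intro mult_right_mono) auto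
      \<comment> \<open>The majorant M does not depend on t and is summable by the bound for the
        empty index, so the limit may be taken term by term.\<close>
      have slim: "((\<lambda>t. \<Sum>i. \<bar>c i t\<bar> * \<nu> i) \<longlongrightarrow> (\<Sum>i. 0)) (at_right 0)"
      proof -
        have "eventually (\<lambda>(i, t). norm (\<bar>c i t\<bar> * \<nu> i) \<le> M i) (at_top \<times>\<^sub>F at_right 0)"
          unfolding eventually_prod_filter
          by (intro exI[of _ "\<lambda>_. True"] exI[of _ "\<lambda>t. 0 < t"])
            (use cM \<nu>(2) in \<open>auto simp: eventually_at_filter abs_mult\<close>)
        from tannerys_theorem[OF _ this M, of "\<lambda>_. 0"] show ?thesis
          using tendsto_mult_left_zero[OF tendsto_rabs_zero[OF c0]] by auto
      qed
      have le: "L1_norm (\<lambda>x. G (replicate_mset q (0, 1)) (x, t) - (if q = j then f x else 0)) \<le> ennreal (\<Sum>i. \<bar>c i t\<bar> * \<nu> i)"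
        if t: "0 < t" for t
      proof -
        have sm: "summable (\<lambda>i. \<bar>c i t\<bar> * \<nu> i)"
          by (rule summable_comparison_test[OF _ M]) (use cM[OF t] \<nu>(2) in \<open>auto simp: abs_mult\<close>)
        obtain N where N: "\<And>n x. N \<le> n \<Longrightarrow> G (replicate_mset q (0, 1)) (x, t) = (\<Sum>i<n. v i q t * g i {#} x)"
        proof -
          obtain N where "\<forall>n\<ge>N. \<forall>\<alpha> p. set_mset \<alpha> \<subseteq> Basis \<longrightarrow> t \<le> snd p \<longrightarrow> G \<alpha> p = (\<Sum>i<n. T i \<alpha> p)"
            using fin[OF t] by blast
          then have "G (replicate_mset q (0, 1)) (x, t) = (\<Sum>i<n. v i q t * g i {#} x)" if "N \<le> n" for n x
            using RB that unfolding T[symmetric] by simp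
          then show ?thesis by (rule that)
        qed
        \<comment> \<open>At height t the extension is a finite sum, whereas f is only the L1 limit
          of its pieces. The remainder of f is therefore kept for every n and sent to 0
          afterwards.\<close>
        have step: "L1_norm (\<lambda>x. G (replicate_mset q (0, 1)) (x, t) - (if q = j then f x else 0))
            \<le> ennreal (\<Sum>i. \<bar>c i t\<bar> * \<nu> i) + L1_norm (\<lambda>x. f x - (\<Sum>i<n. g i {#} x))" if "N \<le> n" for n
        proof -
          have "G (replicate_mset q (0, 1)) (x, t) - (if q = j then f x else 0)
              = (\<Sum>i<n. c i t * g i {#} x) + (- ?d) * (f x - (\<Sum>i<n. g i {#} x))" for x
            unfolding N[OF that] c_def by (simp add: left_diff_distrib sum_subtractf)
          then have "L1_norm (\<lambda>x. G (replicate_mset q (0, 1)) (x, t) - (if q = j then f x else 0))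
              \<le> L1_norm (\<lambda>x. \<Sum>i<n. c i t * g i {#} x) + L1_norm (\<lambda>x. (- ?d) * (f x - (\<Sum>i<n. g i {#} x)))"
            by (simp only:) (intro L1_norm_add; measurable)
          also have "\<dots> \<le> ennreal (\<Sum>i. \<bar>c i t\<bar> * \<nu> i) + L1_norm (\<lambda>x. f x - (\<Sum>i<n. g i {#} x))"
          proof (rule add_mono)
            have "L1_norm (\<lambda>x. \<Sum>i<n. c i t * g i {#} x) \<le> (\<Sum>i<n. L1_norm (\<lambda>x. c i t * g i {#} x))"
              by (intro L1_norm_sum) measurable
            also have "\<dots> = (\<Sum>i<n. ennreal (\<bar>c i t\<bar> * \<nu> i))"
              by (simp add: L1_norm_cmult \<nu> ennreal_mult)
            also have "\<dots> = ennreal (\<Sum>i<n. \<bar>c i t\<bar> * \<nu> i)" by (intro sum_ennreal) (simp add: \<nu>)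
            also have "\<dots> \<le> ennreal (\<Sum>i. \<bar>c i t\<bar> * \<nu> i)"
              by (intro ennreal_leI sum_le_suminf sm) (auto simp: \<nu>)
            finally show "L1_norm (\<lambda>x. \<Sum>i<n. c i t * g i {#} x) \<le> ennreal (\<Sum>i. \<bar>c i t\<bar> * \<nu> i)" .
            have "L1_norm (\<lambda>x. (- ?d) * (f x - (\<Sum>i<n. g i {#} x))) = ennreal \<bar>- ?d\<bar> * L1_norm (\<lambda>x. f x - (\<Sum>i<n. g i {#} x))"
              by (rule L1_norm_cmult) measurable
            also have "\<dots> \<le> L1_norm (\<lambda>x. f x - (\<Sum>i<n. g i {#} x))" by simp
            finally show "L1_norm (\<lambda>x. (- ?d) * (f x - (\<Sum>i<n. g i {#} x))) \<le> L1_norm (\<lambda>x. f x - (\<Sum>i<n. g i {#} x))" .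
          qed
          finally show ?thesis .
        qed
        have "(\<lambda>n. ennreal (\<Sum>i. \<bar>c i t\<bar> * \<nu> i) + L1_norm (\<lambda>x. f x - (\<Sum>i<n. g i {#} x))) \<longlonglongrightarrow> ennreal (\<Sum>i. \<bar>c i t\<bar> * \<nu> i) + 0"
          by (intro tendsto_add tendsto_const conv)
        then have "L1_norm (\<lambda>x. G (replicate_mset q (0, 1)) (x, t) - (if q = j then f x else 0)) \<le> ennreal (\<Sum>i. \<bar>c i t\<bar> * \<nu> i) + 0"
          by (rule LIMSEQ_le_const) (use step in blast)
        then show ?thesis by simp
      qed
      have "integrable lborel (\<lambda>x. G (replicate_mset q (0, 1)) (x, t))" if t: "0 < t" for t
      proof -
        obtain n where "\<forall>\<alpha> p. set_mset \<alpha> \<subseteq> Basis \<longrightarrow> t \<le> snd p \<longrightarrow> G \<alpha> p = (\<Sum>i<n. T i \<alpha> p)"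
          using fin[OF t] by blast
        then have "(\<lambda>x. G (replicate_mset q (0, 1)) (x, t)) = (\<lambda>x. \<Sum>i<n. v i q t * g i {#} x)"
          using RB by (simp add: T)
        then show ?thesis using gi by simp
      qed
      moreover have "((\<lambda>t. L1_norm (\<lambda>x. G (replicate_mset q (0, 1)) (x, t) - (if q = j then f x else 0))) \<longlongrightarrow> 0) (at_right 0)"
      proof (rule tendsto_sandwich[OF _ _ tendsto_const])
        show "eventually (\<lambda>t. L1_norm (\<lambda>x. G (replicate_mset q (0, 1)) (x, t) - (if q = j then f x else 0)) \<le> ennreal (\<Sum>i. \<bar>c i t\<bar> * \<nu> i)) (at_right 0)"
          using le by (auto simp: eventually_at_filter)
        show "((\<lambda>t. ennreal (\<Sum>i. \<bar>c i t\<bar> * \<nu> i)) \<longlongrightarrow> 0) (at_right 0)"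
          using tendsto_ennrealI[OF slim] by simp
      qed simp
      ultimately show ?thesis by blast
    qed
    show "\<exists>G. trace_extension m a j f (ennreal C * B) G"
      unfolding trace_extension_def
      by (intro exI[of _ G] conjI allI ballI impI) (simp_all only: Gm wp norm trace)
  qed
qed

section \<open>Assembly of the extension: weighted norms, traces and the sum over j\<close>

lemma besov_integrable:
  assumes "f \<in> besov s"
  shows "integrable lebesgue f" and "besov_norm s f < \<infinity>"
proof -
  show i: "integrable lebesgue f"
    using assms sobolev_weak_deriv_integrable(1) by (auto simp: besov_def split: if_splits)
  then have "L1_norm f < \<infinity>" by (simp add: L1_norm_def integrable_iff_bounded)
  then show "besov_norm s f < \<infinity>"
    using assms by (auto simp: besov_def besov_norm_def sobolev_def split: if_splits)
qed

lemma norm_nabla_le_sum: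
  fixes u :: "'a::euclidean_space \<Rightarrow> real"
  shows "norm_nabla \<Omega> j u x \<le> (\<Sum>bs | set bs \<subseteq> Basis \<and> length bs = j. \<bar>weak_deriv \<Omega> (mset bs) u x\<bar>)"
  using L2_set_le_sum_abs[of "\<lambda>bs. weak_deriv \<Omega> (mset bs) u x"] by (simp add: norm_nabla_def L2_set_def)

text \<open>\<open>norm_nabla\<close> is built from derivatives picked by choice; uniqueness almost
  everywhere replaces them by the family H. The factor n counts the function itself and one entry
  for each list of directions of length 1 to k.\<close>

lemma weighted_sobolev_of_family:
  fixes H :: "('a::euclidean_space \<times> real) multiset \<Rightarrow> 'a \<times> real \<Rightarrow> real"
  assumes Hm: "\<And>\<alpha>. H \<alpha> \<in> borel_measurable borel"
    and wp: "\<And>\<alpha> c. c \<in> Basis \<Longrightarrow> size \<alpha> < k \<Longrightarrow> weak_partial halfspace c (H \<alpha>) (H (add_mset c \<alpha>))"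
    and norm: "\<And>\<alpha>. size \<alpha> \<le> k \<Longrightarrow>
      (\<integral>\<^sup>+p. indicator halfspace p * ennreal (snd p powr a * \<bar>H \<alpha> p\<bar>) \<partial>lborel) \<le> K"
    and K: "K < \<infinity>"
  defines "n \<equiv> 1 + (\<Sum>j=1..k. card {bs. set bs \<subseteq> (Basis :: ('a \<times> real) set) \<and> length bs = j})"
  shows "\<And>\<alpha>. set_mset \<alpha> \<subseteq> Basis \<Longrightarrow> size \<alpha> \<le> k \<Longrightarrow> has_weak_deriv halfspace \<alpha> (H {#}) (H \<alpha>)"
    and "weighted_sobolev_norm a k (H {#}) \<le> of_nat n * K"
    and "H {#} \<in> weighted_sobolev a k"
proof -
  have loc: "locally_integrable halfspace (H \<alpha>)" if "size \<alpha> \<le> k" for \<alpha>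
    by (rule locally_integrable_weighted[OF Hm le_less_trans[OF norm[OF that] K]])
  show hw: "has_weak_deriv halfspace \<alpha> (H {#}) (H \<alpha>)" if "set_mset \<alpha> \<subseteq> Basis" "size \<alpha> \<le> k" for \<alpha>
    by (rule has_weak_deriv_family[OF Hm loc wp that])
  have w: "(case p of (x, t) \<Rightarrow> t powr a) = snd p powr a" for p :: "'a \<times> real"
    by (simp add: case_prod_beta)
  have I: "(\<integral>\<^sup>+p\<in>halfspace. ennreal ((case p of (x, t) \<Rightarrow> t powr a) * u p) \<partial>lebesgue)
      = (\<integral>\<^sup>+p. indicator halfspace p * ennreal (snd p powr a * u p) \<partial>lborel)" for u :: "'a \<times> real \<Rightarrow> real"
    unfolding w nn_integral_completion by (simp add: mult.commute)
  have nabla: "(\<integral>\<^sup>+p\<in>halfspace. ennreal ((case p of (x, t) \<Rightarrow> t powr a) * norm_nabla halfspace j (H {#}) p) \<partial>lebesgue)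
      \<le> of_nat (card {bs. set bs \<subseteq> (Basis :: ('a \<times> real) set) \<and> length bs = j}) * K" if j: "j \<le> k" for j
  proof -
    let ?L = "{bs. set bs \<subseteq> (Basis :: ('a \<times> real) set) \<and> length bs = j}"
    have finL: "finite ?L" by (rule finite_lists_length_eq) simp
    have "AE p in lebesgue. \<forall>bs\<in>?L. p \<in> halfspace \<longrightarrow> weak_deriv halfspace (mset bs) (H {#}) p = H (mset bs) p"
      using finL j by (subst AE_ball_countable) (auto intro!: weak_deriv_AE open_halfspace hw countable_finite)
    then have ae: "AE p in lborel. \<forall>bs\<in>?L. p \<in> halfspace \<longrightarrow> weak_deriv halfspace (mset bs) (H {#}) p = H (mset bs) p"
      by (simp add: AE_completion_iff)
    have [measurable]: "(snd :: 'a \<times> real \<Rightarrow> real) \<in> borel_measurable borel"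
      by (intro borel_measurable_continuous_onI continuous_intros)
    note Hm [measurable]
    have "(\<integral>\<^sup>+p. indicator halfspace p * ennreal (snd p powr a * norm_nabla halfspace j (H {#}) p) \<partial>lborel)
      \<le> (\<integral>\<^sup>+p. (\<Sum>bs\<in>?L. indicator halfspace p * ennreal (snd p powr a * \<bar>H (mset bs) p\<bar>)) \<partial>lborel)"
    proof (rule nn_integral_mono_AE)
      show "AE p in lborel. indicator halfspace p * ennreal (snd p powr a * norm_nabla halfspace j (H {#}) p)
          \<le> (\<Sum>bs\<in>?L. indicator halfspace p * ennreal (snd p powr a * \<bar>H (mset bs) p\<bar>))"
        using ae
      proof eventually_elim
        case (elim p)
        show ?case
        proof (cases "p \<in> halfspace")
          case True
          have "norm_nabla halfspace j (H {#}) p \<le> (\<Sum>bs\<in>?L. \<bar>H (mset bs) p\<bar>)"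
            by (rule order_trans[OF norm_nabla_le_sum]) (intro sum_mono, use elim True in auto)
          then have "snd p powr a * norm_nabla halfspace j (H {#}) p \<le> snd p powr a * (\<Sum>bs\<in>?L. \<bar>H (mset bs) p\<bar>)"
            by (rule mult_left_mono) simp
          then have "ennreal (snd p powr a * norm_nabla halfspace j (H {#}) p) \<le> ennreal (\<Sum>bs\<in>?L. snd p powr a * \<bar>H (mset bs) p\<bar>)"
            by (intro ennreal_leI) (simp add: sum_distrib_left)
          also have "\<dots> = (\<Sum>bs\<in>?L. ennreal (snd p powr a * \<bar>H (mset bs) p\<bar>))"
            by (intro sum_ennreal[symmetric]) simp
          finally show ?thesis using True by simp
        qed simp
      qed
    qed
    also have "\<dots> = (\<Sum>bs\<in>?L. \<integral>\<^sup>+p. indicator halfspace p * ennreal (snd p powr a * \<bar>H (mset bs) p\<bar>) \<partial>lborel)"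
      by (rule nn_integral_sum) measurable
    also have "\<dots> \<le> (\<Sum>bs\<in>?L. K)"
      using j by (intro sum_mono norm) auto
    finally show ?thesis unfolding I by simp
  qed
  have "weighted_sobolev_norm a k (H {#}) \<le> K + (\<Sum>j=1..k. of_nat (card {bs. set bs \<subseteq> (Basis :: ('a \<times> real) set) \<and> length bs = j}) * K)"
    unfolding sobolev_norm_def
  proof (intro add_mono sum_mono nabla)
    show "(\<integral>\<^sup>+p\<in>halfspace. ennreal ((case p of (x, t) \<Rightarrow> t powr a) * \<bar>H {#} p\<bar>) \<partial>lebesgue) \<le> K"
      unfolding I using norm[of "{#}"] by simp
  qed simp
  also have "\<dots> = of_nat n * K"
    by (simp add: n_def sum_distrib_right distrib_right)
  finally show le: "weighted_sobolev_norm a k (H {#}) \<le> of_nat n * K" .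
  have "of_nat n * K < \<infinity>" using K by (simp add: ennreal_mult_less_top of_nat_less_top)
  with le have "weighted_sobolev_norm a k (H {#}) < \<infinity>" by (rule le_less_trans)
  then show "H {#} \<in> weighted_sobolev a k"
    using loc[of "{#}"] hw by (auto simp: sobolev_def sobolev_loc_def multi_indices_def)
qed

text \<open>w is the representative whose slices are meaningful at each positive height. Convergence
  in L1 of the whole space bounds the integrals over compact sets.\<close>

lemma has_trace_of_L1_limit:
  fixes w :: "'a::euclidean_space \<times> real \<Rightarrow> real"
  assumes ae: "AE p in lebesgue. p \<in> halfspace \<longrightarrow> v p = w p"
    and slice: "\<And>t. 0 < t \<Longrightarrow> integrable lborel (\<lambda>x. w (x, t))"
    and g: "integrable lebesgue g" and g': "integrable lborel g'" "AE x in lebesgue. g x = g' x"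
    and lim: "((\<lambda>t. L1_norm (\<lambda>x. w (x, t) - g' x)) \<longlongrightarrow> 0) (at_right 0)"
  shows "has_trace v g"
  unfolding has_trace_def tendsto_L1_loc_def
proof (intro exI[of _ w] conjI allI impI)
  show "AE p in lebesgue. p \<in> halfspace \<longrightarrow> w p = v p" using ae by eventually_elim simp
  show "locally_integrable UNIV g"
    unfolding locally_integrable_def
  proof (intro allI impI)
    fix K :: "'a set" assume "compact K \<and> K \<subseteq> UNIV"
    then have "K \<in> sets lebesgue" by (simp add: fmeasurableD lmeasurable_compact)
    then show "g absolutely_integrable_on K"
      unfolding set_integrable_def using g by (intro integrable_mult_indicator)
  qed
  show "\<forall>\<^sub>F t in at_right 0. locally_integrable UNIV (\<lambda>x. w (x, t))"
    using integrable_locally_integrable[OF slice] by (auto simp: eventually_at_filter)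
  fix K :: "'a set" assume "compact K"
  then have K: "K \<in> sets lebesgue" by (simp add: fmeasurableD lmeasurable_compact)
  show "((\<lambda>t. LINT x:K|lebesgue. \<bar>w (x, t) - g x\<bar>) \<longlongrightarrow> 0) (at_right 0)"
  proof (rule tendsto_sandwich[OF _ _ tendsto_const])
    show "\<forall>\<^sub>F t in at_right 0. 0 \<le> (LINT x:K|lebesgue. \<bar>w (x, t) - g x\<bar>)"
      by (intro always_eventually allI) (simp add: set_lebesgue_integral_def)
    show "\<forall>\<^sub>F t in at_right 0. (LINT x:K|lebesgue. \<bar>w (x, t) - g x\<bar>) \<le> enn2real (L1_norm (\<lambda>x. w (x, t) - g' x))"
    proof -
      have "(LINT x:K|lebesgue. \<bar>w (x, t) - g x\<bar>) \<le> enn2real (L1_norm (\<lambda>x. w (x, t) - g' x))" if t: "0 < t" for t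
      proof -
        have "integrable lebesgue (\<lambda>x. w (x, t))"
          using slice[OF t] by (subst integrable_completion) auto
        then have i: "integrable lebesgue (\<lambda>x. \<bar>w (x, t) - g x\<bar>)" using g by auto
        have "(LINT x:K|lebesgue. \<bar>w (x, t) - g x\<bar>) \<le> (\<integral>x. \<bar>w (x, t) - g x\<bar> \<partial>lebesgue)"
          unfolding set_lebesgue_integral_def
          by (rule integral_mono[OF integrable_mult_indicator[OF K i] i]) (simp add: indicator_def)
        also have "\<dots> = enn2real (L1_norm (\<lambda>x. w (x, t) - g x))"
          unfolding L1_norm_def using i by (intro integral_eq_nn_integral) auto
        also have "L1_norm (\<lambda>x. w (x, t) - g x) = L1_norm (\<lambda>x. w (x, t) - g' x)"
          by (rule L1_norm_cong_AE) (use g'(2) in eventually_elim, simp)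
        finally show ?thesis .
      qed
      then show ?thesis by (auto simp: eventually_at_filter)
    qed
    show "((\<lambda>t. enn2real (L1_norm (\<lambda>x. w (x, t) - g' x))) \<longlongrightarrow> 0) (at_right 0)"
      by (rule tendsto_enn2real) (use lim in simp_all)
  qed
qed

text \<open>Both cases of the theorem are instances; they differ in the data space for the last j,
  where s may be 0. The extension is the sum over j of the separate extensions.\<close>

lemma weighted_extension:
  fixes m n :: nat and a :: real and X :: "nat \<Rightarrow> ('a::euclidean_space \<Rightarrow> real) set"
    and nrm :: "nat \<Rightarrow> ('a \<Rightarrow> real) \<Rightarrow> ennreal"
  assumes a: "-1 < a" and n: "real n \<le> real m - a"
    and X: "\<And>j f. j \<le> n \<Longrightarrow> f \<in> X j \<Longrightarrow> integrable lebesgue f \<and> nrm j f < \<infinity>"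
    and dec: "\<And>j. j \<le> n \<Longrightarrow> \<exists>C>0. \<forall>f\<in>X j. scale_decomposition (m + 1) (real m - a - real j) f (ennreal C * nrm j f)"
  shows "\<exists>C>0. \<forall>f. (\<forall>j\<le>n. f j \<in> X j) \<longrightarrow>
    (\<exists>F \<in> weighted_sobolev a (m + 1). has_trace F (f 0) \<and>
       (\<forall>j\<in>{1..n}. has_trace (t_deriv j F) (f j)) \<and>
       weighted_sobolev_norm a (m + 1) F \<le> ennreal C * (\<Sum>j\<le>n. nrm j (f j)))"
proof -
  obtain C1 where C1: "\<And>j. j \<le> n \<Longrightarrow> 0 < C1 j"
    "\<And>j f. j \<le> n \<Longrightarrow> f \<in> X j \<Longrightarrow> scale_decomposition (m + 1) (real m - a - real j) f (ennreal (C1 j) * nrm j f)"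
    using dec by metis
  have "\<exists>C>0. \<forall>(f :: 'a \<Rightarrow> real) B. integrable lborel f \<longrightarrow>
      scale_decomposition (m + 1) (real m - a - real j) f B \<longrightarrow> B < \<infinity> \<longrightarrow>
      (\<exists>G. trace_extension m a j f (ennreal C * B) G)" if "j \<le> n" for j
    by (rule scale_extension[OF a refl]) (use n that in simp)
  then obtain C2 where C2: "\<And>j. j \<le> n \<Longrightarrow> 0 < C2 j"
    and ext: "\<And>j (f :: 'a \<Rightarrow> real) B. j \<le> n \<Longrightarrow> integrable lborel f \<Longrightarrow>
      scale_decomposition (m + 1) (real m - a - real j) f B \<Longrightarrow> B < \<infinity> \<Longrightarrow>
      \<exists>G. trace_extension m a j f (ennreal (C2 j) * B) G" by metis
  \<comment> \<open>The factor n of \<open>weighted_sobolev_of_family\<close> for k = m + 1.\<close>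
  define N where "N = 1 + (\<Sum>j=1..m + 1. card {bs. set bs \<subseteq> (Basis :: ('a \<times> real) set) \<and> length bs = j})"
  \<comment> \<open>The sum of the products dominates each of them, so one constant serves all
    j.\<close>
  define C where "C = real N * (\<Sum>j\<le>n. C2 j * C1 j)"
  have pos: "0 < C2 j * C1 j" if "j \<le> n" for j using C1(1)[OF that] C2[OF that] by simp
  have "0 < N" by (simp add: N_def)
  then have "0 < C" unfolding C_def by (intro mult_pos_pos sum_pos pos) auto
  moreover have "\<exists>F \<in> weighted_sobolev a (m + 1). has_trace F (f 0) \<and>
       (\<forall>j\<in>{1..n}. has_trace (t_deriv j F) (f j)) \<and>
       weighted_sobolev_norm a (m + 1) F \<le> ennreal C * (\<Sum>j\<le>n. nrm j (f j))"
    if f: "\<forall>j\<le>n. f j \<in> X j" for f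
  proof -
    have fi: "integrable lebesgue (f j)" "nrm j (f j) < \<infinity>" if "j \<le> n" for j
      using X[OF that] f that by auto
    have "\<exists>f'. integrable lborel f' \<and> (AE x in lebesgue. f j x = f' x)" if "j \<le> n" for j
      using integrable_lebesgue_borel_representative[OF fi(1)[OF that]] by metis
    then obtain f' where f': "\<And>j. j \<le> n \<Longrightarrow> integrable lborel (f' j)"
      "\<And>j. j \<le> n \<Longrightarrow> AE x in lebesgue. f j x = f' j x" by metis
    let ?B = "\<lambda>j. ennreal (C1 j) * nrm j (f j)"
    have Bfin: "?B j < \<infinity>" if "j \<le> n" for j using fi(2)[OF that] by (simp add: ennreal_mult_less_top)
    have d': "scale_decomposition (m + 1) (real m - a - real j) (f' j) (?B j)" if j: "j \<le> n" for j
    proof (rule scale_decomposition_cong_AE[OF C1(2)[OF j] _ order_refl])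
      show "f j \<in> X j" using f j by blast
      show "AE x in lebesgue. f' j x = f j x" using f'(2)[OF j] by eventually_elim simp
    qed
    have "\<exists>G. trace_extension m a j (f' j) (ennreal (C2 j) * ?B j) G" if "j \<le> n" for j
      by (rule ext[OF that f'(1)[OF that] d'[OF that] Bfin[OF that]])
    then obtain G where G: "\<And>j. j \<le> n \<Longrightarrow> trace_extension m a j (f' j) (ennreal (C2 j) * ?B j) (G j)" by metis
    have Gm: "G j \<alpha> \<in> borel_measurable borel" if "j \<le> n" for j \<alpha> using G[of j] that by (simp add: trace_extension_def)
    have Gw: "weak_partial halfspace c (G j \<alpha>) (G j (add_mset c \<alpha>))" if "j \<le> n" "c \<in> Basis" "size \<alpha> \<le> m" for j c \<alpha>
      using G[of j] that by (simp add: trace_extension_def)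
    have Gn: "(\<integral>\<^sup>+p. indicator halfspace p * ennreal (snd p powr a * \<bar>G j \<alpha> p\<bar>) \<partial>lborel) \<le> ennreal (C2 j) * ?B j"
      if "j \<le> n" "size \<alpha> \<le> m + 1" for j \<alpha> using G[of j] that by (simp add: trace_extension_def)
    have Gs: "integrable lborel (\<lambda>x. G j (replicate_mset q (0, 1)) (x, t))"
      if "j \<le> n" "real q \<le> real m - a" "0 < t" for j q t using G[of j] that by (simp add: trace_extension_def)
    have Gt: "((\<lambda>t. L1_norm (\<lambda>x. G j (replicate_mset q (0, 1)) (x, t) - (if q = j then f' j x else 0))) \<longlongrightarrow> 0) (at_right 0)"
      if "j \<le> n" "real q \<le> real m - a" for j q using G[of j] that by (simp add: trace_extension_def)
    have Gl: "locally_integrable halfspace (G j \<alpha>)" if j: "j \<le> n" and "size \<alpha> \<le> m + 1" for j \<alpha>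
    proof (rule locally_integrable_weighted[OF Gm[OF j]])
      have "ennreal (C2 j) * ?B j < \<infinity>" using Bfin[OF j] by (simp add: ennreal_mult_less_top)
      then show "(\<integral>\<^sup>+p. indicator halfspace p * ennreal (snd p powr a * \<bar>G j \<alpha> p\<bar>) \<partial>lborel) < \<infinity>"
        using Gn[OF that] by (rule le_less_trans[rotated])
    qed
    have Gi: "integrable lborel (\<lambda>p. G j \<alpha> p * \<phi> p)"
      if j: "j \<le> n" "size \<alpha> \<le> m + 1" and \<phi>: "\<phi> \<in> test_fun halfspace" for j \<alpha> \<phi>
    proof -
      have "(\<lambda>p. G j \<alpha> p * \<phi> p) \<in> borel_measurable lborel"
        using Gm[OF j(1)] test_fun_borel[OF \<phi>] by simp
      then show ?thesis using locally_integrable_test_fun[OF Gl[OF j] \<phi>] by (simp add: integrable_completion)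
    qed
    define H where "H \<alpha> p = (\<Sum>j\<le>n. G j \<alpha> p)" for \<alpha> p
    have Hm: "H \<alpha> \<in> borel_measurable borel" for \<alpha>
      unfolding H_def[abs_def] using Gm by (intro borel_measurable_sum) auto
    have Hw: "weak_partial halfspace c (H \<alpha>) (H (add_mset c \<alpha>))" if c: "c \<in> Basis" and sz: "size \<alpha> < m + 1" for c \<alpha>
      unfolding weak_partial_def
    proof
      fix \<phi> :: "'a \<times> real \<Rightarrow> real" assume \<phi>: "\<phi> \<in> test_fun halfspace"
      have "(\<integral>p. H \<alpha> p * partial_deriv c \<phi> p \<partial>lborel) = (\<Sum>j\<le>n. \<integral>p. G j \<alpha> p * partial_deriv c \<phi> p \<partial>lborel)"
        unfolding H_def sum_distrib_right using sz
        by (intro Bochner_Integration.integral_sum Gi test_fun_partial_deriv \<phi> c) auto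
      also have "\<dots> = (\<Sum>j\<le>n. - (\<integral>p. G j (add_mset c \<alpha>) p * \<phi> p \<partial>lborel))"
        using Gw[OF _ c, of _ \<alpha>] sz \<phi> by (intro sum.cong refl) (auto simp: weak_partial_def)
      also have "\<dots> = - (\<integral>p. H (add_mset c \<alpha>) p * \<phi> p \<partial>lborel)"
        unfolding H_def sum_distrib_right using sz
        by (subst Bochner_Integration.integral_sum) (auto intro!: Gi \<phi> simp: sum_negf)
      finally show "(\<integral>p. H \<alpha> p * partial_deriv c \<phi> p \<partial>lborel) = - (\<integral>p. H (add_mset c \<alpha>) p * \<phi> p \<partial>lborel)" .
    qed
    define K where "K = (\<Sum>j\<le>n. ennreal (C2 j) * ?B j)"
    have K: "K < \<infinity>" unfolding K_def using Bfin by (auto simp: ennreal_mult_less_top)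
    have Hn: "(\<integral>\<^sup>+p. indicator halfspace p * ennreal (snd p powr a * \<bar>H \<alpha> p\<bar>) \<partial>lborel) \<le> K" if sz: "size \<alpha> \<le> m + 1" for \<alpha>
    proof -
      have [measurable]: "(snd :: 'a \<times> real \<Rightarrow> real) \<in> borel_measurable borel"
        by (intro borel_measurable_continuous_onI continuous_intros)
      have "(\<integral>\<^sup>+p. indicator halfspace p * ennreal (snd p powr a * \<bar>H \<alpha> p\<bar>) \<partial>lborel)
          \<le> (\<integral>\<^sup>+p. (\<Sum>j\<le>n. indicator halfspace p * ennreal (snd p powr a * \<bar>G j \<alpha> p\<bar>)) \<partial>lborel)"
      proof (intro nn_integral_mono)
        fix p :: "'a \<times> real"
        have "snd p powr a * \<bar>H \<alpha> p\<bar> \<le> (\<Sum>j\<le>n. snd p powr a * \<bar>G j \<alpha> p\<bar>)"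
          unfolding H_def sum_distrib_left[symmetric] by (intro mult_left_mono sum_abs) simp
        then have "ennreal (snd p powr a * \<bar>H \<alpha> p\<bar>) \<le> (\<Sum>j\<le>n. ennreal (snd p powr a * \<bar>G j \<alpha> p\<bar>))"
          by (simp add: ennreal_leI sum_ennreal)
        then show "indicator halfspace p * ennreal (snd p powr a * \<bar>H \<alpha> p\<bar>)
            \<le> (\<Sum>j\<le>n. indicator halfspace p * ennreal (snd p powr a * \<bar>G j \<alpha> p\<bar>))"
          by (cases "p \<in> halfspace") auto
      qed
      also have "\<dots> = (\<Sum>j\<le>n. \<integral>\<^sup>+p. indicator halfspace p * ennreal (snd p powr a * \<bar>G j \<alpha> p\<bar>) \<partial>lborel)"
      proof (rule nn_integral_sum)
        fix j assume "j \<in> {..n}"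
        then have [measurable]: "G j \<alpha> \<in> borel_measurable borel" using Gm by simp
        show "(\<lambda>p. indicator halfspace p * ennreal (snd p powr a * \<bar>G j \<alpha> p\<bar>)) \<in> borel_measurable lborel"
          by measurable
      qed
      also have "\<dots> \<le> K" unfolding K_def using sz by (intro sum_mono Gn) auto
      finally show ?thesis .
    qed
    note W = weighted_sobolev_of_family[where H = H and k = "m + 1", OF Hm Hw Hn K, folded N_def]
    have tr: "has_trace v (f q)"
      if q: "q \<le> n" and v: "AE p in lebesgue. p \<in> halfspace \<longrightarrow> v p = H (replicate_mset q (0, 1)) p" for q v
    proof -
      have qr: "real q \<le> real m - a" using q n by linarith
      show ?thesis
      proof (rule has_trace_of_L1_limit[OF v _ fi(1)[OF q] f'(1)[OF q] f'(2)[OF q]])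
        show "integrable lborel (\<lambda>x. H (replicate_mset q (0, 1)) (x, t))" if "0 < t" for t
          unfolding H_def using Gs[OF _ qr that] by (intro Bochner_Integration.integrable_sum) auto
        let ?e = "\<lambda>j t x. G j (replicate_mset q (0, 1)) (x, t) - (if q = j then f' j x else 0)"
        show "((\<lambda>t. L1_norm (\<lambda>x. H (replicate_mset q (0, 1)) (x, t) - f' q x)) \<longlongrightarrow> 0) (at_right 0)"
        proof (rule tendsto_sandwich[OF _ _ tendsto_const])
          have "L1_norm (\<lambda>x. H (replicate_mset q (0, 1)) (x, t) - f' q x) \<le> (\<Sum>j\<le>n. L1_norm (?e j t))" if t: "0 < t" for t
          proof -
            \<comment> \<open>Exactly one of the n + 1 summands carries f' q; the others have trace
              0 at order q.\<close>
            have "(\<lambda>x. H (replicate_mset q (0, 1)) (x, t) - f' q x) = (\<lambda>x. \<Sum>j\<le>n. ?e j t x)"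
              using q by (simp add: H_def sum_subtractf fun_eq_iff)
            moreover have "?e j t \<in> borel_measurable borel" if "j \<le> n" for j
              using Gs[OF that qr t] f'(1)[OF that] by (cases "q = j") auto
            ultimately show ?thesis by (simp only:) (intro L1_norm_sum, simp)
          qed
          then show "\<forall>\<^sub>F t in at_right 0. L1_norm (\<lambda>x. H (replicate_mset q (0, 1)) (x, t) - f' q x) \<le> (\<Sum>j\<le>n. L1_norm (?e j t))"
            by (auto simp: eventually_at_filter)
          have "((\<lambda>t. \<Sum>j\<le>n. L1_norm (?e j t)) \<longlongrightarrow> (\<Sum>j\<le>n. 0)) (at_right 0)"
            using Gt[OF _ qr] by (intro tendsto_sum) auto
          then show "((\<lambda>t. \<Sum>j\<le>n. L1_norm (?e j t)) \<longlongrightarrow> 0) (at_right 0)" by simp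
        qed simp
      qed
    qed
    have "weighted_sobolev_norm a (m + 1) (H {#}) \<le> of_nat N * K" by (rule W(2))
    also have "\<dots> \<le> ennreal (real N) * (\<Sum>j\<le>n. ennreal (\<Sum>j\<le>n. C2 j * C1 j) * nrm j (f j))"
    proof -
      have "K \<le> (\<Sum>j\<le>n. ennreal (\<Sum>j\<le>n. C2 j * C1 j) * nrm j (f j))"
        unfolding K_def
      proof (intro sum_mono)
        fix j assume "j \<in> {..n}"
        then have j: "j \<le> n" by simp
        have "C2 j * C1 j \<le> (\<Sum>j\<le>n. C2 j * C1 j)"
          using j pos by (intro member_le_sum) (auto intro: less_imp_le)
        then have "ennreal (C2 j * C1 j) * nrm j (f j) \<le> ennreal (\<Sum>j\<le>n. C2 j * C1 j) * nrm j (f j)"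
          by (intro mult_right_mono ennreal_leI) auto
        then show "ennreal (C2 j) * ?B j \<le> ennreal (\<Sum>j\<le>n. C2 j * C1 j) * nrm j (f j)"
          using C1(1)[OF j] C2[OF j] by (simp add: ennreal_mult mult.assoc)
      qed
      then show ?thesis by (simp add: ennreal_of_nat_eq_real_of_nat mult_left_mono)
    qed
    also have "\<dots> = ennreal C * (\<Sum>j\<le>n. nrm j (f j))"
    proof -
      have "ennreal C = ennreal (real N) * ennreal (\<Sum>j\<le>n. C2 j * C1 j)"
        unfolding C_def using pos by (intro ennreal_mult sum_nonneg) (auto intro: less_imp_le)
      then show ?thesis by (simp add: sum_distrib_left mult.assoc)
    qed
    finally have norm: "weighted_sobolev_norm a (m + 1) (H {#}) \<le> ennreal C * (\<Sum>j\<le>n. nrm j (f j))" .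
    have "has_trace (t_deriv j (H {#})) (f j)" if j: "j \<in> {1..n}" for j
    proof (rule tr)
      show "j \<le> n" using j by simp
      \<comment> \<open>As n <= m - a and a > -1, the derivatives taken here have order at most m,
        hence belong to the family.\<close>
      have "real n < real m + 1" using n a by linarith
      then have "has_weak_deriv halfspace (replicate_mset j (0, 1)) (H {#}) (H (replicate_mset j (0, 1)))"
        using j by (intro W(1)) (auto simp: Basis_prod_def)
      then show "AE p in lebesgue. p \<in> halfspace \<longrightarrow> t_deriv j (H {#}) p = H (replicate_mset j (0, 1)) p"
        unfolding t_deriv_def by (rule weak_deriv_AE[OF open_halfspace])
    qed
    moreover have "has_trace (H {#}) (f 0)" by (rule tr) auto
    ultimately show ?thesis using W(3) norm by (intro bexI[of _ "H {#}"]) auto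
  qed
  ultimately show ?thesis by blast
qed

theorem theorem1p4:
  fixes m :: nat and a :: real
  assumes "1 \<le> m" and "-1 < a" and "a < real m"
  shows
    "(\<forall>k::nat. a = real k \<longrightarrow>
        (\<exists>C>0. \<forall>f :: nat \<Rightarrow> real ^ 'n \<Rightarrow> real.
           (\<forall>j<m - k. f j \<in> besov (real m - real k - real j)) \<and>
           integrable lebesgue (f (m - k)) \<longrightarrow>
           (\<exists>F \<in> weighted_sobolev (real k) (m + 1).
              has_trace F (f 0) \<and>
              (\<forall>j\<in>{1..m - k}. has_trace (t_deriv j F) (f j)) \<and>
              weighted_sobolev_norm (real k) (m + 1) F
                \<le> ennreal C * ((\<Sum>j<m - k. besov_norm (real m - real k - real j) (f j))
                                + L1_norm (f (m - k))))))
     \<and>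
     (a \<notin> \<nat> \<longrightarrow>
        (\<exists>C>0. \<forall>f :: nat \<Rightarrow> real ^ 'n \<Rightarrow> real.
           (\<forall>j\<le>nat \<lfloor>real m - a\<rfloor>. f j \<in> besov (real m - a - real j)) \<longrightarrow>
           (\<exists>F \<in> weighted_sobolev a (m + 1).
              has_trace F (f 0) \<and>
              (\<forall>j\<in>{1..nat \<lfloor>real m - a\<rfloor>}. has_trace (t_deriv j F) (f j)) \<and>
              weighted_sobolev_norm a (m + 1) F
                \<le> ennreal C * (\<Sum>j\<le>nat \<lfloor>real m - a\<rfloor>.
                                  besov_norm (real m - a - real j) (f j)))))"
proof (intro conjI allI impI)
  fix k :: nat assume k: "a = real k"
  let ?n = "m - k"
  have n: "real ?n = real m - real k" using assms k by simp
  \<comment> \<open>For j = m - k the smoothness s is 0, and the datum is merely integrable.\<close>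
  let ?X = "\<lambda>j. if j < ?n then besov (real m - real k - real j) else {f :: real ^ 'n \<Rightarrow> real. integrable lebesgue f}"
  let ?nrm = "\<lambda>j f :: real ^ 'n \<Rightarrow> real. if j < ?n then besov_norm (real m - real k - real j) f else L1_norm f"
  have "\<exists>C>0. \<forall>f :: nat \<Rightarrow> real ^ 'n \<Rightarrow> real. (\<forall>j\<le>?n. f j \<in> ?X j) \<longrightarrow>
    (\<exists>F \<in> weighted_sobolev (real k) (m + 1). has_trace F (f 0) \<and>
       (\<forall>j\<in>{1..?n}. has_trace (t_deriv j F) (f j)) \<and>
       weighted_sobolev_norm (real k) (m + 1) F \<le> ennreal C * (\<Sum>j\<le>?n. ?nrm j (f j)))"
  proof (rule weighted_extension)
    show "-1 < real k" "real ?n \<le> real m - real k" using n by auto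
    show "integrable lebesgue f \<and> ?nrm j f < \<infinity>" if "f \<in> ?X j" for j f
      using that besov_integrable[of f] by (auto simp: L1_norm_def integrable_iff_bounded split: if_splits)
    fix j assume j: "j \<le> ?n"
    show "\<exists>C>0. \<forall>f\<in>?X j. scale_decomposition (m + 1) (real m - real k - real j) f (ennreal C * ?nrm j f)"
    proof (cases "j < ?n")
      case True
      then have "0 < real m - real k - real j" using n by simp
      from scale_decomposition_besov[OF this] show ?thesis using True by simp
    next
      case False
      then have s: "real m - real k - real j = 0" using j n by simp
      have "scale_decomposition (m + 1) 0 f (ennreal 8 * L1_norm f)" if fi: "integrable lebesgue f" for f :: "real ^ 'n \<Rightarrow> real"
      proof -
        obtain f' where f': "integrable lborel f'" "AE x in lebesgue. f x = f' x"
          using integrable_lebesgue_borel_representative[OF fi] .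
        have "L1_norm f' = L1_norm f" by (rule L1_norm_cong_AE) (use f'(2) in eventually_elim, simp)
        then show ?thesis
          using scale_decomposition_cong_AE[OF scale_decomposition_L1[OF f'(1)] f'(2)] by simp
      qed
      then show ?thesis unfolding s using False by (intro exI[of _ 8]) auto
    qed
  qed
  then obtain C where C: "0 < C" and *: "\<And>f :: nat \<Rightarrow> real ^ 'n \<Rightarrow> real. (\<forall>j\<le>?n. f j \<in> ?X j) \<Longrightarrow>
    (\<exists>F \<in> weighted_sobolev (real k) (m + 1). has_trace F (f 0) \<and>
       (\<forall>j\<in>{1..?n}. has_trace (t_deriv j F) (f j)) \<and>
       weighted_sobolev_norm (real k) (m + 1) F \<le> ennreal C * (\<Sum>j\<le>?n. ?nrm j (f j)))" by blast
  have sum: "(\<Sum>j\<le>?n. ?nrm j (f j)) = (\<Sum>j<?n. besov_norm (real m - real k - real j) (f j)) + L1_norm (f ?n)"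
    for f :: "nat \<Rightarrow> real ^ 'n \<Rightarrow> real"
    by (simp add: lessThan_Suc_atMost[symmetric])
  show "\<exists>C>0. \<forall>f :: nat \<Rightarrow> real ^ 'n \<Rightarrow> real.
           (\<forall>j<m - k. f j \<in> besov (real m - real k - real j)) \<and>
           integrable lebesgue (f (m - k)) \<longrightarrow>
           (\<exists>F \<in> weighted_sobolev (real k) (m + 1).
              has_trace F (f 0) \<and>
              (\<forall>j\<in>{1..m - k}. has_trace (t_deriv j F) (f j)) \<and>
              weighted_sobolev_norm (real k) (m + 1) F
                \<le> ennreal C * ((\<Sum>j<m - k. besov_norm (real m - real k - real j) (f j))
                                + L1_norm (f (m - k))))"
  proof (intro exI[of _ C] conjI C allI impI)
    fix f :: "nat \<Rightarrow> real ^ 'n \<Rightarrow> real"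
    assume "(\<forall>j<m - k. f j \<in> besov (real m - real k - real j)) \<and> integrable lebesgue (f (m - k))"
    then have "\<forall>j\<le>?n. f j \<in> ?X j" by (auto simp: le_less)
    from *[OF this] show "\<exists>F \<in> weighted_sobolev (real k) (m + 1).
              has_trace F (f 0) \<and>
              (\<forall>j\<in>{1..m - k}. has_trace (t_deriv j F) (f j)) \<and>
              weighted_sobolev_norm (real k) (m + 1) F
                \<le> ennreal C * ((\<Sum>j<m - k. besov_norm (real m - real k - real j) (f j))
                                + L1_norm (f (m - k)))"
      unfolding sum .
  qed
next
  assume aN: "a \<notin> \<nat>"
  let ?n = "nat \<lfloor>real m - a\<rfloor>"
  have n: "real ?n \<le> real m - a" using assms by simp
  \<comment> \<open>Equality j = m - a would make a an integer, and a > -1 would make it a natural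
    number. So s = 0 does not occur and only Besov data are needed.\<close>
  have pos: "0 < real m - a - real j" if "j \<le> ?n" for j
  proof -
    have "real j \<le> real m - a" using that n by linarith
    moreover have "real j \<noteq> real m - a"
    proof
      assume e: "real j = real m - a"
      then have "real j \<le> real m + 1" using assms by simp
      then have "j \<le> m \<or> a = -1" using e assms by linarith
      then have "a = real (m - j)" using e assms by (auto simp: of_nat_diff)
      then show False using aN by simp
    qed
    ultimately show ?thesis by simp
  qed
  show "\<exists>C>0. \<forall>f :: nat \<Rightarrow> real ^ 'n \<Rightarrow> real.
           (\<forall>j\<le>nat \<lfloor>real m - a\<rfloor>. f j \<in> besov (real m - a - real j)) \<longrightarrow>
           (\<exists>F \<in> weighted_sobolev a (m + 1).
              has_trace F (f 0) \<and>
              (\<forall>j\<in>{1..nat \<lfloor>real m - a\<rfloor>}. has_trace (t_deriv j F) (f j)) \<and>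
              weighted_sobolev_norm a (m + 1) F
                \<le> ennreal C * (\<Sum>j\<le>nat \<lfloor>real m - a\<rfloor>.
                                  besov_norm (real m - a - real j) (f j)))"
  proof (rule weighted_extension[OF assms(2) n])
    show "integrable lebesgue f \<and> besov_norm (real m - a - real j) f < \<infinity>"
      if "f \<in> besov (real m - a - real j)" for j and f :: "real ^ 'n \<Rightarrow> real"
      using besov_integrable[OF that] by simp
    fix j assume "j \<le> ?n"
    then have "0 < real m - a - real j" by (rule pos)
    from scale_decomposition_besov[OF this]
    show "\<exists>C>0. \<forall>f\<in>besov (real m - a - real j). scale_decomposition (m + 1) (real m - a - real j) f
        (ennreal C * besov_norm (real m - a - real j) (f :: real ^ 'n \<Rightarrow> real))" .
  qed
qed

end
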